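(* Let $n=2$, let $\Omega\subset\mathbb{R}^2$ be a connected bounded open set with Lipschitz boundary, and let $a,\tilde a\in L^\infty(\Omega)$ with $0<m\le a,\tilde a\le M$. Let $F=\nabla f$ with $f\in C^1(\Omega)\cap C(\overline\Omega)$, $\|F\|_{L^1(\Omega)}\le k_1$. Suppose that $u$ and $\tilde u$ are admissible for $(a,F,H)$ and $(\tilde a,F,H)$ respectively (with constants $\sigma_0,\sigma_1,m,M$), with $u|_{\partial\Omega}=\tilde u|_{\partial\Omega}=0$ and coefficients $\sigma,\tilde\sigma$. Suppose $F\in C^2(\overline\Omega)$, $H\in C^1(\overline\Omega)$, $\sigma,\tilde\sigma\in C^2(\overline\Omega)$, and $$\|F\|_{C^2(\Omega)},\|H\|_{C^1(\Omega)}\le k_2,\qquad \|\sigma\|_{C^2(\Omega)},\|\tilde\sigma\|_{C^2(\Omega)}\le\sigma_2$$ for some $k_2,\sigma_2>0$. Let $v=u+f$. If $$\sup_{t\in\mathbb{R}}\int_{\{v=t\}\cap\Omega}dl=K<\infty$$ and the level sets of $v$ are well-structured with constant $\tilde K$, then $$\|\sigma-\tilde\sigma\|_{L^1(\Omega)}\le C\,\|a-\tilde a\|_{L^\infty(\Omega)}^{1/4}$$ for some constant $C=C(\Omega,m,M,k_1,k_2,K,\tilde K,\sigma_0,\sigma_1,\sigma_2)$ independent of $\tilde u$ and $\tilde\sigma$.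
   Context: Admissibility: fix $\sigma_0,\sigma_1>0$. For data $(a,F,H)$, $u\in C^1(\overline\Omega)$ is admissible if $u$ minimizes $\int_\Omega(a|Dw+F|+Hw)\,dx$ over $w\in H_0^1(\Omega)$ and there is $\sigma\in C(\Omega)$ with $0<\sigma_0\le\sigma\le\sigma_1$ such that $J=\sigma(\nabla u+F)$ and $m\le|J|\le M$. Here $J$ is the flux field of the problem (a solution of the dual problem of maximizing $\int_\Omega F\cdot b\,dx$ over $b\in L^2(\Omega;\mathbb{R}^n)$ with $|b|\le a$ a.e. and $\int_\Omega(\nabla w\cdot b+Hw)\,dx=0$ for all $w\in H^1_0(\Omega)$); thus $\nabla\cdot J=H$ weakly, $|J|=a$ and $\sigma=a/|\nabla u+F|$. Well-structured level sets ($n=2$): the level sets of $v$ are well-structured if, with a constant $\tilde K$, for a.e. $x\in\Omega$, every $h\in S^{1}$ and all sufficiently small $t\neq0$: if $\gamma$ is the arc-length parametrization of the level curve of $v$ through $x$, with $\gamma(0)\in\partial\Omega$ and $\gamma(s_0)=x$, then the level curve of $v$ through $x+th$ has a $C^1$ parametrization $\gamma_t$ with $\gamma_t(0)\in\partial\Omega$, $\gamma_t(s_0)=x+th$, such that $|\gamma_t'(s)-\gamma'(s)|\le\tilde K|t|$ for $s\in[0,s_0]$, and the limit $B_{x,h}(s)=\lim_{t\to0}\frac{\gamma_t(s)-\gamma(s)}{t}$ exists, with $B_{x,h}$ bounded uniformly in $x,h,s$. (In particular level curves of $v$ reach $\partial\Omega$.) *)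

theory Defs
  imports "HOL-Analysis.Analysis" "HOL-Probability.Essential_Supremum"
begin

section \<open>Classical derivatives and \<open>C\<^sup>k\<close> spaces in the plane\<close>

definition partial_deriv :: "2 \<Rightarrow> (real^2 \<Rightarrow> 'b::real_normed_vector) \<Rightarrow> real^2 \<Rightarrow> 'b" where
  "partial_deriv i f = (\<lambda>x. frechet_derivative f (at x) (axis i 1))"

definition multi_deriv :: "nat \<Rightarrow> nat \<Rightarrow> (real^2 \<Rightarrow> 'b::real_normed_vector) \<Rightarrow> real^2 \<Rightarrow> 'b" where
  "multi_deriv i j f = (partial_deriv 1 ^^ i) ((partial_deriv 2 ^^ j) f)"

definition grad :: "(real^2 \<Rightarrow> real) \<Rightarrow> real^2 \<Rightarrow> real^2" where
  "grad f x = (\<chi> i. partial_deriv i f x)"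

text \<open>Only used for open sets \<open>\<Omega>\<close>.\<close>

primrec Ck_on :: "nat \<Rightarrow> (real^2) set \<Rightarrow> (real^2 \<Rightarrow> 'b::real_normed_vector) \<Rightarrow> bool" where
  "Ck_on 0 \<Omega> f \<longleftrightarrow> continuous_on \<Omega> f"
| "Ck_on (Suc k) \<Omega> f \<longleftrightarrow> f differentiable_on \<Omega> \<and> (\<forall>i. Ck_on k \<Omega> (partial_deriv i f))"

text \<open>\<open>C\<^sup>k(closure \<Omega>)\<close>: the derivatives of order at most \<open>k\<close>, taken in the open set \<open>\<Omega>\<close>, have
  continuous extensions to the closure. The function itself carries its own boundary values.\<close>

definition Ck_closure :: "nat \<Rightarrow> (real^2) set \<Rightarrow> (real^2 \<Rightarrow> 'b::real_normed_vector) \<Rightarrow> bool" where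
  "Ck_closure k \<Omega> f \<longleftrightarrow>
     continuous_on (closure \<Omega>) f \<and> Ck_on k \<Omega> f \<and>
     (\<forall>i j. i + j \<le> k \<longrightarrow>
        (\<exists>g. continuous_on (closure \<Omega>) g \<and> (\<forall>x\<in>\<Omega>. g x = multi_deriv i j f x)))"

definition Ck_norm :: "nat \<Rightarrow> (real^2) set \<Rightarrow> (real^2 \<Rightarrow> 'b::real_normed_vector) \<Rightarrow> ennreal" where
  "Ck_norm k \<Omega> f = (\<Sum>i\<le>k. \<Sum>j\<le>k - i. SUP x\<in>\<Omega>. ennreal (norm (multi_deriv i j f x)))"

section \<open>Lebesgue norms and \<open>H\<^sub>0\<^sup>1\<close>\<close>

definition L1_norm :: "(real^2) set \<Rightarrow> (real^2 \<Rightarrow> 'b::real_normed_vector) \<Rightarrow> ennreal" where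
  "L1_norm \<Omega> f = (\<integral>\<^sup>+x. ennreal (norm (f x)) \<partial>lebesgue_on \<Omega>)"

definition L2_norm_sq :: "(real^2) set \<Rightarrow> (real^2 \<Rightarrow> 'b::real_normed_vector) \<Rightarrow> ennreal" where
  "L2_norm_sq \<Omega> f = (\<integral>\<^sup>+x. ennreal ((norm (f x))\<^sup>2) \<partial>lebesgue_on \<Omega>)"

definition Linf_norm :: "(real^2) set \<Rightarrow> (real^2 \<Rightarrow> 'b::real_normed_vector) \<Rightarrow> ennreal" where
  "Linf_norm \<Omega> f = esssup (lebesgue_on \<Omega>) (\<lambda>x. ennreal (norm (f x)))"

definition test_fun :: "(real^2) set \<Rightarrow> (real^2 \<Rightarrow> real) \<Rightarrow> bool" where
  "test_fun \<Omega> \<phi> \<longleftrightarrow> (\<forall>k. Ck_on k UNIV \<phi>) \<and>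
     compact (closure {x. \<phi> x \<noteq> 0}) \<and> closure {x. \<phi> x \<noteq> 0} \<subseteq> \<Omega>"

text \<open>\<open>H10 \<Omega> w Dw\<close> says that \<open>w\<close> lies in the closure of the test functions in the \<open>H\<^sup>1\<close> norm and
  that \<open>Dw\<close> is (a representative of) its weak gradient, i.e. the \<open>L\<^sup>2\<close> limit of the gradients.\<close>

definition H10 :: "(real^2) set \<Rightarrow> (real^2 \<Rightarrow> real) \<Rightarrow> (real^2 \<Rightarrow> real^2) \<Rightarrow> bool" where
  "H10 \<Omega> w Dw \<longleftrightarrow>
     w \<in> borel_measurable (lebesgue_on \<Omega>) \<and> Dw \<in> borel_measurable (lebesgue_on \<Omega>) \<and>
     (\<exists>\<phi>. (\<forall>k::nat. test_fun \<Omega> (\<phi> k)) \<and>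
        (\<lambda>k. L2_norm_sq \<Omega> (\<lambda>x. \<phi> k x - w x)) \<longlonglongrightarrow> 0 \<and>
        (\<lambda>k. L2_norm_sq \<Omega> (\<lambda>x. grad (\<phi> k) x - Dw x)) \<longlonglongrightarrow> 0)"

section \<open>Lipschitz boundary and length\<close>

text \<open>Near each boundary point, in suitable orthonormal coordinates with last axis \<open>e\<close>, the set is
  the strict epigraph of a Lipschitz function of the component orthogonal to \<open>e\<close>.\<close>

definition lipschitz_boundary :: "(real^2) set \<Rightarrow> bool" where
  "lipschitz_boundary \<Omega> \<longleftrightarrow>
     (\<forall>p\<in>frontier \<Omega>. \<exists>e r L \<phi>. norm e = 1 \<and> 0 < r \<and> L-lipschitz_on {y. y \<bullet> e = 0} \<phi> \<and>
        (\<forall>x\<in>ball p r. x \<in> \<Omega> \<longleftrightarrow> \<phi> (x - (x \<bullet> e) *\<^sub>R e) < x \<bullet> e))"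

text \<open>One-dimensional Hausdorff measure; the normalising constant is \<open>1\<close> in dimension one.
  Boundedness is needed because \<^const>\<open>diameter\<close> is not meaningful for unbounded sets.\<close>

definition hausdorff1 :: "(real^2) set \<Rightarrow> ennreal" where
  "hausdorff1 S = (SUP \<delta>\<in>{0<..}.
     INF U\<in>{U :: nat \<Rightarrow> (real^2) set. S \<subseteq> (\<Union>i. U i) \<and> (\<forall>i. bounded (U i) \<and> diameter (U i) \<le> \<delta>)}.
       \<Sum>i. ennreal (diameter (U i)))"

section \<open>Admissibility\<close>

definition primal_functional ::
  "(real^2) set \<Rightarrow> (real^2 \<Rightarrow> real) \<Rightarrow> (real^2 \<Rightarrow> real^2) \<Rightarrow> (real^2 \<Rightarrow> real)
     \<Rightarrow> (real^2 \<Rightarrow> real) \<Rightarrow> (real^2 \<Rightarrow> real^2) \<Rightarrow> real" where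
  "primal_functional \<Omega> a F H w Dw = (\<integral>x. a x * norm (Dw x + F x) + H x * w x \<partial>lebesgue_on \<Omega>)"

definition primal_solution ::
  "(real^2) set \<Rightarrow> (real^2 \<Rightarrow> real) \<Rightarrow> (real^2 \<Rightarrow> real^2) \<Rightarrow> (real^2 \<Rightarrow> real)
     \<Rightarrow> (real^2 \<Rightarrow> real) \<Rightarrow> (real^2 \<Rightarrow> real^2) \<Rightarrow> bool" where
  "primal_solution \<Omega> a F H u Du \<longleftrightarrow> H10 \<Omega> u Du \<and>
     (\<forall>w Dw. H10 \<Omega> w Dw \<longrightarrow> primal_functional \<Omega> a F H u Du \<le> primal_functional \<Omega> a F H w Dw)"

definition dual_feasible ::
  "(real^2) set \<Rightarrow> (real^2 \<Rightarrow> real) \<Rightarrow> (real^2 \<Rightarrow> real) \<Rightarrow> (real^2 \<Rightarrow> real^2) \<Rightarrow> bool" where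
  "dual_feasible \<Omega> a H b \<longleftrightarrow>
     b \<in> borel_measurable (lebesgue_on \<Omega>) \<and> L2_norm_sq \<Omega> b < \<infinity> \<and>
     (AE x in lebesgue_on \<Omega>. norm (b x) \<le> a x) \<and>
     (\<forall>w Dw. H10 \<Omega> w Dw \<longrightarrow> (\<integral>x. Dw x \<bullet> b x + H x * w x \<partial>lebesgue_on \<Omega>) = 0)"

definition dual_solution ::
  "(real^2) set \<Rightarrow> (real^2 \<Rightarrow> real) \<Rightarrow> (real^2 \<Rightarrow> real^2) \<Rightarrow> (real^2 \<Rightarrow> real)
     \<Rightarrow> (real^2 \<Rightarrow> real^2) \<Rightarrow> bool" where
  "dual_solution \<Omega> a F H J \<longleftrightarrow> dual_feasible \<Omega> a H J \<and>
     (\<forall>b. dual_feasible \<Omega> a H b \<longrightarrow>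
        (\<integral>x. F x \<bullet> b x \<partial>lebesgue_on \<Omega>) \<le> (\<integral>x. F x \<bullet> J x \<partial>lebesgue_on \<Omega>))"

text \<open>\<open>u\<close> is admissible for \<open>(a, F, H)\<close> with coefficient \<open>\<sigma>\<close>. That \<open>norm J = a\<close> almost everywhere
  is a consequence of the optimality of \<open>u\<close> and \<open>J\<close> and is not part of the definition.\<close>

definition admissible ::
  "(real^2) set \<Rightarrow> real \<Rightarrow> real \<Rightarrow> real \<Rightarrow> real
     \<Rightarrow> (real^2 \<Rightarrow> real) \<Rightarrow> (real^2 \<Rightarrow> real^2) \<Rightarrow> (real^2 \<Rightarrow> real)
     \<Rightarrow> (real^2 \<Rightarrow> real) \<Rightarrow> (real^2 \<Rightarrow> real) \<Rightarrow> bool" where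
  "admissible \<Omega> \<sigma>0 \<sigma>1 m M a F H u \<sigma> \<longleftrightarrow>
     Ck_closure 1 \<Omega> u \<and> primal_solution \<Omega> a F H u (grad u) \<and>
     continuous_on \<Omega> \<sigma> \<and> (\<forall>x\<in>\<Omega>. \<sigma>0 \<le> \<sigma> x \<and> \<sigma> x \<le> \<sigma>1) \<and>
     (let J = (\<lambda>x. \<sigma> x *\<^sub>R (grad u x + F x)) in
        dual_solution \<Omega> a F H J \<and> (\<forall>x\<in>\<Omega>. m \<le> norm (J x) \<and> norm (J x) \<le> M))"

section \<open>Well-structured level sets\<close>

definition level_curve :: "(real^2) set \<Rightarrow> (real^2 \<Rightarrow> real) \<Rightarrow> real^2 \<Rightarrow> (real^2) set" where
  "level_curve \<Omega> v x = connected_component_set {y\<in>\<Omega>. v y = v x} x"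

text \<open>\<open>\<gamma>\<close> is a \<open>C\<^sup>1\<close> parametrization of the part of the level curve through \<open>x\<close> between the boundary
  and \<open>x\<close>. Only the values on \<open>[0, s0]\<close> matter: since \<open>\<gamma>\<close> is always quantified existentially, the
  two-sided derivatives at the end points are no restriction.\<close>

definition level_curve_param ::
  "(real^2) set \<Rightarrow> (real^2 \<Rightarrow> real) \<Rightarrow> real^2 \<Rightarrow> real \<Rightarrow> (real \<Rightarrow> real^2) \<Rightarrow> bool" where
  "level_curve_param \<Omega> v x s0 \<gamma> \<longleftrightarrow>
     \<gamma> C1_differentiable_on {0..s0} \<and> \<gamma> 0 \<in> frontier \<Omega> \<and> \<gamma> s0 = x \<and>
     \<gamma> ` {0<..s0} \<subseteq> level_curve \<Omega> v x"

text \<open>A level curve may reach the boundary at both ends, and then there are two arc-length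
  parametrizations from the boundary to \<open>x\<close>. The condition is required for one of them: it cannot
  hold for both with a uniform \<open>Kt\<close>, because it forces \<open>s0\<close> to stay away from \<open>0\<close> (take \<open>h\<close>
  tangent to the level curve).\<close>

definition well_structured :: "(real^2) set \<Rightarrow> real \<Rightarrow> (real^2 \<Rightarrow> real) \<Rightarrow> bool" where
  "well_structured \<Omega> Kt v \<longleftrightarrow>
     (\<exists>R. AE x in lebesgue_on \<Omega>. \<exists>s0 \<gamma>.
        0 < s0 \<and> level_curve_param \<Omega> v x s0 \<gamma> \<and>
        (\<forall>s\<in>{0..s0}. norm (vector_derivative \<gamma> (at s)) = 1) \<and>
        (\<forall>h. norm h = 1 \<longrightarrow>
          (\<exists>\<Gamma> B.
             (\<forall>\<^sub>F t in at 0. level_curve_param \<Omega> v (x + t *\<^sub>R h) s0 (\<Gamma> t) \<and>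
                (\<forall>s\<in>{0..s0}. norm (vector_derivative (\<Gamma> t) (at s) - vector_derivative \<gamma> (at s))
                   \<le> Kt * \<bar>t\<bar>)) \<and>
             (\<forall>s\<in>{0..s0}. ((\<lambda>t. (\<Gamma> t s - \<gamma> s) /\<^sub>R t) \<longlongrightarrow> B s) (at 0) \<and> norm (B s) \<le> R))))"

end

theory Submission
  imports Defs
begin

text \<open>
  Put \<open>v = u + f\<close>, \<open>v' = u' + f\<close>, \<open>w = u - u'\<close> and let \<open>\<delta>\<close> be the \<open>L\<^sup>\<infinity>\<close> norm of \<open>a - a'\<close>.
  Since \<open>\<nabla>v\<close> does not vanish, the Euler--Lagrange equation of the primal problem produces a dual
  competitor \<open>a \<nabla>v / |\<nabla>v|\<close>, and comparison with the dual solution gives \<open>|J| = a\<close>. Minimality of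
  \<open>u\<close> and the weak equation for \<open>J'\<close> bound the integral of \<open>|\<nabla>v| |\<nabla>v'| - \<nabla>v \<bullet> \<nabla>v'\<close> by \<open>C \<delta>\<close>,
  hence the \<open>L\<^sup>1\<close> norm of \<open>det (\<nabla>v, \<nabla>w)\<close> by \<open>C \<delta>\<^bsup>1/2\<^esup>\<close>.

  This determinant is the Jacobian of \<open>\<Psi> = (v, w)\<close>. As \<open>w\<close> vanishes on the boundary and level
  curves of \<open>v\<close> reach it, the section of \<open>\<Psi>(\<Omega>)\<close> over the value \<open>v x\<close> contains all numbers between
  \<open>0\<close> and \<open>w x\<close>. The length bound on level sets controls the distribution of \<open>v\<close>, so the \<open>L\<^sup>1\<close>
  norm of \<open>w\<close> is bounded by the area of \<open>\<Psi>(\<Omega>)\<close>, which is at most the integral of the Jacobian.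

  Finally the weak equations tested with \<open>w / \<sigma>\<close> and \<open>w / \<sigma>'\<close> have right-hand sides bounded by
  \<open>C |w|\<close>; their difference bounds the integral of \<open>|\<nabla>w|\<^sup>2\<close> by \<open>C \<delta>\<^bsup>1/2\<^esup>\<close>, which gives the
  exponent \<open>1/4\<close> because \<open>\<sigma> = a / |\<nabla>v|\<close>.
\<close>

section \<open>Level sets in the plane\<close>

text \<open>The Jacobian sees only the derivative of w along the level curves of v; the transverse
  derivative comes from the energy argument. There, subtracting the fluxes \<sigma> \<nabla>v and
  \<sigma>' \<nabla>v' would leave the unknown \<sigma> - \<sigma>'. Dividing the test function by
  the coefficient removes it: what remains are \<nabla>v and \<nabla>v', whose difference is
  \<nabla>w, plus terms of order zero in w. The price is that w / \<sigma> must lie in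
  \<open>H10\<close> although \<sigma> is regular only inside \<Omega>; the mollification serves
  this purpose.

  Area and length are compared in one direction only, so inequalities replace the coarea and area
  formulas. Charts, a Vitali covering and Fubini yield the first with lossy factors: 4 from choosing
  a large component of \<nabla>v, 2 from covering projections by intervals; together they make the 8
  in \<open>8 * K / c\<close>.

  Two square roots produce the exponent: misalignment of the gradients controls only the squared
  Jacobian, and the energy only the squared gradient of w. All constants rest on c = m /
  \<open>\<sigma>1\<close> as lower and V = |M| / \<open>\<sigma>0\<close> as upper bound of
  |\<nabla>v| and |\<nabla>v'|.\<close>

lemma measurable_vector_2:
  "(\<lambda>(t, z). vector [t, z] :: real^2) \<in> borel_measurable (lborel \<Otimes>\<^sub>M lborel)"
proof -
  have "continuous_on UNIV (\<lambda>p::real\<times>real. vector [fst p, snd p] :: real^2)"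
    by (subst continuous_on_componentwise) (auto simp: Basis_vec_def inner_axis forall_2 intro!: continuous_intros)
  from borel_measurable_continuous_onI[OF this] show ?thesis
    by (simp add: case_prod_beta' lborel_prod)
qed

text \<open>Both measures agree on open boxes. This makes Tonelli available on
  \<open>real^2\<close>, whose Lebesgue measure is not introduced as a product.\<close>

lemma lborel_plane_eq:
  "(lborel :: (real^2) measure) = distr (lborel \<Otimes>\<^sub>M lborel) borel (\<lambda>(t, z). vector [t, z])"
proof (rule lborel_eqI)
  fix l u :: "real^2"
  assume le: "\<And>b. b \<in> Basis \<Longrightarrow> l \<bullet> b \<le> u \<bullet> b"
  have le': "l $ 1 \<le> u $ 1" "l $ 2 \<le> u $ 2"
    using le[of "axis 1 1"] le[of "axis 2 1"] by (auto simp: inner_axis Basis_vec_def)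
  have "(\<lambda>(t, z). vector [t, z] :: real^2) -` box l u \<inter> space (lborel \<Otimes>\<^sub>M lborel)
      = {l $ 1<..<u $ 1} \<times> {l $ 2<..<u $ 2}"
    by (auto simp: mem_box_cart forall_2 space_pair_measure)
  then have "emeasure (distr (lborel \<Otimes>\<^sub>M lborel) borel (\<lambda>(t, z). vector [t, z])) (box l u)
      = emeasure (lborel \<Otimes>\<^sub>M lborel) ({l $ 1<..<u $ 1} \<times> {l $ 2<..<u $ 2})"
    using measurable_vector_2 by (subst emeasure_distr) auto
  also have "\<dots> = ennreal ((u $ 1 - l $ 1) * (u $ 2 - l $ 2))"
    using le' by (simp add: lborel.emeasure_pair_measure_Times ennreal_mult)
  also have "(u $ 1 - l $ 1) * (u $ 2 - l $ 2) = (\<Prod>b\<in>Basis. (u - l) \<bullet> b)"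
  proof -
    have "(\<Prod>b\<in>Basis. (u - l) \<bullet> b) = (\<Prod>b\<in>(\<lambda>i. axis i 1) ` UNIV. (u - l) \<bullet> b)"
      by (rule prod.cong) (auto simp: Basis_vec_def)
    also have "\<dots> = (\<Prod>i\<in>UNIV. (u - l) \<bullet> axis i 1)"
      by (subst prod.reindex) (auto simp: inj_on_def axis_eq_axis)
    finally show ?thesis by (simp add: UNIV_2 inner_axis)
  qed
  finally show "emeasure (distr (lborel \<Otimes>\<^sub>M lborel) borel (\<lambda>(t, z). vector [t, z])) (box l u)
      = (\<Prod>b\<in>Basis. (u - l) \<bullet> b)" .
qed simp

lemma
  assumes "S \<in> sets borel"
  shows emeasure_plane_sections:
      "emeasure lborel (S :: (real^2) set) = (\<integral>\<^sup>+t. emeasure lborel {z. vector [t, z] \<in> S} \<partial>lborel)"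
    and measurable_plane_sections:
      "(\<lambda>t. emeasure lborel {z. vector [t, z] \<in> S}) \<in> borel_measurable borel"
proof -
  let ?f = "\<lambda>(t, z). vector [t, z] :: real^2"
  let ?S = "?f -` S \<inter> space (lborel \<Otimes>\<^sub>M lborel)"
  have S: "?S \<in> sets (lborel \<Otimes>\<^sub>M lborel)"
    using assms by (intro measurable_sets[OF measurable_vector_2]) auto
  have sec: "Pair t -` ?S = {z. vector [t, z] \<in> S}" for t
    by (auto simp: space_pair_measure)
  have "emeasure lborel S = emeasure (lborel \<Otimes>\<^sub>M lborel) ?S"
    by (subst lborel_plane_eq, subst emeasure_distr[OF measurable_vector_2]) (use assms in auto)
  also have "\<dots> = (\<integral>\<^sup>+t. emeasure lborel (Pair t -` ?S) \<partial>lborel)"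
    by (rule lborel.emeasure_pair_measure_alt[OF S])
  finally show "emeasure lborel S = (\<integral>\<^sup>+t. emeasure lborel {z. vector [t, z] \<in> S} \<partial>lborel)"
    by (simp only: sec)
  show "(\<lambda>t. emeasure lborel {z. vector [t, z] \<in> S}) \<in> borel_measurable borel"
    using lborel.measurable_emeasure_Pair[OF S] unfolding sec by simp
qed

section \<open>Projections and one-dimensional Hausdorff measure\<close>

text \<open>Projections are 1-Lipschitz, so a cover of S also covers each projected piece. The point
  is not to pay for a covering set several times: finitely many disjoint compact pieces have
  positive mutual distance, and a cover finer than that meets at most one piece per set. The
  coordinate may therefore vary with the piece, as the charts below require.\<close>

lemma sum_projections_le_hausdorff1:
  fixes P :: "'i \<Rightarrow> (real^2) set" and j :: "'i \<Rightarrow> 2"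
  assumes I: "finite I" and P: "\<And>i. i \<in> I \<Longrightarrow> compact (P i)" "\<And>i. i \<in> I \<Longrightarrow> P i \<subseteq> S"
    and disj: "disjoint_family_on P I"
  shows "(\<Sum>i\<in>I. emeasure lborel ((\<lambda>x. x $ j i) ` P i)) \<le> 2 * hausdorff1 S"
proof -
  have "\<forall>\<^sub>F d in at_right 0. \<forall>p\<in>I \<times> I. fst p \<noteq> snd p \<longrightarrow> (\<forall>x\<in>P (fst p). \<forall>y\<in>P (snd p). d < dist x y)"
  proof (rule eventually_ball_finite)
    show "\<forall>p\<in>I \<times> I. \<forall>\<^sub>F d in at_right 0. fst p \<noteq> snd p \<longrightarrow> (\<forall>x\<in>P (fst p). \<forall>y\<in>P (snd p). d < dist x y)"
    proof
      fix p assume p: "p \<in> I \<times> I"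
      define i k where "i = fst p" and "k = snd p"
      have ik: "i \<in> I" "k \<in> I" using p by (auto simp: i_def k_def)
      have "\<forall>\<^sub>F d in at_right 0. i \<noteq> k \<longrightarrow> (\<forall>x\<in>P i. \<forall>y\<in>P k. d < dist x y)"
      proof (cases "i = k")
        case False
        then have "P i \<inter> P k = {}"
          using disj ik by (auto simp: disjoint_family_on_def)
        then obtain e where "e > 0" "\<forall>x\<in>P i. \<forall>y\<in>P k. e \<le> dist x y"
          using separate_compact_closed[of "P i" "P k"] P ik compact_imp_closed by metis
        then show ?thesis
          unfolding eventually_at_right_field by (intro exI[of _ e]) force
      qed simp
      then show "\<forall>\<^sub>F d in at_right 0. fst p \<noteq> snd p \<longrightarrow> (\<forall>x\<in>P (fst p). \<forall>y\<in>P (snd p). d < dist x y)"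
        by (simp only: i_def k_def)
    qed
  qed (use I in auto)
  moreover have "\<forall>\<^sub>F d in at_right (0::real). 0 < d"
    by (simp add: eventually_at_right_less)
  ultimately have "\<forall>\<^sub>F d in at_right (0::real). 0 < d \<and>
      (\<forall>p\<in>I \<times> I. fst p \<noteq> snd p \<longrightarrow> (\<forall>x\<in>P (fst p). \<forall>y\<in>P (snd p). d < dist x y))"
    by eventually_elim auto
  \<comment> \<open>The mesh size of the cover: strictly below every distance between two different
    pieces.\<close>
  then obtain d :: real where d0: "0 < d"
      "\<forall>p\<in>I \<times> I. fst p \<noteq> snd p \<longrightarrow> (\<forall>x\<in>P (fst p). \<forall>y\<in>P (snd p). d < dist x y)"
    using eventually_happens'[OF trivial_limit_at_right_real] by blast
  have d: "0 < d"
      "\<And>i k x y. i \<in> I \<Longrightarrow> k \<in> I \<Longrightarrow> i \<noteq> k \<Longrightarrow> x \<in> P i \<Longrightarrow> y \<in> P k \<Longrightarrow> d < dist x y"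
    using d0 by (force, metis SigmaI fst_conv snd_conv)
  have "(\<Sum>i\<in>I. emeasure lborel ((\<lambda>x. x $ j i) ` P i)) \<le> 2 * (\<Sum>n. ennreal (diameter (U n)))"
    if U: "S \<subseteq> (\<Union>n. U n)" "\<And>n. bounded (U n) \<and> diameter (U n) \<le> d" for U :: "nat \<Rightarrow> (real^2) set"
  proof -
    \<comment> \<open>The length that the n-th covering set contributes to the projection of the
      i-th piece.\<close>
    define D where "D i n = (if U n \<inter> P i = {} then 0 else 2 * ennreal (diameter (U n)))" for i n
    have single: "emeasure lborel ((\<lambda>x. x $ j i) ` P i) \<le> (\<Sum>n. D i n)" if i: "i \<in> I" for i
    proof -
      \<comment> \<open>The interval is centred at the projection of a chosen common point and has
        the diameter as radius, hence length twice the diameter: the source of the factor 2.\<close>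
      define y where "y n = (SOME y. y \<in> U n \<inter> P i)" for n
      define J where "J n = (if U n \<inter> P i = {} then {}
          else {y n $ j i - diameter (U n) .. y n $ j i + diameter (U n)})" for n
      have "(\<lambda>x. x $ j i) ` P i \<subseteq> (\<Union>n. J n)"
      proof clarify
        fix x assume x: "x \<in> P i"
        then obtain n where n: "x \<in> U n" using P(2)[OF i] U(1) by auto
        then have ne: "U n \<inter> P i \<noteq> {}" using x by auto
        then have "y n \<in> U n \<inter> P i" unfolding y_def by (meson ex_in_conv someI_ex)
        then have "dist x (y n) \<le> diameter (U n)"
          using n U(2) diameter_bounded_bound by blast
        moreover have "\<bar>x $ j i - y n $ j i\<bar> \<le> dist x (y n)"
          using component_le_norm_cart[of "x - y n" "j i"] by (simp add: dist_norm)
        ultimately show "x $ j i \<in> (\<Union>n. J n)"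
          using ne by (intro UN_I[of n]) (auto simp: J_def)
      qed
      then have "emeasure lborel ((\<lambda>x. x $ j i) ` P i) \<le> emeasure lborel (\<Union>n. J n)"
        by (rule emeasure_mono) (auto simp: J_def)
      also have "\<dots> \<le> (\<Sum>n. emeasure lborel (J n))"
        by (rule emeasure_subadditive_countably) (auto simp: J_def)
      also have "\<dots> = (\<Sum>n. D i n)"
      proof (rule suminf_cong)
        fix n
        show "emeasure lborel (J n) = D i n"
          using diameter_ge_0[of "U n"] U(2)[of n]
          by (cases "U n \<inter> P i = {}") (simp_all add: J_def D_def ennreal_mult' flip: ennreal_numeral)
      qed
      finally show ?thesis .
    qed
    have "(\<Sum>i\<in>I. emeasure lborel ((\<lambda>x. x $ j i) ` P i)) \<le> (\<Sum>i\<in>I. \<Sum>n. D i n)"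
      by (rule sum_mono) (rule single)
    also have "\<dots> = (\<Sum>n. \<Sum>i\<in>I. D i n)"
      by (rule suminf_sum[symmetric]) auto
    also have "\<dots> \<le> (\<Sum>n. 2 * ennreal (diameter (U n)))"
    proof (rule suminf_le)
      fix n
      show "(\<Sum>i\<in>I. D i n) \<le> 2 * ennreal (diameter (U n))"
      proof (cases "\<exists>i\<in>I. U n \<inter> P i \<noteq> {}")
        case True
        then obtain i where i: "i \<in> I" "U n \<inter> P i \<noteq> {}" by blast
        then obtain x where x: "x \<in> U n" "x \<in> P i" by auto
        \<comment> \<open>Points of two different pieces inside \<open>U n\<close> would be at most
          d apart.\<close>
        have "D k n = 0" if k: "k \<in> I - {i}" for k
        proof -
          have "y \<notin> U n" if "y \<in> P k" for y
          proof
            assume "y \<in> U n"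
            then have "dist x y \<le> d"
              using x U(2)[of n] diameter_bounded_bound[of "U n" x y] by auto
            with d(2)[of i k x y] i k x that show False by auto
          qed
          then show ?thesis by (auto simp: D_def)
        qed
        then have "(\<Sum>k\<in>I. D k n) = D i n"
          using I i by (subst sum.remove[of _ i]) auto
        then show ?thesis by (simp add: D_def)
      next
        case False
        then have "(\<Sum>i\<in>I. D i n) = 0" by (auto simp: D_def)
        then show ?thesis by simp
      qed
    qed auto
    also have "\<dots> = 2 * (\<Sum>n. ennreal (diameter (U n)))"
      by (rule ennreal_suminf_cmult)
    finally show ?thesis .
  qed
  note cover = this
  let ?\<U> = "{U :: nat \<Rightarrow> (real^2) set. S \<subseteq> (\<Union>i. U i) \<and> (\<forall>i. bounded (U i) \<and> diameter (U i) \<le> d)}"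
  have *: "(\<Sum>i\<in>I. emeasure lborel ((\<lambda>x. x $ j i) ` P i)) / 2 \<le> (\<Sum>n. ennreal (diameter (U n)))"
    if "U \<in> ?\<U>" for U
  proof -
    have "(\<Sum>i\<in>I. emeasure lborel ((\<lambda>x. x $ j i) ` P i)) / 2 \<le> (2 * (\<Sum>n. ennreal (diameter (U n)))) / 2"
      by (rule divide_right_mono_ennreal, rule cover) (use that in auto)
    then show ?thesis by (simp add: ennreal_mult_divide_eq mult.commute[of 2 "\<Sum>n. ennreal (diameter (U n))"])
  qed
  have "(\<Sum>i\<in>I. emeasure lborel ((\<lambda>x. x $ j i) ` P i)) / 2
      \<le> (INF U\<in>?\<U>. \<Sum>n. ennreal (diameter (U n)))"
    by (rule INF_greatest) (rule *)
  also have "\<dots> \<le> hausdorff1 S"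
    unfolding hausdorff1_def using d(1) by (intro SUP_upper) auto
  finally have "(\<Sum>i\<in>I. emeasure lborel ((\<lambda>x. x $ j i) ` P i)) / 2 * 2 \<le> hausdorff1 S * 2"
    by (rule mult_right_mono) simp
  moreover have "A / 2 * 2 = A" for A :: ennreal
    by (simp add: ennreal_divide_times)
  ultimately show ?thesis
    by (simp add: mult.commute)
qed

section \<open>Planar Jacobians and Borel preliminaries\<close>

definition plane_det :: "real^2 \<Rightarrow> real^2 \<Rightarrow> real" where
  "plane_det p q = p $ 1 * q $ 2 - p $ 2 * q $ 1"

lemma continuous_on_if_has_derivative:
  assumes "\<And>x. x \<in> S \<Longrightarrow> (f has_derivative f' x) (at x)"
  shows "continuous_on S f"
  using assms by (meson continuous_at_imp_continuous_on has_derivative_continuous)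

lemma det_matrix_rows:
  "det (matrix (\<lambda>h. vector [p \<bullet> h, q \<bullet> h] :: real^2)) = plane_det p q"
  by (simp add: det_2 matrix_def plane_det_def inner_axis)

lemma has_derivative_vector_2:
  fixes f g :: "real^2 \<Rightarrow> real"
  assumes "(f has_derivative f') F" "(g has_derivative g') F"
  shows "((\<lambda>x. vector [f x, g x] :: real^2) has_derivative (\<lambda>h. vector [f' h, g' h])) F"
proof -
  have eq: "(vector [a, b] :: real^2) = a *\<^sub>R axis 1 1 + b *\<^sub>R axis 2 1" for a b :: real
    by (simp add: vec_eq_iff forall_2 axis_def)
  show ?thesis unfolding eq
    by (intro derivative_eq_intros assms) (auto simp: assms)
qed

lemma continuous_on_vector_2:
  fixes f g :: "'a::topological_space \<Rightarrow> real"
  assumes "continuous_on S f" "continuous_on S g"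
  shows "continuous_on S (\<lambda>x. vector [f x, g x] :: real^2)"
proof -
  have eq: "(vector [a, b] :: real^2) = a *\<^sub>R axis 1 1 + b *\<^sub>R axis 2 1" for a b :: real
    by (simp add: vec_eq_iff forall_2 axis_def)
  show ?thesis unfolding eq by (intro continuous_intros assms)
qed

lemma borel_Int_vimage:
  fixes v :: "'a::topological_space \<Rightarrow> 'b::topological_space"
  assumes "continuous_on A v" "A \<in> sets borel" "T \<in> sets borel"
  shows "A \<inter> v -` T \<in> sets borel"
proof -
  have "v -` T \<inter> space (restrict_space borel A) \<in> sets (restrict_space borel A)"
    by (rule measurable_sets[OF borel_measurable_continuous_on_restrict[OF assms(1)] assms(3)])
  then show ?thesis
    using assms(2) by (auto simp: sets_restrict_space_iff space_restrict_space Int_commute)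
qed

lemma emeasure_lborel_eq_measure_lebesgue:
  assumes "S \<in> lmeasurable" "S \<in> sets borel"
  shows "emeasure lborel S = ennreal (measure lebesgue S)"
proof -
  have "emeasure lebesgue S = emeasure lborel S"
    using assms(2) by simp
  with emeasure_eq_measure2[OF assms(1)] show ?thesis by simp
qed

section \<open>A coarea inequality for v\<close>

text \<open>The map (v, \<open>x $ j\<close>) is a chart on B: by convexity and the mean value
  theorem it is injective, and its Jacobian is the partial derivative of v in the other direction i
  up to sign, hence at least c in modulus. Slicing the image at first coordinate t gives the
  projected level set, so Fubini on the image bounds the volume.\<close>

lemma chart_volume:
  fixes v :: "real^2 \<Rightarrow> real" and g :: "real^2 \<Rightarrow> real^2"
  assumes B: "compact B" "convex B"
    and der: "\<And>x. x \<in> B \<Longrightarrow> (v has_derivative (\<lambda>h. g x \<bullet> h)) (at x)"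
    and g: "continuous_on B g" and c: "\<And>x. x \<in> B \<Longrightarrow> c \<le> \<bar>g x $ i\<bar>" "0 < c" and ij: "i \<noteq> j"
    and T: "T \<in> sets borel"
  shows "ennreal c * emeasure lborel (B \<inter> v -` T)
      \<le> (\<integral>\<^sup>+t\<in>T. emeasure lborel ((\<lambda>x. x $ j) ` (B \<inter> v -` {t})) \<partial>lborel)"
proof -
  define \<Phi> where "\<Phi> x = (vector [v x, x $ j] :: real^2)" for x
  have contv: "continuous_on B v"
    by (rule continuous_on_if_has_derivative[OF der])
  have cont\<Phi>: "continuous_on B \<Phi>"
    unfolding \<Phi>_def by (intro continuous_on_vector_2 contv continuous_intros)
  have inj: "inj_on \<Phi> B"
  proof
    fix x y assume xy: "x \<in> B" "y \<in> B" "\<Phi> x = \<Phi> y"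
    then have eq: "v x = v y" "x $ j = y $ j"
      by (auto simp: \<Phi>_def dest: arg_cong[of _ _ "\<lambda>p. p $ 1"] arg_cong[of _ _ "\<lambda>p. p $ 2"])
    have seg: "x + t *\<^sub>R (y - x) \<in> B" if "0 \<le> t" "t \<le> 1" for t
      using convexD_alt[OF B(2) xy(1,2) that] by (simp add: algebra_simps)
    \<comment> \<open>Two points with the same image differ only in coordinate i, so a vanishing
      derivative of v along their segment contradicts the lower bound on \<open>g x $ i\<close>
      unless they coincide.\<close>
    have "\<exists>z\<in>{0<..<1::real}. (\<lambda>t. v (x + t *\<^sub>R (y - x))) 1 - (\<lambda>t. v (x + t *\<^sub>R (y - x))) 0
        = (\<lambda>h. g (x + z *\<^sub>R (y - x)) \<bullet> (h *\<^sub>R (y - x))) (1 - 0)"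
    proof (rule mvt_simple)
      fix t :: real assume "0 \<le> t" "t \<le> 1"
      then have "x + t *\<^sub>R (y - x) \<in> B"
        by (rule seg)
      note D = has_derivative_compose[where f = "\<lambda>t. x + t *\<^sub>R (y - x)" and f' = "\<lambda>h. h *\<^sub>R (y - x)"
          and g = v and g' = "\<lambda>h. g (x + t *\<^sub>R (y - x)) \<bullet> h", OF _ der[OF this]]
      show "((\<lambda>t. v (x + t *\<^sub>R (y - x))) has_derivative (\<lambda>h. g (x + t *\<^sub>R (y - x)) \<bullet> (h *\<^sub>R (y - x))))
          (at t within {0..1})"
        by (rule D) (auto intro!: derivative_eq_intros)
    qed simp
    then obtain z :: real where z: "0 < z" "z < 1" "g (x + z *\<^sub>R (y - x)) \<bullet> (y - x) = 0"
      using eq by auto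
    have "x + z *\<^sub>R (y - x) \<in> B"
      using z by (intro seg) auto
    then have "\<bar>g (x + z *\<^sub>R (y - x)) $ i\<bar> > 0" using c by force
    moreover have "g (x + z *\<^sub>R (y - x)) \<bullet> (y - x) = g (x + z *\<^sub>R (y - x)) $ i * (y $ i - x $ i)"
      using ij eq(2) exhaust_2[of i] exhaust_2[of j] by (auto simp: inner_vec_def UNIV_2)
    ultimately have "x $ i = y $ i" using z by auto
    then show "x = y"
      using ij eq(2) exhaust_2[of i] exhaust_2[of j] by (auto simp: vec_eq_iff forall_2)
  qed
  define S where "S = B \<inter> v -` T"
  have Sb: "S \<in> sets borel"
    unfolding S_def using B T by (intro borel_Int_vimage contv) (auto simp: borel_compact)
  have \<Phi>S: "\<Phi> ` S = \<Phi> ` B \<inter> {p. p $ 1 \<in> T}"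
    by (auto simp: S_def \<Phi>_def)
  have \<Phi>Sb: "\<Phi> ` S \<in> sets borel"
  proof -
    have "{p :: real^2. p $ 1 \<in> T} = (\<lambda>p. p $ 1) -` T \<inter> space borel" by auto
    also have "\<dots> \<in> sets borel"
      by (rule measurable_sets[OF _ T]) (intro borel_measurable_continuous_onI continuous_intros)
    moreover have "\<Phi> ` B \<in> sets borel"
      using compact_continuous_image[OF cont\<Phi> B(1)] by (simp add: borel_compact)
    ultimately show ?thesis unfolding \<Phi>S by auto
  qed
  have der\<Phi>: "(\<Phi> has_derivative (\<lambda>h. vector [g x \<bullet> h, axis j 1 \<bullet> h])) (at x within S)" if "x \<in> S" for x
    unfolding \<Phi>_def
    by (rule has_derivative_vector_2)
      (use that der[of x] in \<open>auto simp: S_def inner_axis' intro: has_derivative_at_withinI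
        bounded_linear_imp_has_derivative bounded_linear_vec_nth\<close>)
  have det: "\<bar>det (matrix (\<lambda>h. vector [g x \<bullet> h, axis j 1 \<bullet> h] :: real^2))\<bar> = \<bar>g x $ i\<bar>" for x
    unfolding det_matrix_rows using ij exhaust_2[of i] exhaust_2[of j]
    by (auto simp: plane_det_def axis_def)
  have intB: "(\<lambda>x. \<bar>g x $ i\<bar>) absolutely_integrable_on B"
  proof -
    have int: "integrable lborel (\<lambda>x. indicator B x *\<^sub>R \<bar>g x $ i\<bar>)"
      using B by (intro borel_integrable_compact continuous_intros g)
    show ?thesis
      using integrable_completion[THEN iffD2, OF borel_measurable_integrable[OF int] int]
      by (simp add: set_integrable_def)
  qed
  have intS: "(\<lambda>x. \<bar>g x $ i\<bar>) integrable_on S"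
    using set_integrable_subset[OF intB, of S] Sb by (auto simp: S_def intro: set_lebesgue_integral_eq_integral(1))
  have "bounded S" using B by (auto simp: S_def intro: bounded_subset compact_imp_bounded)
  then have Slm: "S \<in> lmeasurable"
    using Sb by (intro bounded_set_imp_lmeasurable) auto
  have "c * measure lebesgue S = integral S (\<lambda>x. c)"
    using Slm by (simp add: lmeasure_integral flip: integral_mult_right)
  also have "\<dots> \<le> integral S (\<lambda>x. \<bar>g x $ i\<bar>)"
    using Slm c intS by (intro integral_le) (auto simp: S_def integrable_on_const)
  also have "\<dots> = measure lebesgue (\<Phi> ` S)"
    using measure_differentiable_image_eq[of S \<Phi>, OF _ der\<Phi>] Sb intS inj
    unfolding det by (auto simp: S_def inj_on_def)
  finally have le: "c * measure lebesgue S \<le> measure lebesgue (\<Phi> ` S)" .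
  have "ennreal c * emeasure lborel S = ennreal (c * measure lebesgue S)"
    using c by (simp add: ennreal_mult emeasure_lborel_eq_measure_lebesgue[OF Slm Sb])
  also have "\<dots> \<le> ennreal (measure lebesgue (\<Phi> ` S))"
    using le by (rule ennreal_leI)
  \<comment> \<open>\<open>enn2real\<close> sends an infinite measure to 0, so the inequality holds
    whether or not the image has finite measure.\<close>
  also have "\<dots> \<le> emeasure lborel (\<Phi> ` S)"
    using \<Phi>Sb by (simp add: measure_def ennreal_enn2real_if)
  also have "\<dots> = (\<integral>\<^sup>+t. emeasure lborel {z. vector [t, z] \<in> \<Phi> ` S} \<partial>lborel)"
    by (rule emeasure_plane_sections[OF \<Phi>Sb])
  also have "\<dots> = (\<integral>\<^sup>+t\<in>T. emeasure lborel ((\<lambda>x. x $ j) ` (B \<inter> v -` {t})) \<partial>lborel)"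
  proof (rule nn_integral_cong)
    fix t
    show "emeasure lborel {z. vector [t, z] \<in> \<Phi> ` S}
        = emeasure lborel ((\<lambda>x. x $ j) ` (B \<inter> v -` {t})) * indicator T t"
    proof (cases "t \<in> T")
      case True
      then have "{z. vector [t, z] \<in> \<Phi> ` S} = (\<lambda>x. x $ j) ` (B \<inter> v -` {t})"
        by (force simp: \<Phi>_def S_def vec_eq_iff forall_2)
      with True show ?thesis by simp
    next
      case False
      then have "{z. vector [t, z] \<in> \<Phi> ` S} = {}"
        by (force simp: \<Phi>_def S_def vec_eq_iff forall_2)
      with False show ?thesis by (simp del: Collect_empty_eq)
    qed
  qed
  finally show ?thesis unfolding S_def .
qed

text \<open>These lengths are those of the vertical sections of one compact planar set, the image of
  B under the chart map.\<close>

lemma measurable_projection_level_sets: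
  fixes v :: "real^2 \<Rightarrow> real"
  assumes B: "compact B" and v: "continuous_on B v"
  shows "(\<lambda>t. emeasure lborel ((\<lambda>x. x $ j) ` (B \<inter> v -` {t}))) \<in> borel_measurable borel"
proof -
  define \<Phi> where "\<Phi> x = (vector [v x, x $ j] :: real^2)" for x
  have "compact (\<Phi> ` B)"
    unfolding \<Phi>_def by (intro compact_continuous_image continuous_on_vector_2 v continuous_intros B)
  then have "(\<lambda>t. emeasure lborel {z. vector [t, z] \<in> \<Phi> ` B}) \<in> borel_measurable borel"
    by (intro measurable_plane_sections borel_compact)
  moreover have "{z. vector [t, z] \<in> \<Phi> ` B} = (\<lambda>x. x $ j) ` (B \<inter> v -` {t})" for t
    by (force simp: \<Phi>_def vec_eq_iff forall_2)
  ultimately show ?thesis by simp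
qed

text \<open>In other words, the distribution of v on \<Omega> has density at most
  \<open>8 * K / c\<close>. Disjoint balls carrying a chart cover \<Omega> up to a null set; on
  finitely many of them the projected level sets at each t add up to at most 2 K, and an increasing
  limit reaches all of \<Omega>.\<close>

lemma level_sets_volume:
  fixes v :: "real^2 \<Rightarrow> real" and g :: "real^2 \<Rightarrow> real^2" and K :: ennreal
  assumes \<Omega>: "open \<Omega>"
    and der: "\<And>x. x \<in> \<Omega> \<Longrightarrow> (v has_derivative (\<lambda>h. g x \<bullet> h)) (at x)"
    and g: "continuous_on \<Omega> g" and c: "\<And>x. x \<in> \<Omega> \<Longrightarrow> c \<le> norm (g x)" "0 < c"
    and K: "\<And>t. hausdorff1 {x\<in>\<Omega>. v x = t} \<le> K"
    and T: "T \<in> sets borel"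
  shows "ennreal (c / 4) * emeasure lborel (\<Omega> \<inter> v -` T) \<le> 2 * K * emeasure lborel T"
proof -
  have contv: "continuous_on \<Omega> v"
    by (rule continuous_on_if_has_derivative[OF der])
  \<comment> \<open>A pair p encodes a closed ball by centre and radius, the form in which the
    Vitali covering theorem receives its family.\<close>
  define good where "good p i \<longleftrightarrow> 0 < snd p \<and> cball (fst p) (snd p) \<subseteq> \<Omega> \<and>
    (\<forall>x\<in>cball (fst p) (snd p). c / 4 \<le> \<bar>g x $ i\<bar>)" for p and i :: 2
  define \<K> where "\<K> = {p. \<exists>i. good p i}"
  define B where "B p = cball (fst p) (snd p)" for p :: "(real^2) \<times> real"
  have "\<exists>p. p \<in> \<K> \<and> x \<in> cball (fst p) (snd p) \<and> snd p < d" if x: "x \<in> \<Omega>" and d: "0 < d" for x d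
  proof -
    have "norm (g x) \<le> \<bar>g x $ 1\<bar> + \<bar>g x $ 2\<bar>"
      using norm_le_l1_cart[of "g x"] by (simp add: UNIV_2)
    \<comment> \<open>One of two components carries at least c / 2; the weaker c / 4 makes the
      inequality strict, so that it persists in a neighbourhood.\<close>
    then have "c / 4 < \<bar>g x $ 1\<bar> \<or> c / 4 < \<bar>g x $ 2\<bar>"
      using c(1)[OF x] c(2) by linarith
    then obtain i where i: "c / 4 < \<bar>g x $ i\<bar>" by blast
    have "continuous_on \<Omega> (\<lambda>y. \<bar>g y $ i\<bar>)" by (intro continuous_intros g)
    then have "isCont (\<lambda>y. \<bar>g y $ i\<bar>) x"
      using \<Omega> x by (simp add: continuous_on_eq_continuous_at)
    then have "\<forall>\<^sub>F y in nhds x. c / 4 < \<bar>g y $ i\<bar>"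
      using i by (metis isCont_def order_tendstoD(1) tendsto_at_iff_tendsto_nhds)
    moreover have "\<forall>\<^sub>F y in nhds x. y \<in> \<Omega>" using \<Omega> x by (rule eventually_nhds_in_open)
    ultimately have "\<forall>\<^sub>F y in nhds x. c / 4 < \<bar>g y $ i\<bar> \<and> y \<in> \<Omega>" by eventually_elim auto
    then obtain e where e: "e > 0" "\<And>y. dist y x < e \<Longrightarrow> c / 4 < \<bar>g y $ i\<bar> \<and> y \<in> \<Omega>"
      unfolding eventually_nhds_metric by blast
    define r where "r = min (e / 2) (d / 2)"
    have r: "0 < r" "r < e" "r < d" using e d by (auto simp: r_def)
    have "c / 4 < \<bar>g y $ i\<bar> \<and> y \<in> \<Omega>" if "y \<in> cball x r" for y
      using e(2)[of y] that r by (auto simp: dist_commute)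
    then have "good (x, r) i" using r by (auto simp: good_def less_imp_le)
    then show ?thesis using r by (intro exI[of _ "(x, r)"]) (auto simp: \<K>_def)
  qed
  then obtain \<C> where \<C>: "countable \<C>" "\<C> \<subseteq> \<K>"
      "pairwise (\<lambda>p q. disjnt (B p) (B q)) \<C>" "negligible (\<Omega> - (\<Union>p\<in>\<C>. B p))"
    using Vitali_covering_theorem_cballs[of \<K> snd \<Omega> fst] unfolding B_def
    by (smt (verit, best) \<K>_def good_def mem_Collect_eq)
  define i where "i p = (SOME i. good p i)" for p
  define j where "j p = (if i p = 1 then 2 else 1 :: 2)" for p
  have good: "good p (i p)" if "p \<in> \<C>" for p
    using \<C>(2) that unfolding \<K>_def i_def by (metis (mono_tags) mem_Collect_eq someI_ex subsetD)
  have ij: "i p \<noteq> j p" for p by (simp add: j_def)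
  have B\<Omega>: "B p \<subseteq> \<Omega>" if "p \<in> \<C>" for p using good[OF that] by (auto simp: good_def B_def)
  have BT: "B p \<inter> v -` T \<in> sets borel" if "p \<in> \<C>" for p
    using continuous_on_subset[OF contv B\<Omega>[OF that]] T
    by (intro borel_Int_vimage) (auto simp: B_def)
  define L where "L p t = emeasure lborel ((\<lambda>x. x $ j p) ` (B p \<inter> v -` {t}))" for p t
  have chart: "ennreal (c / 4) * emeasure lborel (B p \<inter> v -` T) \<le> (\<integral>\<^sup>+t\<in>T. L p t \<partial>lborel)"
    if p: "p \<in> \<C>" for p
    unfolding L_def
  proof (rule chart_volume[where g = g and i = "i p"])
    show "continuous_on (B p) g" using g B\<Omega>[OF p] continuous_on_subset by blast
    show "(v has_derivative (\<lambda>h. g x \<bullet> h)) (at x)" if "x \<in> B p" for x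
      using der that B\<Omega>[OF p] by blast
  qed (use good[OF p] c T ij in \<open>auto simp: B_def good_def\<close>)
  have Lmeas: "L p \<in> borel_measurable borel" if p: "p \<in> \<C>" for p
    unfolding L_def
    using continuous_on_subset[OF contv B\<Omega>[OF that]]
    by (intro measurable_projection_level_sets) (auto simp: B_def)
  have finite_bound: "ennreal (c / 4) * emeasure lborel (\<Union>p\<in>I. B p \<inter> v -` T) \<le> 2 * K * emeasure lborel T"
    if I: "finite I" "I \<subseteq> \<C>" for I
  proof -
    \<comment> \<open>Finiteness of I matters here: it keeps the disjoint compact pieces of the
      level set at a positive distance.\<close>
    have Lsum: "(\<Sum>p\<in>I. L p t) \<le> 2 * K" for t
    proof -
      have "(\<Sum>p\<in>I. L p t) \<le> 2 * hausdorff1 {x\<in>\<Omega>. v x = t}"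
        unfolding L_def
      proof (rule sum_projections_le_hausdorff1)
        show "compact (B p \<inter> v -` {t})" if p: "p \<in> I" for p
        proof -
          have "closed (B p \<inter> v -` {t})"
            using continuous_on_subset[OF contv B\<Omega>] p I
            by (intro continuous_closed_preimage) (auto simp: B_def)
          then show ?thesis
            using compact_Int_closed[of "B p" "B p \<inter> v -` {t}"] by (simp add: B_def Int_assoc[symmetric])
        qed
        show "B p \<inter> v -` {t} \<subseteq> {x \<in> \<Omega>. v x = t}" if "p \<in> I" for p
          using B\<Omega>[of p] that I by auto
        show "disjoint_family_on (\<lambda>p. B p \<inter> v -` {t}) I"
          using \<C>(3) I by (force simp: disjoint_family_on_def pairwise_def disjnt_def)
      qed (rule I)
      also have "\<dots> \<le> 2 * K" using K[of t] by (rule mult_left_mono) simp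
      finally show ?thesis .
    qed
    have "ennreal (c / 4) * emeasure lborel (\<Union>p\<in>I. B p \<inter> v -` T)
        \<le> ennreal (c / 4) * (\<Sum>p\<in>I. emeasure lborel (B p \<inter> v -` T))"
      using I BT by (intro mult_left_mono emeasure_subadditive_finite) auto
    also have "\<dots> \<le> (\<Sum>p\<in>I. \<integral>\<^sup>+t\<in>T. L p t \<partial>lborel)"
      unfolding sum_distrib_left using chart I by (intro sum_mono) auto
    also have "\<dots> = (\<integral>\<^sup>+t. (\<Sum>p\<in>I. L p t * indicator T t) \<partial>lborel)"
      using Lmeas I T by (intro nn_integral_sum[symmetric] borel_measurable_times) auto
    also have "\<dots> \<le> (\<integral>\<^sup>+t. 2 * K * indicator T t \<partial>lborel)"
      unfolding sum_distrib_right[symmetric] using Lsum by (intro nn_integral_mono mult_right_mono) auto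
    also have "\<dots> = 2 * K * emeasure lborel T"
      using T by (subst nn_integral_cmult_indicator) auto
    finally show ?thesis .
  qed
  \<comment> \<open>The first n + 1 balls in an enumeration of the countable family, so that the
    bound for finite families applies to each \<open>A n\<close>.\<close>
  define A where "A n = (\<Union>p\<in>to_nat_on \<C> -` {..n} \<inter> \<C>. B p \<inter> v -` T)" for n :: nat
  have A_bound: "ennreal (c / 4) * emeasure lborel (A n) \<le> 2 * K * emeasure lborel T" for n
    unfolding A_def
    by (rule finite_bound) (use \<C>(1) in \<open>auto intro!: finite_vimage_IntI inj_on_to_nat_on\<close>)
  have A_meas: "A n \<in> sets borel" for n
    unfolding A_def using \<C>(1) BT by (intro sets.countable_UN') auto
  have A_Un: "(\<Union>n. A n) = (\<Union>p\<in>\<C>. B p \<inter> v -` T)"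
  proof
    show "(\<Union>p\<in>\<C>. B p \<inter> v -` T) \<subseteq> (\<Union>n. A n)"
    proof (rule UN_least)
      fix p assume "p \<in> \<C>"
      then have "B p \<inter> v -` T \<subseteq> A (to_nat_on \<C> p)" unfolding A_def by (intro UN_upper) auto
      then show "B p \<inter> v -` T \<subseteq> (\<Union>n. A n)" by (rule order_trans) (intro UN_upper, simp)
    qed
    show "(\<Union>n. A n) \<subseteq> (\<Union>p\<in>\<C>. B p \<inter> v -` T)" unfolding A_def by blast
  qed
  let ?N = "\<Omega> - (\<Union>p\<in>\<C>. B p)"
  have N: "?N \<in> sets borel"
    using \<Omega> \<C>(1) by (intro sets.Diff sets.countable_UN') (auto simp: B_def)
  have N0: "emeasure lborel ?N = 0"
    using \<C>(4) N negligible_iff_emeasure0[of ?N] by simp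
  have "emeasure lborel (\<Omega> \<inter> v -` T) \<le> emeasure lborel ((\<Union>n. A n) \<union> ?N)"
  proof (rule emeasure_mono)
    show "(\<Union>n. A n) \<union> ?N \<in> sets lborel" using A_meas N by simp
  qed (auto simp: A_Un)
  also have "\<dots> \<le> emeasure lborel (\<Union>n. A n) + emeasure lborel ?N"
    using A_meas N by (intro emeasure_subadditive) auto
  also have "\<dots> = (SUP n. emeasure lborel (A n))"
  proof -
    have "incseq A" unfolding incseq_def A_def by (intro allI impI UN_mono) auto
    then show ?thesis unfolding N0 using A_meas by (subst SUP_emeasure_incseq) auto
  qed
  finally have "ennreal (c / 4) * emeasure lborel (\<Omega> \<inter> v -` T)
      \<le> ennreal (c / 4) * (SUP n. emeasure lborel (A n))"
    by (rule mult_left_mono) simp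
  also have "\<dots> = (SUP n. ennreal (c / 4) * emeasure lborel (A n))"
    by (rule SUP_mult_left_ennreal)
  also have "\<dots> \<le> 2 * K * emeasure lborel T"
    using A_bound by (intro SUP_least) auto
  finally show ?thesis .
qed


lemma integrable_continuous_bounded:
  fixes f :: "real^2 \<Rightarrow> 'b::euclidean_space"
  assumes "open \<Omega>" "bounded \<Omega>" "continuous_on \<Omega> f" "\<And>x. x \<in> \<Omega> \<Longrightarrow> norm (f x) \<le> c"
  shows "integrable (lebesgue_on \<Omega>) f"
proof -
  have \<Omega>: "\<Omega> \<in> lmeasurable" using assms by (simp add: lmeasurable_open)
  interpret finite_measure "lebesgue_on \<Omega>" by (rule finite_measure_lebesgue_on[OF \<Omega>])
  show ?thesis
    using assms \<Omega> by (intro integrable_const_bound[of _ c])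
      (auto intro: continuous_imp_measurable_on_sets_lebesgue)
qed

section \<open>The image of (v, w) and the mean of w\<close>

text \<open>The change of variables counts the image without multiplicity, hence an inequality that
  requires no injectivity. The bound b makes the Jacobian integrable; the image is Borel because
  \<Omega> is a countable union of compact sets.\<close>

lemma
  fixes v w :: "real^2 \<Rightarrow> real" and g k :: "real^2 \<Rightarrow> real^2"
  assumes \<Omega>: "open \<Omega>" "bounded \<Omega>"
    and v: "\<And>x. x \<in> \<Omega> \<Longrightarrow> (v has_derivative (\<lambda>h. g x \<bullet> h)) (at x)"
    and w: "\<And>x. x \<in> \<Omega> \<Longrightarrow> (w has_derivative (\<lambda>h. k x \<bullet> h)) (at x)"
    and cont: "continuous_on \<Omega> g" "continuous_on \<Omega> k"
    and bound: "\<And>x. x \<in> \<Omega> \<Longrightarrow> \<bar>plane_det (g x) (k x)\<bar> \<le> b"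
  shows emeasure_plane_image_le:
      "emeasure lborel ((\<lambda>x. vector [v x, w x] :: real^2) ` \<Omega>)
        \<le> (\<integral>\<^sup>+x. ennreal \<bar>plane_det (g x) (k x)\<bar> \<partial>lebesgue_on \<Omega>)"
    and borel_plane_image: "(\<lambda>x. vector [v x, w x] :: real^2) ` \<Omega> \<in> sets borel"
proof -
  let ?\<Psi> = "\<lambda>x. vector [v x, w x] :: real^2"
  have cont\<Psi>: "continuous_on \<Omega> ?\<Psi>"
    by (rule continuous_on_vector_2)
      (rule continuous_on_if_has_derivative[OF v] continuous_on_if_has_derivative[OF w], assumption)+
  have \<Omega>s: "\<Omega> \<in> sets lebesgue" using \<Omega> by auto
  have int: "integrable (lebesgue_on \<Omega>) (\<lambda>x. \<bar>plane_det (g x) (k x)\<bar>)"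
  proof (rule integrable_continuous_bounded[OF \<Omega>])
    show "continuous_on \<Omega> (\<lambda>x. \<bar>plane_det (g x) (k x)\<bar>)"
      unfolding plane_det_def by (intro continuous_intros cont)
    show "norm \<bar>plane_det (g x) (k x)\<bar> \<le> b" if "x \<in> \<Omega>" for x
      using bound[OF that] by simp
  qed
  have der: "(?\<Psi> has_derivative (\<lambda>h. vector [g x \<bullet> h, k x \<bullet> h])) (at x within \<Omega>)" if "x \<in> \<Omega>" for x
    by (rule has_derivative_at_withinI, rule has_derivative_vector_2[OF v[OF that] w[OF that]])
  have int': "(\<lambda>x. \<bar>det (matrix (\<lambda>h. vector [g x \<bullet> h, k x \<bullet> h] :: real^2))\<bar>) integrable_on \<Omega>"
    unfolding det_matrix_rows by (rule integrable_on_lebesgue_on[OF int \<Omega>s])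
  show borel: "?\<Psi> ` \<Omega> \<in> sets borel"
  proof -
    obtain C :: "nat \<Rightarrow> (real^2) set" where C: "\<And>n. compact (C n)" "\<And>n. C n \<subseteq> \<Omega>" "(\<Union>n. C n) = \<Omega>"
      using open_Union_compact_subsets[OF \<Omega>(1)] by metis
    have "?\<Psi> ` \<Omega> = (\<Union>n. ?\<Psi> ` C n)" using C(3) by blast
    moreover have "?\<Psi> ` C n \<in> sets borel" for n
      using compact_continuous_image[OF continuous_on_subset[OF cont\<Psi> C(2)[of n]] C(1)]
      by (simp add: borel_compact)
    ultimately show ?thesis by auto
  qed
  have lm: "?\<Psi> ` \<Omega> \<in> lmeasurable"
    by (rule measurable_differentiable_image[OF \<Omega>s der int'])
  have "emeasure lborel (?\<Psi> ` \<Omega>) = ennreal (measure lebesgue (?\<Psi> ` \<Omega>))"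
    by (rule emeasure_lborel_eq_measure_lebesgue[OF lm borel])
  also have "\<dots> \<le> ennreal (integral \<Omega> (\<lambda>x. \<bar>plane_det (g x) (k x)\<bar>))"
    using measure_differentiable_image[OF \<Omega>s der int'] unfolding det_matrix_rows by (rule ennreal_leI)
  also have "integral \<Omega> (\<lambda>x. \<bar>plane_det (g x) (k x)\<bar>) = (\<integral>x. \<bar>plane_det (g x) (k x)\<bar> \<partial>lebesgue_on \<Omega>)"
    by (rule lebesgue_integral_eq_integral[symmetric, OF int \<Omega>s])
  also have "ennreal \<dots> = (\<integral>\<^sup>+x. ennreal \<bar>plane_det (g x) (k x)\<bar> \<partial>lebesgue_on \<Omega>)"
    by (rule nn_integral_eq_integral[symmetric, OF int]) auto
  finally show "emeasure lborel (?\<Psi> ` \<Omega>) \<le> \<dots>" .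
qed

text \<open>Along a curve in the level set of v through x, the function w runs from 0 to
  \<open>w x\<close>, so the section of the image of (v, w) at \<open>v x\<close> has length at
  least |w x|. Integrating over x turns this into the integral of the section length against the
  distribution of v, which the coarea inequality replaces by Lebesgue measure; Fubini then yields
  the area of the image.\<close>

lemma level_set_transport:
  fixes v w :: "real^2 \<Rightarrow> real" and g k :: "real^2 \<Rightarrow> real^2" and K :: ennreal
  assumes \<Omega>: "open \<Omega>" "bounded \<Omega>"
    and v: "\<And>x. x \<in> \<Omega> \<Longrightarrow> (v has_derivative (\<lambda>h. g x \<bullet> h)) (at x)"
    and w: "\<And>x. x \<in> \<Omega> \<Longrightarrow> (w has_derivative (\<lambda>h. k x \<bullet> h)) (at x)"
    and cont: "continuous_on \<Omega> g" "continuous_on \<Omega> k"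
    and bound: "\<And>x. x \<in> \<Omega> \<Longrightarrow> \<bar>plane_det (g x) (k x)\<bar> \<le> b"
    and c: "\<And>x. x \<in> \<Omega> \<Longrightarrow> c \<le> norm (g x)" "0 < c"
    and K: "\<And>t. hausdorff1 {x\<in>\<Omega>. v x = t} \<le> K"
    and path: "AE x in lebesgue_on \<Omega>. \<exists>(s0::real) \<gamma>. 0 < s0 \<and> continuous_on {0..s0} (\<lambda>s. w (\<gamma> s)) \<and>
       w (\<gamma> 0) = 0 \<and> \<gamma> s0 = x \<and> (\<forall>s\<in>{0<..s0}. \<gamma> s \<in> \<Omega> \<and> v (\<gamma> s) = v x)"
  shows "ennreal (c / 4) * (\<integral>\<^sup>+x. ennreal \<bar>w x\<bar> \<partial>lebesgue_on \<Omega>)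
      \<le> 2 * K * (\<integral>\<^sup>+x. ennreal \<bar>plane_det (g x) (k x)\<bar> \<partial>lebesgue_on \<Omega>)"
proof -
  have contv: "continuous_on \<Omega> v"
    by (rule continuous_on_if_has_derivative[OF v])
  have vmeas: "v \<in> borel_measurable (lebesgue_on \<Omega>)"
    using contv \<Omega> by (intro continuous_imp_measurable_on_sets_lebesgue) auto
  let ?\<Psi> = "\<lambda>x. vector [v x, w x] :: real^2"
  have borel: "?\<Psi> ` \<Omega> \<in> sets borel"
    by (rule borel_plane_image[OF \<Omega> v w cont bound])
  define A where "A t = emeasure lborel {z. vector [t, z] \<in> ?\<Psi> ` \<Omega>}" for t
  have Am: "A \<in> borel_measurable borel"
    unfolding A_def by (rule measurable_plane_sections[OF borel])
  have sec: "{z. vector [t, z] \<in> ?\<Psi> ` \<Omega>} \<in> sets borel" for t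
  proof -
    have "(\<lambda>z. vector [t, z] :: real^2) -` (?\<Psi> ` \<Omega>) \<inter> space borel \<in> sets borel"
      by (rule measurable_sets[OF _ borel])
        (intro borel_measurable_continuous_onI continuous_on_vector_2 continuous_intros)
    then show ?thesis by (simp add: vimage_def)
  qed
  have "AE x in lebesgue_on \<Omega>. ennreal \<bar>w x\<bar> \<le> A (v x)"
    using path
  proof eventually_elim
    case (elim x)
    then obtain s0 :: real and \<gamma> where \<gamma>: "0 < s0" "continuous_on {0..s0} (\<lambda>s. w (\<gamma> s))" "w (\<gamma> 0) = 0" "\<gamma> s0 = x"
       "\<forall>s\<in>{0<..s0}. \<gamma> s \<in> \<Omega> \<and> v (\<gamma> s) = v x" by blast
    \<comment> \<open>The value 0 is left out: it may be attained only at \<gamma> 0, which need not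
      lie in \<Omega>. A half-open interval has the same length.\<close>
    have *: "z \<in> {z. vector [v x, z] \<in> ?\<Psi> ` \<Omega>}" if z: "z \<noteq> 0" "0 < z \<and> z \<le> w x \<or> w x \<le> z \<and> z < 0" for z
    proof -
      have "\<exists>s\<ge>0. s \<le> s0 \<and> w (\<gamma> s) = z"
        using z
      proof (elim disjE)
        assume "0 < z \<and> z \<le> w x"
        then show ?thesis using \<gamma> by (intro IVT') auto
      next
        assume "w x \<le> z \<and> z < 0"
        then show ?thesis using \<gamma> by (intro IVT2') auto
      qed
      then obtain s where s: "0 \<le> s" "s \<le> s0" "w (\<gamma> s) = z" by blast
      then have "s \<in> {0<..s0}" using z(1) \<gamma>(3) by (cases "s = 0") auto
      with \<gamma>(5) s show ?thesis by (auto intro!: image_eqI[of _ _ "\<gamma> s"])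
    qed
    show ?case
    proof (cases "0 \<le> w x")
      case True
      have "ennreal \<bar>w x\<bar> = emeasure lborel {0<..w x}" using True by simp
      also have "\<dots> \<le> A (v x)" unfolding A_def using * by (intro emeasure_mono) (auto simp: sec)
      finally show ?thesis .
    next
      case False
      have "ennreal \<bar>w x\<bar> = emeasure lborel {w x..<0}" using False by simp
      also have "\<dots> \<le> A (v x)" unfolding A_def using * by (intro emeasure_mono) (auto simp: sec)
      finally show ?thesis .
    qed
  qed
  then have le1: "(\<integral>\<^sup>+x. ennreal \<bar>w x\<bar> \<partial>lebesgue_on \<Omega>) \<le> (\<integral>\<^sup>+x. A (v x) \<partial>lebesgue_on \<Omega>)"
    by (rule nn_integral_mono_AE)
  define N where "N = distr (lebesgue_on \<Omega>) borel v"
  \<comment> \<open>The estimate on Borel sets is stated as an order between measures, so that it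
    passes to the integral of A at once.\<close>
  have "scale_measure (ennreal (c / 4)) N \<le> scale_measure (2 * K) lborel"
  proof (subst le_measure)
    show "\<forall>T\<in>sets (scale_measure (ennreal (c / 4)) N). emeasure (scale_measure (ennreal (c / 4)) N) T
        \<le> emeasure (scale_measure (2 * K) lborel) T"
    proof
      fix T assume "T \<in> sets (scale_measure (ennreal (c / 4)) N)"
      then have T: "T \<in> sets borel" by (simp add: N_def)
      have "emeasure N T = emeasure (lebesgue_on \<Omega>) (\<Omega> \<inter> v -` T)"
        unfolding N_def using vmeas T by (subst emeasure_distr) (auto simp: space_restrict_space Int_commute)
      also have "\<dots> = emeasure lborel (\<Omega> \<inter> v -` T)"
        using borel_Int_vimage[OF contv _ T] \<Omega> by (subst emeasure_restrict_space) auto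
      finally show "emeasure (scale_measure (ennreal (c / 4)) N) T \<le> emeasure (scale_measure (2 * K) lborel) T"
        using level_sets_volume[OF \<Omega>(1) v cont(1) c K T] by simp
    qed
  qed (simp add: N_def)
  then have "(\<integral>\<^sup>+t. A t \<partial>scale_measure (ennreal (c / 4)) N) \<le> (\<integral>\<^sup>+t. A t \<partial>scale_measure (2 * K) lborel)"
    by (intro nn_integral_mono_measure) (simp_all add: N_def)
  then have le2: "ennreal (c / 4) * (\<integral>\<^sup>+x. A (v x) \<partial>lebesgue_on \<Omega>) \<le> 2 * K * (\<integral>\<^sup>+t. A t \<partial>lborel)"
    using Am vmeas by (simp add: nn_integral_scale_measure N_def nn_integral_distr)
  have le3: "(\<integral>\<^sup>+t. A t \<partial>lborel) \<le> (\<integral>\<^sup>+x. ennreal \<bar>plane_det (g x) (k x)\<bar> \<partial>lebesgue_on \<Omega>)"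
    using emeasure_plane_image_le[OF \<Omega> v w cont bound]
    unfolding A_def emeasure_plane_sections[OF borel, symmetric] .
  have "ennreal (c / 4) * (\<integral>\<^sup>+x. ennreal \<bar>w x\<bar> \<partial>lebesgue_on \<Omega>)
      \<le> ennreal (c / 4) * (\<integral>\<^sup>+x. A (v x) \<partial>lebesgue_on \<Omega>)"
    using le1 by (rule mult_left_mono) simp
  also note le2
  also have "2 * K * (\<integral>\<^sup>+t. A t \<partial>lborel)
      \<le> 2 * K * (\<integral>\<^sup>+x. ennreal \<bar>plane_det (g x) (k x)\<bar> \<partial>lebesgue_on \<Omega>)"
    using le3 by (rule mult_left_mono) simp
  finally show ?thesis .
qed

section \<open>Test functions and mollification\<close>

lemma partial_deriv_eq:
  "(f has_derivative f') (at x) \<Longrightarrow> partial_deriv i f x = f' (axis i 1)"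
  by (simp add: partial_deriv_def frechet_derivative_at[symmetric])

lemma has_derivative_grad:
  fixes f :: "real^2 \<Rightarrow> real"
  assumes "f differentiable (at x)"
  shows "(f has_derivative (\<lambda>h. grad f x \<bullet> h)) (at x)"
proof -
  let ?D = "frechet_derivative f (at x)"
  have D: "(f has_derivative ?D) (at x)"
    using assms by (simp add: frechet_derivative_works)
  have lin: "linear ?D" using D by (rule has_derivative_linear)
  have "?D h = grad f x \<bullet> h" for h
  proof -
    have "h = h $ 1 *\<^sub>R axis 1 1 + h $ 2 *\<^sub>R axis 2 1"
      by (simp add: vec_eq_iff forall_2 axis_def)
    then have "?D h = ?D (h $ 1 *\<^sub>R axis 1 1 + h $ 2 *\<^sub>R axis 2 1)" by simp
    also have "\<dots> = grad f x \<bullet> h"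
      by (simp add: linear_add[OF lin] linear_scale[OF lin] grad_def inner_vec_def UNIV_2
          partial_deriv_def mult.commute)
    finally show ?thesis .
  qed
  then have "?D = (\<lambda>h. grad f x \<bullet> h)" by auto
  with D show ?thesis by simp
qed

lemma grad_eqI:
  assumes "(f has_derivative (\<lambda>h. p \<bullet> h)) (at x)"
  shows "grad f x = p"
  using partial_deriv_eq[OF assms] by (simp add: grad_def vec_eq_iff inner_axis)

lemma Ck_on_1D:
  fixes f :: "real^2 \<Rightarrow> real"
  assumes "Ck_on 1 \<Omega> f" "open \<Omega>"
  shows "\<And>x. x \<in> \<Omega> \<Longrightarrow> (f has_derivative (\<lambda>h. grad f x \<bullet> h)) (at x)"
    and "continuous_on \<Omega> (grad f)"
proof -
  have "f differentiable_on \<Omega>" and c: "\<And>i. continuous_on \<Omega> (partial_deriv i f)"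
    using assms(1) by (simp_all add: One_nat_def)
  then show "\<And>x. x \<in> \<Omega> \<Longrightarrow> (f has_derivative (\<lambda>h. grad f x \<bullet> h)) (at x)"
    using assms(2) by (intro has_derivative_grad) (simp add: differentiable_on_eq_differentiable_at)
  show "continuous_on \<Omega> (grad f)"
    unfolding grad_def[abs_def] by (intro continuous_on_vec_lambda c)
qed

lemma Ck_on_Suc_imp: "Ck_on (Suc k) \<Omega> f \<Longrightarrow> Ck_on k \<Omega> f"
proof (induction k arbitrary: f)
  case 0
  then show ?case by (simp add: differentiable_imp_continuous_on)
next
  case (Suc k)
  then have "\<forall>i. Ck_on (Suc k) \<Omega> (partial_deriv i f)" "f differentiable_on \<Omega>" by simp_all
  then show ?case using Suc.IH by simp
qed

lemma Ck_on_antimono: "Ck_on n \<Omega> f \<Longrightarrow> m \<le> n \<Longrightarrow> Ck_on m \<Omega> f"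
  by (induction n) (auto simp: le_Suc_eq dest: Ck_on_Suc_imp simp del: Ck_on.simps)

section \<open>Algebra of smooth functions\<close>

lemma Ck_on_UNIV_differentiable:
  "Ck_on (Suc k) UNIV f \<Longrightarrow> f differentiable (at x)"
  by (simp add: differentiable_on_eq_differentiable_at)

lemma Ck_on_const: "Ck_on k UNIV (\<lambda>_. c)"
proof (induction k arbitrary: c)
  case (Suc k)
  have "partial_deriv i (\<lambda>_. c) = (\<lambda>_. 0)" for i
    by (rule ext) (rule partial_deriv_eq, rule has_derivative_const)
  with Suc show ?case by simp
qed simp

lemma Ck_on_add:
  "Ck_on k UNIV f \<Longrightarrow> Ck_on k UNIV g \<Longrightarrow> Ck_on k UNIV (\<lambda>x. f x + g x)"
proof (induction k arbitrary: f g)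
  case 0
  then show ?case by (simp add: continuous_on_add)
next
  case (Suc k)
  have d: "f differentiable (at x)" "g differentiable (at x)" for x
    using Suc.prems Ck_on_UNIV_differentiable by blast+
  have "partial_deriv i (\<lambda>x. f x + g x) = (\<lambda>x. partial_deriv i f x + partial_deriv i g x)" for i
  proof
    fix x
    note D = has_derivative_add[OF d(1)[of x, unfolded frechet_derivative_works] d(2)[of x, unfolded frechet_derivative_works]]
    show "partial_deriv i (\<lambda>x. f x + g x) x = partial_deriv i f x + partial_deriv i g x"
      unfolding partial_deriv_eq[OF D] by (simp only: partial_deriv_def)
  qed
  moreover have "(\<lambda>x. f x + g x) differentiable_on UNIV"
    using d by (simp add: differentiable_on_eq_differentiable_at differentiable_add)
  ultimately show ?case using Suc by simp
qed

lemma Ck_on_mult: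
  fixes f g :: "real^2 \<Rightarrow> real"
  shows "Ck_on k UNIV f \<Longrightarrow> Ck_on k UNIV g \<Longrightarrow> Ck_on k UNIV (\<lambda>x. f x * g x)"
proof (induction k arbitrary: f g)
  case 0
  then show ?case by (simp add: continuous_on_mult)
next
  case (Suc k)
  have d: "f differentiable (at x)" "g differentiable (at x)" for x
    using Suc.prems Ck_on_UNIV_differentiable by blast+
  have "partial_deriv i (\<lambda>x. f x * g x) = (\<lambda>x. f x * partial_deriv i g x + partial_deriv i f x * g x)" for i
  proof
    fix x
    note D = has_derivative_mult[OF d(1)[of x, unfolded frechet_derivative_works] d(2)[of x, unfolded frechet_derivative_works]]
    show "partial_deriv i (\<lambda>x. f x * g x) x = f x * partial_deriv i g x + partial_deriv i f x * g x"
      unfolding partial_deriv_eq[OF D] by (simp only: partial_deriv_def)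
  qed
  moreover have "(\<lambda>x. f x * g x) differentiable_on UNIV"
    using d by (simp add: differentiable_on_eq_differentiable_at differentiable_mult)
  moreover have "Ck_on k UNIV (\<lambda>x. f x * partial_deriv i g x + partial_deriv i f x * g x)" for i
    using Suc.prems by (intro Ck_on_add Suc.IH Ck_on_Suc_imp[of k _ f] Ck_on_Suc_imp[of k _ g]) simp_all
  ultimately show ?case by simp
qed

text \<open>The factor c belongs to the statement because every partial derivative multiplies it by
  s; the induction needs it arbitrary.\<close>

lemma Ck_on_dilation:
  fixes f :: "real^2 \<Rightarrow> 'b::real_normed_vector"
  shows "Ck_on k UNIV f \<Longrightarrow> Ck_on k UNIV (\<lambda>x. c *\<^sub>R f (s *\<^sub>R x))"
proof (induction k arbitrary: f c)
  case 0
  then have "continuous_on UNIV (\<lambda>x. f (s *\<^sub>R x))"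
    by (intro continuous_on_compose2[of UNIV f UNIV "\<lambda>x. s *\<^sub>R x"]) (auto intro!: continuous_intros)
  then show ?case by (simp add: continuous_on_scaleR)
next
  case (Suc k)
  have d: "((\<lambda>x. c *\<^sub>R f (s *\<^sub>R x)) has_derivative
      (\<lambda>h. c *\<^sub>R frechet_derivative f (at (s *\<^sub>R x)) (s *\<^sub>R h))) (at x)" for x
  proof -
    have "(f has_derivative frechet_derivative f (at (s *\<^sub>R x))) (at (s *\<^sub>R x))"
      using Ck_on_UNIV_differentiable[OF Suc.prems] by (simp add: frechet_derivative_works)
    then have "((\<lambda>x. f (s *\<^sub>R x)) has_derivative
        (\<lambda>h. frechet_derivative f (at (s *\<^sub>R x)) (s *\<^sub>R h))) (at x)"
      by (rule has_derivative_compose[where g = f, rotated]) (auto intro!: derivative_eq_intros)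
    then show ?thesis by (rule has_derivative_scaleR_right)
  qed
  have "partial_deriv i (\<lambda>x. c *\<^sub>R f (s *\<^sub>R x)) = (\<lambda>x. (c * s) *\<^sub>R partial_deriv i f (s *\<^sub>R x))" for i
  proof
    fix x
    have "linear (frechet_derivative f (at (s *\<^sub>R x)))"
      using Ck_on_UNIV_differentiable[OF Suc.prems] by (rule linear_frechet_derivative)
    then show "partial_deriv i (\<lambda>x. c *\<^sub>R f (s *\<^sub>R x)) x = (c * s) *\<^sub>R partial_deriv i f (s *\<^sub>R x)"
      using partial_deriv_eq[OF d, of i x] by (simp add: partial_deriv_def linear_scale)
  qed
  moreover have "(\<lambda>x. c *\<^sub>R f (s *\<^sub>R x)) differentiable_on UNIV"
    using d by (auto simp: differentiable_on_eq_differentiable_at differentiable_def)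
  ultimately show ?case using Suc by simp
qed

section \<open>Convolutions\<close>

text \<open>Differentiation under the integral over a fixed box, with the derivative falling on the
  second factor only. It is used in both orders: with the kernel second it gives smoothness, with
  the kernel first it identifies the gradient.\<close>

lemma has_derivative_convolution:
  fixes \<psi> \<eta> :: "real^2 \<Rightarrow> real" and p :: "real^2 \<Rightarrow> real^2"
  assumes \<psi>: "continuous_on UNIV \<psi>" and p: "continuous_on UNIV p"
    and \<eta>: "\<And>x. (\<eta> has_derivative (\<lambda>h. p x \<bullet> h)) (at x)"
  shows "((\<lambda>x. integral (cbox a b) (\<lambda>y. \<psi> y * \<eta> (x - y))) has_derivative
      (\<lambda>h. integral (cbox a b) (\<lambda>y. \<psi> y *\<^sub>R p (x - y)) \<bullet> h)) (at x)"
proof -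
  have c\<eta>: "continuous_on UNIV \<eta>"
    by (rule continuous_on_if_has_derivative[OF \<eta>])
  have comp: "continuous_on S (\<lambda>z. g (h z))"
    if "continuous_on UNIV g" "continuous_on S h" for g :: "real^2 \<Rightarrow> 'c::topological_space" and h S
    using continuous_on_compose2[OF that] by auto
  let ?D = "\<lambda>x y. blinfun_inner_left (\<psi> y *\<^sub>R p (x - y))"
  have "((\<lambda>x. integral (cbox a b) (\<lambda>y. \<psi> y * \<eta> (x - y))) has_derivative
      blinfun_apply (integral (cbox a b) (?D x))) (at x within UNIV)"
  proof (rule leibniz_rule)
    show "((\<lambda>x. \<psi> y * \<eta> (x - y)) has_derivative blinfun_apply (?D x y)) (at x within UNIV)" for x y
    proof -
      have "((\<lambda>x. \<eta> (x - y)) has_derivative (\<lambda>h. p (x - y) \<bullet> h)) (at x)"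
        by (rule has_derivative_compose[where g = \<eta> and f = "\<lambda>x. x - y" and f' = "\<lambda>h. h", OF _ \<eta>])
          (auto intro!: derivative_eq_intros)
      from has_derivative_mult_right[OF this, of "\<psi> y"] show ?thesis
        by (simp add: inner_commute)
    qed
    show "(\<lambda>y. \<psi> y * \<eta> (x - y)) integrable_on cbox a b" for x
      by (intro integrable_continuous continuous_intros comp[OF c\<eta>] continuous_on_subset[OF \<psi>]) auto
    show "continuous_on (UNIV \<times> cbox a b) (\<lambda>(x, y). ?D x y)"
      unfolding split_beta
      by (intro bounded_linear.continuous_on[OF bounded_linear_blinfun_inner_left]
          continuous_intros comp[OF p] comp[OF \<psi>])
  qed auto
  moreover have "blinfun_apply (integral (cbox a b) (?D x)) = (\<lambda>h. integral (cbox a b) (\<lambda>y. \<psi> y *\<^sub>R p (x - y)) \<bullet> h)"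
  proof -
    have "(\<lambda>y. \<psi> y *\<^sub>R p (x - y)) integrable_on cbox a b"
      by (intro integrable_continuous continuous_intros comp[OF p] continuous_on_subset[OF \<psi>]) auto
    from integral_linear[OF this bounded_linear_blinfun_inner_left]
    show ?thesis by (auto simp: o_def inner_commute)
  qed
  ultimately show ?thesis by simp
qed

lemma partial_deriv_convolution:
  fixes \<psi> \<eta> :: "real^2 \<Rightarrow> real"
  assumes \<psi>: "continuous_on UNIV \<psi>" and \<eta>: "Ck_on 1 UNIV \<eta>"
  shows "partial_deriv i (\<lambda>x. integral (cbox a b) (\<lambda>y. \<psi> y * \<eta> (x - y)))
      = (\<lambda>x. integral (cbox a b) (\<lambda>y. \<psi> y * partial_deriv i \<eta> (x - y)))"
proof
  fix x
  note g = Ck_on_1D[OF \<eta> open_UNIV]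
  have "(\<lambda>y. \<psi> y *\<^sub>R grad \<eta> (x - y)) integrable_on cbox a b"
    by (intro integrable_continuous continuous_intros continuous_on_subset[OF \<psi>]
        continuous_on_compose2[OF g(2)]) auto
  then have "integral (cbox a b) (\<lambda>y. \<psi> y *\<^sub>R grad \<eta> (x - y)) $ i
      = integral (cbox a b) (\<lambda>y. (\<psi> y *\<^sub>R grad \<eta> (x - y)) $ i)"
    using integral_linear[OF _ bounded_linear_vec_nth[of i]] by (metis (mono_tags, lifting) comp_apply integral_cong)
  then show "partial_deriv i (\<lambda>x. integral (cbox a b) (\<lambda>y. \<psi> y * \<eta> (x - y))) x
      = integral (cbox a b) (\<lambda>y. \<psi> y * partial_deriv i \<eta> (x - y))"
    using partial_deriv_eq[OF has_derivative_convolution[where a = a and b = b and x = x, OF \<psi> g(2) g(1)], of i]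
    by (simp add: inner_axis grad_def)
qed

text \<open>Every derivative moves onto \<eta>. One order is lost because continuity in the base
  case is read off from differentiability, which requires \<eta> to be continuously differentiable;
  a smooth kernel can afford this.\<close>

lemma Ck_on_convolution:
  fixes \<psi> \<eta> :: "real^2 \<Rightarrow> real"
  assumes \<psi>: "continuous_on UNIV \<psi>"
  shows "Ck_on (Suc k) UNIV \<eta> \<Longrightarrow> Ck_on k UNIV (\<lambda>x. integral (cbox a b) (\<lambda>y. \<psi> y * \<eta> (x - y)))"
proof (induction k arbitrary: \<eta>)
  case 0
  note g = Ck_on_1D[OF 0[folded One_nat_def] open_UNIV]
  show ?case
    by (simp, rule continuous_on_if_has_derivative[OF has_derivative_convolution[OF \<psi> g(2) g(1)]]) simp
next
  case (Suc k)
  have 1: "Ck_on 1 UNIV \<eta>" using Suc.prems by (rule Ck_on_antimono) simp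
  note g = Ck_on_1D[OF 1 open_UNIV]
  have "(\<lambda>x. integral (cbox a b) (\<lambda>y. \<psi> y * \<eta> (x - y))) differentiable_on UNIV"
    using has_derivative_convolution[OF \<psi> g(2) g(1)]
    by (auto simp: differentiable_on_eq_differentiable_at differentiable_def)
  moreover have "Ck_on k UNIV (partial_deriv i (\<lambda>x. integral (cbox a b) (\<lambda>y. \<psi> y * \<eta> (x - y))))" for i
    unfolding partial_deriv_convolution[OF \<psi> 1] using Suc by simp
  ultimately show ?case by simp
qed

lemma integral_lborel_eq_cbox:
  fixes f :: "real^2 \<Rightarrow> real"
  assumes f: "continuous_on UNIV f" and 0: "\<And>x. x \<notin> cbox a b \<Longrightarrow> f x = 0"
  shows "integrable lborel f" and "(\<integral>x. f x \<partial>lborel) = integral (cbox a b) f"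
proof -
  have eq: "(\<lambda>x. indicator (cbox a b) x *\<^sub>R f x) = f"
  proof
    fix x
    show "indicator (cbox a b) x *\<^sub>R f x = f x" by (cases "x \<in> cbox a b") (simp_all add: 0)
  qed
  show int: "integrable lborel f"
    using borel_integrable_compact[OF compact_cbox continuous_on_subset[OF f], of a b]
    by (simp only: eq subset_UNIV)
  have "(\<integral>x. f x \<partial>lborel) = integral UNIV f"
    by (rule integral_lborel[OF int, symmetric])
  also have "\<dots> = integral UNIV (\<lambda>x. if x \<in> cbox a b then f x else 0)"
    using 0 by (intro integral_cong) auto
  also have "\<dots> = integral (cbox a b) f"
    by (rule integral_restrict_UNIV)
  finally show "(\<integral>x. f x \<partial>lborel) = integral (cbox a b) f" .
qed

lemma integral_lborel_reflect:
  fixes f :: "real^2 \<Rightarrow> real"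
  assumes "f \<in> borel_measurable borel"
  shows "(\<integral>y. f (x - y) \<partial>lborel) = (\<integral>z. f z \<partial>lborel)"
proof -
  have "(lborel :: (real^2) measure) = distr lborel borel (\<lambda>y. x - y)"
    using lborel_affine[of "-1" x] by (simp add: density_1)
  then have "(\<integral>z. f z \<partial>lborel) = (\<integral>z. f z \<partial>distr lborel borel (\<lambda>y. x - y))"
    by simp
  also have "\<dots> = (\<integral>y. f (x - y) \<partial>lborel)"
    using assms by (subst integral_distr) auto
  finally show ?thesis by simp
qed

text \<open>The substitution z = x - y is carried out for the Lebesgue integral over the whole
  plane; the supports then restrict both sides to boxes again.\<close>

lemma convolution_commute:
  fixes \<psi> \<eta> :: "real^2 \<Rightarrow> real"
  assumes "continuous_on UNIV \<psi>" "continuous_on UNIV \<eta>"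
    and "\<And>x. x \<notin> cbox a b \<Longrightarrow> \<psi> x = 0" "\<And>x. x \<notin> cbox c d \<Longrightarrow> \<eta> x = 0"
  shows "integral (cbox a b) (\<lambda>y. \<psi> y * \<eta> (x - y)) = integral (cbox c d) (\<lambda>z. \<eta> z * \<psi> (x - z))"
proof -
  have c: "continuous_on UNIV (\<lambda>y. \<psi> y * \<eta> (x - y))" "continuous_on UNIV (\<lambda>z. \<eta> z * \<psi> (x - z))"
    by (auto intro!: continuous_intros assms(1,2) continuous_on_compose2[OF assms(1)]
        continuous_on_compose2[OF assms(2)])
  have "integral (cbox a b) (\<lambda>y. \<psi> y * \<eta> (x - y)) = (\<integral>y. \<psi> y * \<eta> (x - y) \<partial>lborel)"
    using assms by (intro integral_lborel_eq_cbox(2)[symmetric] c) auto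
  also have "\<dots> = (\<integral>y. (\<lambda>z. \<eta> z * \<psi> (x - z)) (x - y) \<partial>lborel)"
    by (simp add: mult.commute)
  also have "\<dots> = (\<integral>z. \<eta> z * \<psi> (x - z) \<partial>lborel)"
    by (intro integral_lborel_reflect borel_measurable_continuous_onI c)
  also have "\<dots> = integral (cbox c d) (\<lambda>z. \<eta> z * \<psi> (x - z))"
    using assms by (intro integral_lborel_eq_cbox(2) c) auto
  finally show ?thesis .
qed

lemma measurable_lebesgue_on_continuous:
  fixes f :: "real^2 \<Rightarrow> 'b::euclidean_space"
  shows "continuous_on UNIV f \<Longrightarrow> f \<in> borel_measurable (lebesgue_on \<Omega>)"
  by (intro measurable_restrict_space1 measurable_completion) (simp add: borel_measurable_continuous_onI)

section \<open>Squared norms in L2\<close>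

lemma L2_norm_sq_le_cmult:
  assumes f: "\<And>x. x \<in> \<Omega> \<Longrightarrow> norm (f x) \<le> c * norm (g x)"
    and g: "g \<in> borel_measurable (lebesgue_on \<Omega>)"
  shows "L2_norm_sq \<Omega> f \<le> ennreal (c\<^sup>2) * L2_norm_sq \<Omega> g"
proof -
  have "L2_norm_sq \<Omega> f \<le> (\<integral>\<^sup>+x. ennreal (c\<^sup>2) * ennreal ((norm (g x))\<^sup>2) \<partial>lebesgue_on \<Omega>)"
    unfolding L2_norm_sq_def
  proof (rule nn_integral_mono)
    fix x assume "x \<in> space (lebesgue_on \<Omega>)"
    then have "norm (f x) \<le> c * norm (g x)" using f by (simp add: space_restrict_space)
    then have "(norm (f x))\<^sup>2 \<le> c\<^sup>2 * (norm (g x))\<^sup>2"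
      unfolding power_mult_distrib[symmetric] by (rule power_mono) simp
    then show "ennreal ((norm (f x))\<^sup>2) \<le> ennreal (c\<^sup>2) * ennreal ((norm (g x))\<^sup>2)"
      by (simp add: ennreal_mult[symmetric] ennreal_leI)
  qed
  also have "\<dots> = ennreal (c\<^sup>2) * L2_norm_sq \<Omega> g"
    unfolding L2_norm_sq_def using g by (intro nn_integral_cmult) measurable
  finally show ?thesis .
qed

text \<open>The substitute for the triangle inequality when only squares occur. Its factor 2 on each
  term is why approximations below are requested with accuracy e / 4.\<close>

lemma L2_norm_sq_add_le:
  fixes f g :: "real^2 \<Rightarrow> 'b::euclidean_space"
  assumes "f \<in> borel_measurable (lebesgue_on \<Omega>)" "g \<in> borel_measurable (lebesgue_on \<Omega>)"
  shows "L2_norm_sq \<Omega> (\<lambda>x. f x + g x) \<le> 2 * L2_norm_sq \<Omega> f + 2 * L2_norm_sq \<Omega> g"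
proof -
  have "L2_norm_sq \<Omega> (\<lambda>x. f x + g x)
      \<le> (\<integral>\<^sup>+x. 2 * ennreal ((norm (f x))\<^sup>2) + 2 * ennreal ((norm (g x))\<^sup>2) \<partial>lebesgue_on \<Omega>)"
    unfolding L2_norm_sq_def
  proof (rule nn_integral_mono)
    fix x
    have "(norm (f x + g x))\<^sup>2 \<le> (norm (f x) + norm (g x))\<^sup>2"
      by (intro power_mono norm_triangle_ineq) simp
    also have "\<dots> \<le> 2 * (norm (f x))\<^sup>2 + 2 * (norm (g x))\<^sup>2"
      using sum_squares_bound[of "norm (f x)" "norm (g x)"] by (simp add: power2_sum)
    finally have "ennreal ((norm (f x + g x))\<^sup>2) \<le> ennreal (2 * (norm (f x))\<^sup>2 + 2 * (norm (g x))\<^sup>2)"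
      by (rule ennreal_leI)
    then show "ennreal ((norm (f x + g x))\<^sup>2) \<le> 2 * ennreal ((norm (f x))\<^sup>2) + 2 * ennreal ((norm (g x))\<^sup>2)"
      by (simp add: ennreal_mult)
  qed
  also have "\<dots> = 2 * L2_norm_sq \<Omega> f + 2 * L2_norm_sq \<Omega> g"
    unfolding L2_norm_sq_def using assms
    by (subst nn_integral_add; (subst nn_integral_cmult)?; measurable?) (simp add: nn_integral_cmult)
  finally show ?thesis .
qed

lemma L2_norm_sq_uniform_le:
  assumes "\<Omega> \<in> lmeasurable" "\<And>x. x \<in> \<Omega> \<Longrightarrow> norm (f x) \<le> e"
  shows "L2_norm_sq \<Omega> f \<le> ennreal (e\<^sup>2 * measure lebesgue \<Omega>)"
proof -
  have "L2_norm_sq \<Omega> f \<le> (\<integral>\<^sup>+x. ennreal (e\<^sup>2) \<partial>lebesgue_on \<Omega>)"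
    unfolding L2_norm_sq_def using assms
    by (intro nn_integral_mono ennreal_leI power_mono) (auto simp: space_restrict_space)
  also have "\<dots> = ennreal (e\<^sup>2) * emeasure lebesgue \<Omega>"
    using assms by (simp add: emeasure_restrict_space fmeasurableD space_restrict_space)
  also have "\<dots> = ennreal (e\<^sup>2 * measure lebesgue \<Omega>)"
    using emeasure_eq_measure2[OF assms(1)] by (simp add: ennreal_mult)
  finally show ?thesis .
qed

section \<open>Test functions and the space \<open>H10\<close>\<close>

lemma test_fun_1D:
  assumes "test_fun \<Omega> \<phi>"
  shows "\<And>x. (\<phi> has_derivative (\<lambda>h. grad \<phi> x \<bullet> h)) (at x)"
    and "continuous_on UNIV \<phi>" and "continuous_on UNIV (grad \<phi>)"
proof -
  have "Ck_on 1 UNIV \<phi>" "Ck_on 0 UNIV \<phi>" using assms unfolding test_fun_def by blast+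
  then show "\<And>x. (\<phi> has_derivative (\<lambda>h. grad \<phi> x \<bullet> h)) (at x)"
    and "continuous_on UNIV \<phi>" and "continuous_on UNIV (grad \<phi>)"
    using Ck_on_1D[OF _ open_UNIV] by auto
qed

lemma test_fun_measurable:
  assumes "test_fun \<Omega> \<phi>"
  shows "\<phi> \<in> borel_measurable (lebesgue_on \<Omega>)" "grad \<phi> \<in> borel_measurable (lebesgue_on \<Omega>)"
  using test_fun_1D[OF assms] by (auto intro: measurable_lebesgue_on_continuous)

lemma test_funI:
  assumes "\<And>k. Ck_on k UNIV \<phi>" "compact S" "S \<subseteq> \<Omega>" "\<And>x. x \<notin> S \<Longrightarrow> \<phi> x = 0"
  shows "test_fun \<Omega> \<phi>"
proof -
  have "closure {x. \<phi> x \<noteq> 0} \<subseteq> S"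
    using assms by (intro closure_minimal compact_imp_closed) auto
  then show ?thesis
    using assms compact_Int_closed[of S "closure {x. \<phi> x \<noteq> 0}"]
    by (auto simp: test_fun_def Int_absorb1)
qed

lemma test_fun_lincomb:
  assumes "test_fun \<Omega> \<phi>" "test_fun \<Omega> \<psi>"
  shows "test_fun \<Omega> (\<lambda>x. \<phi> x + c * \<psi> x)"
proof (rule test_funI)
  show "Ck_on k UNIV (\<lambda>x. \<phi> x + c * \<psi> x)" for k
    using assms by (intro Ck_on_add Ck_on_mult Ck_on_const) (auto simp: test_fun_def)
  let ?S = "closure {x. \<phi> x \<noteq> 0} \<union> closure {x. \<psi> x \<noteq> 0}"
  show "compact ?S" "?S \<subseteq> \<Omega>" using assms by (auto simp: test_fun_def)
  show "\<phi> x + c * \<psi> x = 0" if "x \<notin> ?S" for x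
  proof -
    have "\<phi> x = 0" "\<psi> x = 0"
      using that closure_subset[of "{x. \<phi> x \<noteq> 0}"] closure_subset[of "{x. \<psi> x \<noteq> 0}"] by blast+
    then show ?thesis by simp
  qed
qed

lemma H10_approx:
  assumes "H10 \<Omega> w Dw" "0 < e"
  obtains \<phi> where "test_fun \<Omega> \<phi>" "L2_norm_sq \<Omega> (\<lambda>x. \<phi> x - w x) \<le> ennreal e"
    "L2_norm_sq \<Omega> (\<lambda>x. grad \<phi> x - Dw x) \<le> ennreal e"
proof -
  obtain \<phi> :: "nat \<Rightarrow> real^2 \<Rightarrow> real" where \<phi>: "\<And>k. test_fun \<Omega> (\<phi> k)"
      "(\<lambda>k. L2_norm_sq \<Omega> (\<lambda>x. \<phi> k x - w x)) \<longlonglongrightarrow> 0"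
      "(\<lambda>k. L2_norm_sq \<Omega> (\<lambda>x. grad (\<phi> k) x - Dw x)) \<longlonglongrightarrow> 0"
    using assms(1) unfolding H10_def by blast
  have "\<forall>\<^sub>F k in sequentially. L2_norm_sq \<Omega> (\<lambda>x. \<phi> k x - w x) < ennreal e"
    "\<forall>\<^sub>F k in sequentially. L2_norm_sq \<Omega> (\<lambda>x. grad (\<phi> k) x - Dw x) < ennreal e"
    using order_tendstoD(2)[OF \<phi>(2), of "ennreal e"] order_tendstoD(2)[OF \<phi>(3), of "ennreal e"] assms(2)
    by simp_all
  then have "\<forall>\<^sub>F k in sequentially. L2_norm_sq \<Omega> (\<lambda>x. \<phi> k x - w x) < ennreal e \<and>
    L2_norm_sq \<Omega> (\<lambda>x. grad (\<phi> k) x - Dw x) < ennreal e"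
    by eventually_elim auto
  then obtain k where "L2_norm_sq \<Omega> (\<lambda>x. \<phi> k x - w x) < ennreal e"
    "L2_norm_sq \<Omega> (\<lambda>x. grad (\<phi> k) x - Dw x) < ennreal e"
    using eventually_happens'[OF sequentially_bot] by blast
  with \<phi>(1) show ?thesis by (intro that[of "\<phi> k"]) auto
qed

lemma H10I:
  assumes "w \<in> borel_measurable (lebesgue_on \<Omega>)" "Dw \<in> borel_measurable (lebesgue_on \<Omega>)"
    and "\<And>e. 0 < e \<Longrightarrow> \<exists>\<phi>. test_fun \<Omega> \<phi> \<and> L2_norm_sq \<Omega> (\<lambda>x. \<phi> x - w x) \<le> ennreal e \<and>
      L2_norm_sq \<Omega> (\<lambda>x. grad \<phi> x - Dw x) \<le> ennreal e"
  shows "H10 \<Omega> w Dw"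
proof -
  have "\<forall>k. \<exists>\<phi>. test_fun \<Omega> \<phi> \<and> L2_norm_sq \<Omega> (\<lambda>x. \<phi> x - w x) \<le> ennreal (inverse (real (Suc k))) \<and>
      L2_norm_sq \<Omega> (\<lambda>x. grad \<phi> x - Dw x) \<le> ennreal (inverse (real (Suc k)))"
    using assms(3) by simp
  then obtain \<phi> where \<phi>: "\<And>k. test_fun \<Omega> (\<phi> k)"
      "\<And>k. L2_norm_sq \<Omega> (\<lambda>x. \<phi> k x - w x) \<le> ennreal (inverse (real (Suc k)))"
      "\<And>k. L2_norm_sq \<Omega> (\<lambda>x. grad (\<phi> k) x - Dw x) \<le> ennreal (inverse (real (Suc k)))"
    by metis
  have "(\<lambda>k. ennreal (inverse (real (Suc k)))) \<longlonglongrightarrow> ennreal 0"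
    by (intro tendsto_ennrealI LIMSEQ_inverse_real_of_nat)
  then have lim: "(\<lambda>k. ennreal (inverse (real (Suc k)))) \<longlonglongrightarrow> 0" by simp
  have "(\<lambda>k. L2_norm_sq \<Omega> (\<lambda>x. \<phi> k x - w x)) \<longlonglongrightarrow> 0"
    by (rule tendsto_sandwich[OF _ _ tendsto_const lim]) (simp_all add: \<phi>(2) del: of_nat_Suc)
  moreover have "(\<lambda>k. L2_norm_sq \<Omega> (\<lambda>x. grad (\<phi> k) x - Dw x)) \<longlonglongrightarrow> 0"
    by (rule tendsto_sandwich[OF _ _ tendsto_const lim]) (simp_all add: \<phi>(3) del: of_nat_Suc)
  ultimately show ?thesis
    using assms(1,2) \<phi>(1) unfolding H10_def by blast
qed

lemma H10_measurable:
  assumes "H10 \<Omega> w Dw"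
  shows "w \<in> borel_measurable (lebesgue_on \<Omega>)" "Dw \<in> borel_measurable (lebesgue_on \<Omega>)"
  using assms by (auto simp: H10_def)

lemma ennreal_twice_quarter:
  assumes "A \<le> ennreal (e / 4)" "B \<le> ennreal (e / 4)" "0 < e"
  shows "2 * A + 2 * B \<le> ennreal e"
proof -
  have "2 * A + 2 * B \<le> 2 * ennreal (e / 4) + 2 * ennreal (e / 4)"
    using assms by (intro add_mono mult_left_mono) auto
  also have "\<dots> = ennreal e"
    using assms(3) by (simp add: ennreal_mult[symmetric] ennreal_plus[symmetric] del: ennreal_plus flip: ennreal_numeral)
  finally show ?thesis .
qed

lemma L2_norm_sq_diff_triangle:
  fixes f g h :: "real^2 \<Rightarrow> 'b::euclidean_space"
  assumes "f \<in> borel_measurable (lebesgue_on \<Omega>)" "g \<in> borel_measurable (lebesgue_on \<Omega>)"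
    "h \<in> borel_measurable (lebesgue_on \<Omega>)" "0 < e"
    and "L2_norm_sq \<Omega> (\<lambda>x. f x - g x) \<le> ennreal (e / 4)" "L2_norm_sq \<Omega> (\<lambda>x. g x - h x) \<le> ennreal (e / 4)"
  shows "L2_norm_sq \<Omega> (\<lambda>x. f x - h x) \<le> ennreal e"
proof -
  have "L2_norm_sq \<Omega> (\<lambda>x. f x - h x) = L2_norm_sq \<Omega> (\<lambda>x. (f x - g x) + (g x - h x))"
    by simp
  also have "\<dots> \<le> 2 * L2_norm_sq \<Omega> (\<lambda>x. f x - g x) + 2 * L2_norm_sq \<Omega> (\<lambda>x. g x - h x)"
    using assms by (intro L2_norm_sq_add_le borel_measurable_diff)
  also have "\<dots> \<le> ennreal e"
    using assms by (intro ennreal_twice_quarter)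
  finally show ?thesis .
qed

text \<open>A diagonal choice: a test function close to the approximating \<psi> is also close to w.
  This permits approximation by any members of \<open>H10\<close> instead of test functions.\<close>

lemma H10_closed:
  assumes meas: "w \<in> borel_measurable (lebesgue_on \<Omega>)" "Dw \<in> borel_measurable (lebesgue_on \<Omega>)"
    and approx: "\<And>e. 0 < e \<Longrightarrow> \<exists>\<psi> D\<psi>. H10 \<Omega> \<psi> D\<psi> \<and> L2_norm_sq \<Omega> (\<lambda>x. \<psi> x - w x) \<le> ennreal e \<and>
      L2_norm_sq \<Omega> (\<lambda>x. D\<psi> x - Dw x) \<le> ennreal e"
  shows "H10 \<Omega> w Dw"
proof (rule H10I[OF meas])
  fix e :: real assume "0 < e"
  then have e: "0 < e / 4" by simp
  obtain \<psi> D\<psi> where \<psi>: "H10 \<Omega> \<psi> D\<psi>" "L2_norm_sq \<Omega> (\<lambda>x. \<psi> x - w x) \<le> ennreal (e / 4)"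
      "L2_norm_sq \<Omega> (\<lambda>x. D\<psi> x - Dw x) \<le> ennreal (e / 4)"
    using approx[OF e] by blast
  obtain \<phi> where \<phi>: "test_fun \<Omega> \<phi>" "L2_norm_sq \<Omega> (\<lambda>x. \<phi> x - \<psi> x) \<le> ennreal (e / 4)"
      "L2_norm_sq \<Omega> (\<lambda>x. grad \<phi> x - D\<psi> x) \<le> ennreal (e / 4)"
    using H10_approx[OF \<psi>(1) e] .
  note m = test_fun_measurable[OF \<phi>(1)] H10_measurable[OF \<psi>(1)] meas
  show "\<exists>\<phi>. test_fun \<Omega> \<phi> \<and> L2_norm_sq \<Omega> (\<lambda>x. \<phi> x - w x) \<le> ennreal e \<and>
      L2_norm_sq \<Omega> (\<lambda>x. grad \<phi> x - Dw x) \<le> ennreal e"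
    using L2_norm_sq_diff_triangle[OF m(1,3,5) \<open>0 < e\<close> \<phi>(2) \<psi>(2)]
      L2_norm_sq_diff_triangle[OF m(2,4,6) \<open>0 < e\<close> \<phi>(3) \<psi>(3)] \<phi>(1) by blast
qed

lemma H10_lincomb:
  assumes u: "H10 \<Omega> u Du" and w: "H10 \<Omega> w Dw"
  shows "H10 \<Omega> (\<lambda>x. u x + c * w x) (\<lambda>x. Du x + c *\<^sub>R Dw x)"
proof (rule H10I)
  note mu = H10_measurable[OF u] and mw = H10_measurable[OF w]
  show "(\<lambda>x. u x + c * w x) \<in> borel_measurable (lebesgue_on \<Omega>)"
    "(\<lambda>x. Du x + c *\<^sub>R Dw x) \<in> borel_measurable (lebesgue_on \<Omega>)"
    using mu mw by measurable
  fix e :: real assume e: "0 < e"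
  \<comment> \<open>Scaling by c multiplies the squared norm by its square, which must stay below e
    / 4; the added 1 covers c = 0.\<close>
  have d: "0 < e / (4 * (c\<^sup>2 + 1))"
    using e by (intro divide_pos_pos) (auto simp: add_nonneg_pos)
  obtain \<phi> where \<phi>: "test_fun \<Omega> \<phi>" "L2_norm_sq \<Omega> (\<lambda>x. \<phi> x - u x) \<le> ennreal (e / 4)"
      "L2_norm_sq \<Omega> (\<lambda>x. grad \<phi> x - Du x) \<le> ennreal (e / 4)"
    using H10_approx[OF u, of "e / 4"] e by auto
  obtain \<psi> where \<psi>: "test_fun \<Omega> \<psi>" "L2_norm_sq \<Omega> (\<lambda>x. \<psi> x - w x) \<le> ennreal (e / (4 * (c\<^sup>2 + 1)))"
      "L2_norm_sq \<Omega> (\<lambda>x. grad \<psi> x - Dw x) \<le> ennreal (e / (4 * (c\<^sup>2 + 1)))"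
    using H10_approx[OF w d] .
  note m\<phi> = test_fun_measurable[OF \<phi>(1)] and m\<psi> = test_fun_measurable[OF \<psi>(1)]
  have ce: "ennreal (c\<^sup>2) * A \<le> ennreal (e / 4)" if "A \<le> ennreal (e / (4 * (c\<^sup>2 + 1)))" for A
  proof -
    have "ennreal (c\<^sup>2) * A \<le> ennreal (c\<^sup>2) * ennreal (e / (4 * (c\<^sup>2 + 1)))"
      using that by (rule mult_left_mono) simp
    also have "\<dots> = ennreal (c\<^sup>2 * (e / (4 * (c\<^sup>2 + 1))))"
      by (intro ennreal_mult[symmetric] less_imp_le[OF d]) simp
    also have "c\<^sup>2 * (e / (4 * (c\<^sup>2 + 1))) \<le> e / 4"
    proof -
      have "c\<^sup>2 + 1 > 0" by (simp add: add_nonneg_pos)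
      then show ?thesis using e by (simp add: field_simps)
    qed
    finally show ?thesis by (simp add: ennreal_leI)
  qed
  have "L2_norm_sq \<Omega> (\<lambda>x. (\<phi> x + c * \<psi> x) - (u x + c * w x)) \<le> ennreal e"
  proof -
    have "L2_norm_sq \<Omega> (\<lambda>x. (\<phi> x + c * \<psi> x) - (u x + c * w x))
        = L2_norm_sq \<Omega> (\<lambda>x. (\<phi> x - u x) + c * (\<psi> x - w x))"
      by (simp add: algebra_simps)
    also have "\<dots> \<le> 2 * L2_norm_sq \<Omega> (\<lambda>x. \<phi> x - u x) + 2 * L2_norm_sq \<Omega> (\<lambda>x. c * (\<psi> x - w x))"
      using m\<phi> m\<psi> mu mw by (intro L2_norm_sq_add_le; measurable)
    also have "\<dots> \<le> ennreal e"
      using L2_norm_sq_le_cmult[of \<Omega> "\<lambda>x. c * (\<psi> x - w x)" "\<bar>c\<bar>" "\<lambda>x. \<psi> x - w x"] m\<psi> mw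
      by (intro ennreal_twice_quarter \<phi>(2) e order_trans[OF _ ce[OF \<psi>(2)]])
        (auto simp: abs_mult intro: borel_measurable_diff)
    finally show ?thesis .
  qed
  moreover have "grad (\<lambda>x. \<phi> x + c * \<psi> x) x = grad \<phi> x + c *\<^sub>R grad \<psi> x" for x
    by (rule grad_eqI)
      (use has_derivative_add[OF test_fun_1D(1)[OF \<phi>(1)] has_derivative_mult_right[OF test_fun_1D(1)[OF \<psi>(1)]]]
        in \<open>simp add: inner_add_left\<close>)
  moreover have "L2_norm_sq \<Omega> (\<lambda>x. (grad \<phi> x + c *\<^sub>R grad \<psi> x) - (Du x + c *\<^sub>R Dw x)) \<le> ennreal e"
  proof -
    have "L2_norm_sq \<Omega> (\<lambda>x. (grad \<phi> x + c *\<^sub>R grad \<psi> x) - (Du x + c *\<^sub>R Dw x))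
        = L2_norm_sq \<Omega> (\<lambda>x. (grad \<phi> x - Du x) + c *\<^sub>R (grad \<psi> x - Dw x))"
      by (simp add: algebra_simps)
    also have "\<dots> \<le> 2 * L2_norm_sq \<Omega> (\<lambda>x. grad \<phi> x - Du x) + 2 * L2_norm_sq \<Omega> (\<lambda>x. c *\<^sub>R (grad \<psi> x - Dw x))"
      using m\<phi> m\<psi> mu mw by (intro L2_norm_sq_add_le; measurable)
    also have "\<dots> \<le> ennreal e"
      using L2_norm_sq_le_cmult[of \<Omega> "\<lambda>x. c *\<^sub>R (grad \<psi> x - Dw x)" "\<bar>c\<bar>" "\<lambda>x. grad \<psi> x - Dw x"] m\<psi> mw
      by (intro ennreal_twice_quarter \<phi>(3) e order_trans[OF _ ce[OF \<psi>(3)]])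
        (auto intro: borel_measurable_diff)
    finally show ?thesis .
  qed
  ultimately show "\<exists>\<phi>. test_fun \<Omega> \<phi> \<and> L2_norm_sq \<Omega> (\<lambda>x. \<phi> x - (u x + c * w x)) \<le> ennreal e \<and>
      L2_norm_sq \<Omega> (\<lambda>x. grad \<phi> x - (Du x + c *\<^sub>R Dw x)) \<le> ennreal e"
    by (intro exI[of _ "\<lambda>x. \<phi> x + c * \<psi> x"]) (simp add: test_fun_lincomb \<phi>(1) \<psi>(1))
qed

section \<open>Mollification\<close>

lemma norm_le_mem_cbox_vec:
  fixes z :: "real^2"
  shows "norm z \<le> r \<Longrightarrow> z \<in> cbox (vec (- r)) (vec r)"
  using component_le_norm_cart[of z] by (auto simp: mem_box_cart abs_le_iff) (smt (verit))+

text \<open>No bump function has to be constructed: if there is no nonzero test function, every element of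
  \<open>H\<^sub>0\<^sup>1\<close> vanishes, and otherwise the square of a nonzero test function is rescaled.\<close>

lemma exists_mollifier:
  assumes \<phi>: "test_fun \<Omega> \<phi>" "\<phi> x0 \<noteq> 0" and r: "0 < r"
  obtains \<eta> :: "real^2 \<Rightarrow> real" where "\<And>k. Ck_on k UNIV \<eta>" "\<And>z. 0 \<le> \<eta> z" "\<And>z. r < norm z \<Longrightarrow> \<eta> z = 0"
    "integral (cbox (vec (- r)) (vec r)) \<eta> = 1"
proof -
  have "bounded (closure {x. \<phi> x \<noteq> 0})"
    using \<phi> by (simp add: test_fun_def compact_imp_bounded)
  then obtain R where R: "0 < R" "\<And>x. x \<in> closure {x. \<phi> x \<noteq> 0} \<Longrightarrow> norm x \<le> R"
    unfolding bounded_pos by blast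
  \<comment> \<open>Evaluating at s z instead of z shrinks a support within radius R to one within
    radius r.\<close>
  define s where "s = R / r"
  have s: "0 < s" using R r by (simp add: s_def)
  define \<rho> where "\<rho> z = (\<phi> z * \<phi> z)" for z
  let ?Q = "cbox (vec (- r)) (vec r) :: (real^2) set"
  define I where "I = integral ?Q (\<lambda>z. 1 *\<^sub>R \<rho> (s *\<^sub>R z))"
  have smooth: "Ck_on k UNIV (\<lambda>z. c *\<^sub>R \<rho> (s *\<^sub>R z))" for c k
    using \<phi>(1) unfolding \<rho>_def test_fun_def by (intro Ck_on_dilation[of k "\<lambda>z. \<phi> z * \<phi> z"] Ck_on_mult) auto
  have cont: "continuous_on ?Q (\<lambda>z. 1 *\<^sub>R \<rho> (s *\<^sub>R z))"
    using smooth[of 0 1] by (auto intro: continuous_on_subset)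
  have zero: "\<rho> (s *\<^sub>R z) = 0" if "r < norm z" for z
  proof -
    have "R < norm (s *\<^sub>R z)" using that s r by (simp add: s_def field_simps)
    then have "s *\<^sub>R z \<notin> {x. \<phi> x \<noteq> 0}"
      using R(2)[of "s *\<^sub>R z"] closure_subset[of "{x. \<phi> x \<noteq> 0}"] by (meson not_le subsetD)
    then show ?thesis by (simp add: \<rho>_def)
  qed
  have pos: "\<rho> (s *\<^sub>R (x0 /\<^sub>R s)) > 0"
  proof -
    have "0 < \<phi> x0 * \<phi> x0" using \<phi>(2) by (metis not_real_square_gt_zero)
    then show ?thesis using s by (simp add: \<rho>_def)
  qed
  then have "norm (x0 /\<^sub>R s) \<le> r" using zero by (metis less_irrefl not_le)
  then have x0: "x0 /\<^sub>R s \<in> ?Q" by (rule norm_le_mem_cbox_vec)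
  have I0: "0 \<le> I" unfolding I_def
    by (rule integral_nonneg[OF integrable_continuous[OF cont]]) (simp add: \<rho>_def)
  \<comment> \<open>A continuous nonnegative function with zero integral over a box vanishes there,
    but this one is positive at \<open>x0 /\<^sub>R s\<close>.\<close>
  have "I \<noteq> 0"
  proof
    assume "I = 0"
    then have "((\<lambda>z. 1 *\<^sub>R \<rho> (s *\<^sub>R z)) has_integral 0) ?Q"
      using integrable_integral[OF integrable_continuous[OF cont]] by (simp add: I_def)
    moreover have "box (vec (- r)) (vec r) \<noteq> ({} :: (real^2) set)"
      using r by (simp add: interval_ne_empty_cart)
    ultimately have "1 *\<^sub>R \<rho> (s *\<^sub>R (x0 /\<^sub>R s)) = 0"
      using has_integral_0_cbox_imp_0[OF cont _ _ _ x0] by (simp add: \<rho>_def)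
    with pos show False by simp
  qed
  with I0 have I: "0 < I" by simp
  show ?thesis
  proof (rule that[of "\<lambda>z. (1 / I) *\<^sub>R \<rho> (s *\<^sub>R z)"])
    show "integral ?Q (\<lambda>z. (1 / I) *\<^sub>R \<rho> (s *\<^sub>R z)) = 1"
      using I by (simp add: I_def)
    show "Ck_on k UNIV (\<lambda>z. (1 / I) *\<^sub>R \<rho> (s *\<^sub>R z))" for k by (rule smooth)
  qed (use zero I in \<open>auto simp: \<rho>_def\<close>)
qed

text \<open>Uniform continuity on a ball one unit larger than the support suffices: for a shift of
  length at most 1, either both points lie in that ball or f vanishes at both. The resulting d
  serves all x.\<close>

lemma compact_support_shift:
  fixes f :: "'a::euclidean_space \<Rightarrow> 'b::real_normed_vector"
  assumes f: "continuous_on UNIV f" and S: "compact S" "\<And>x. x \<notin> S \<Longrightarrow> f x = 0" and e: "0 < e"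
  obtains d where "0 < d" "\<And>x z. norm z \<le> d \<Longrightarrow> norm (f (x - z) - f x) \<le> e"
proof -
  obtain R where R: "S \<subseteq> cball 0 R"
    using bounded_subset_ballD[OF compact_imp_bounded[OF S(1)], of 0] ball_subset_cball by blast
  have "uniformly_continuous_on (cball 0 (R + 1)) f"
    using f by (intro compact_uniformly_continuous) (auto intro: continuous_on_subset)
  then obtain d where d: "0 < d" "\<And>x y. x \<in> cball 0 (R + 1) \<Longrightarrow> y \<in> cball 0 (R + 1) \<Longrightarrow> dist y x < d \<Longrightarrow> dist (f y) (f x) < e"
    using e unfolding uniformly_continuous_on_def by metis
  show ?thesis
  proof (rule that[of "min (d / 2) 1"])
    show "0 < min (d / 2) 1" using d by simp
    fix x z :: 'a assume z: "norm z \<le> min (d / 2) 1"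
    have tri: "norm (x - z) \<le> norm x + norm z" "norm x \<le> norm (x - z) + norm z"
      using norm_triangle_ineq4[of x z] norm_triangle_ineq[of "x - z" z] by auto
    show "norm (f (x - z) - f x) \<le> e"
    proof (cases "x \<in> S \<or> x - z \<in> S")
      case True
      then have "norm x \<le> R \<or> norm (x - z) \<le> R" using R by auto
      then have "x \<in> cball 0 (R + 1)" "x - z \<in> cball 0 (R + 1)" using z tri by auto
      moreover have "dist (x - z) x < d" using z d(1) by (simp add: dist_norm)
      ultimately have "dist (f (x - z)) (f x) < e" by (rule d(2))
      then show ?thesis by (simp add: dist_norm)
    next
      case False
      then show ?thesis using S(2) e by simp
    qed
  qed
qed

text \<open>The kernel has total mass 1, so \<open>f x\<close> is its own average and the error is
  an average of differences, each at most e on the support of the kernel.\<close>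

lemma mollification_error:
  fixes f :: "real^2 \<Rightarrow> 'b::euclidean_space"
  assumes f: "continuous_on UNIV f" and \<eta>: "continuous_on UNIV \<eta>" "\<And>z. 0 \<le> \<eta> z"
      "\<And>z. r < norm z \<Longrightarrow> \<eta> z = 0" "integral (cbox (vec (- r)) (vec r)) \<eta> = 1"
    and d: "\<And>z. norm z \<le> r \<Longrightarrow> norm (f (x - z) - f x) \<le> e"
  shows "norm (integral (cbox (vec (- r)) (vec r)) (\<lambda>z. \<eta> z *\<^sub>R f (x - z)) - f x) \<le> e"
proof -
  let ?Q = "cbox (vec (- r)) (vec r) :: (real^2) set"
  have c\<eta>: "continuous_on ?Q \<eta>" using \<eta>(1) continuous_on_subset by blast
  have cf: "continuous_on ?Q (\<lambda>z. f (x - z))"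
    by (rule continuous_on_compose2[OF f, of _ "\<lambda>z. x - z"]) (auto intro!: continuous_intros)
  have i: "(\<lambda>z. \<eta> z *\<^sub>R f (x - z)) integrable_on ?Q" "(\<lambda>z. \<eta> z *\<^sub>R f x) integrable_on ?Q"
    "(\<lambda>z. \<eta> z *\<^sub>R (f (x - z) - f x)) integrable_on ?Q" "(\<lambda>z. \<eta> z * e) integrable_on ?Q" "\<eta> integrable_on ?Q"
    by (intro integrable_continuous continuous_intros c\<eta> cf)+
  have "integral ?Q (\<lambda>z. \<eta> z *\<^sub>R f x) = f x"
    using integral_linear[OF i(5) bounded_linear_scaleR_left[of "f x"]] \<eta>(4) by (simp add: o_def)
  then have "integral ?Q (\<lambda>z. \<eta> z *\<^sub>R f (x - z)) - f x = integral ?Q (\<lambda>z. \<eta> z *\<^sub>R (f (x - z) - f x))"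
    using integral_diff[OF i(1,2)] by (simp add: scaleR_diff_right)
  also have "norm \<dots> \<le> integral ?Q (\<lambda>z. \<eta> z * e)"
  proof (rule integral_norm_bound_integral[OF i(3,4)])
    fix z
    show "norm (\<eta> z *\<^sub>R (f (x - z) - f x)) \<le> \<eta> z * e"
      using d[of z] \<eta>(2)[of z] \<eta>(3)[of z] by (cases "norm z \<le> r") (auto intro: mult_left_mono)
  qed
  also have "\<dots> = e" using \<eta>(4) by simp
  finally show ?thesis .
qed

lemma has_derivative_zero_outside:
  assumes "closed S" "\<And>y. y \<notin> S \<Longrightarrow> f y = 0" "x \<notin> S"
  shows "(f has_derivative (\<lambda>_. 0)) (at x)"
  by (rule has_derivative_transform_within_open[of "\<lambda>_. 0" _ _ UNIV "- S"])
    (use assms in \<open>auto simp: open_Compl\<close>)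

text \<open>A kernel of small radius keeps the support inside \<Omega>, and both function and
  gradient converge uniformly, hence in L2 on the bounded set \<Omega>. The nonzero test function
  supplies the kernel.\<close>

lemma H10_C1_compact_support:
  fixes \<psi> :: "real^2 \<Rightarrow> real" and p :: "real^2 \<Rightarrow> real^2"
  assumes \<Omega>: "open \<Omega>" "bounded \<Omega>" and \<phi>: "test_fun \<Omega> \<phi>" "\<phi> x0 \<noteq> 0"
    and \<psi>: "\<And>x. (\<psi> has_derivative (\<lambda>h. p x \<bullet> h)) (at x)" and p: "continuous_on UNIV p"
    and S: "compact S" "S \<subseteq> \<Omega>" "\<And>x. x \<notin> S \<Longrightarrow> \<psi> x = 0"
  shows "H10 \<Omega> \<psi> p"
proof (rule H10I)
  have c\<psi>: "continuous_on UNIV \<psi>"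
    by (rule continuous_on_if_has_derivative[OF \<psi>])
  show "\<psi> \<in> borel_measurable (lebesgue_on \<Omega>)" "p \<in> borel_measurable (lebesgue_on \<Omega>)"
    using c\<psi> p by (auto intro: measurable_lebesgue_on_continuous)
  have p0: "p x = 0" if "x \<notin> S" for x
  proof -
    have "(\<psi> has_derivative (\<lambda>h. 0)) (at x)"
      by (rule has_derivative_zero_outside[OF compact_imp_closed[OF S(1)] S(3) that])
    then have "(\<lambda>h. p x \<bullet> h) = (\<lambda>h. 0)"
      by (rule has_derivative_unique[OF \<psi>])
    then have "p x \<bullet> p x = 0" by (rule fun_cong)
    then show ?thesis by simp
  qed
  have \<Omega>m: "\<Omega> \<in> lmeasurable" using \<Omega> by (simp add: lmeasurable_open)
  fix e :: real assume e: "0 < e"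
  let ?V = "measure lebesgue \<Omega>"
  \<comment> \<open>A uniform error \<open>e1\<close> costs its square times the area of \<Omega> in
    squared norm, at most e; the added 1 avoids a division by 0.\<close>
  define e1 where "e1 = sqrt (e / (?V + 1))"
  have V: "0 < ?V + 1" by (simp add: add_nonneg_pos)
  have e1: "0 < e1" using e V by (simp add: e1_def)
  have "e1\<^sup>2 * ?V = e * (?V / (?V + 1))"
    using e V by (simp add: e1_def)
  also have "\<dots> \<le> e * 1" using e V by (intro mult_left_mono) auto
  finally have e1e: "e1\<^sup>2 * ?V \<le> e" by simp
  obtain d1 where d1: "0 < d1" "\<And>x z. norm z \<le> d1 \<Longrightarrow> norm (\<psi> (x - z) - \<psi> x) \<le> e1"
    using compact_support_shift[OF c\<psi> S(1,3) e1] by blast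
  obtain d2 where d2: "0 < d2" "\<And>x z. norm z \<le> d2 \<Longrightarrow> norm (p (x - z) - p x) \<le> e1"
    using compact_support_shift[OF p S(1) p0 e1] by blast
  have "S \<inter> - \<Omega> = {}" using S(2) by auto
  then obtain d3 where d3: "0 < d3" "\<And>x y. x \<in> S \<Longrightarrow> y \<in> - \<Omega> \<Longrightarrow> d3 \<le> dist x y"
    using separate_compact_closed[of S "- \<Omega>"] S(1) \<Omega>(1) by (auto simp: closed_Compl)
  \<comment> \<open>Below \<open>d1\<close> and \<open>d2\<close> for the error of function and
    gradient, and strictly below the distance \<open>d3\<close> from the support to the complement
    of \<Omega>.\<close>
  define r where "r = min (min d1 d2) (d3 / 2)"
  have r: "0 < r" "r \<le> d1" "r \<le> d2" "r < d3" using d1 d2 d3 by (auto simp: r_def min_def)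
  obtain \<eta> :: "real^2 \<Rightarrow> real" where \<eta>: "\<And>k. Ck_on k UNIV \<eta>" "\<And>z. 0 \<le> \<eta> z" "\<And>z. r < norm z \<Longrightarrow> \<eta> z = 0"
      "integral (cbox (vec (- r)) (vec r)) \<eta> = 1"
    by (rule exists_mollifier[OF \<phi> r(1)]) (rule that)
  let ?Q = "cbox (vec (- r)) (vec r) :: (real^2) set"
  have c\<eta>: "continuous_on UNIV \<eta>" using \<eta>(1)[of 0] by simp
  have \<eta>Q: "\<eta> z = 0" if "z \<notin> ?Q" for z
    using that norm_le_mem_cbox_vec[of z r] \<eta>(3)[of z] by (cases "norm z \<le> r") auto
  define f where "f x = integral ?Q (\<lambda>z. \<eta> z * \<psi> (x - z))" for x
  obtain c where c: "S \<subseteq> cbox (- c) c"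
    using bounded_subset_cbox_symmetric[OF compact_imp_bounded[OF S(1)]] by blast
  \<comment> \<open>In this order the derivatives fall on the smooth kernel, which makes f smooth;
    the original order shows that its gradient is the mollified p.\<close>
  have f_eq: "f = (\<lambda>x. integral (cbox (- c) c) (\<lambda>y. \<psi> y * \<eta> (x - y)))"
    unfolding f_def using c S(3) \<eta>Q
    by (intro ext convolution_commute[OF c\<eta> c\<psi>]) auto
  have grad_f: "grad f x = integral ?Q (\<lambda>z. \<eta> z *\<^sub>R p (x - z))" for x
    unfolding f_def[abs_def] by (rule grad_eqI[OF has_derivative_convolution[OF c\<eta> p \<psi>]])
  have "test_fun \<Omega> f"
  proof (rule test_funI)
    show "Ck_on k UNIV f" for k
      unfolding f_eq by (rule Ck_on_convolution[OF c\<psi> \<eta>(1)])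
    let ?T = "{y + z |y z. y \<in> S \<and> z \<in> cball 0 r}"
    show "compact ?T" using S(1) by (intro compact_sums) auto
    show "?T \<subseteq> \<Omega>"
    proof clarify
      fix y z assume "y \<in> S" "z \<in> cball (0 :: real^2) r"
      then have "dist y (y + z) < d3" using r by (simp add: dist_norm)
      then show "y + z \<in> \<Omega>" using d3(2)[OF \<open>y \<in> S\<close>, of "y + z"] by force
    qed
    show "f x = 0" if x: "x \<notin> ?T" for x
    proof -
      have "\<eta> z * \<psi> (x - z) = 0" for z
      proof (cases "norm z \<le> r")
        case True
        then have "x - z \<notin> S" using x by (force intro: exI[of _ "x - z"] exI[of _ z])
        then show ?thesis using S(3) by simp
      next
        case False
        then show ?thesis using \<eta>(3) by simp
      qed
      then have "(\<lambda>z. \<eta> z * \<psi> (x - z)) = (\<lambda>_. 0)" by (rule ext)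
      then show ?thesis unfolding f_def by (simp only: integral_0)
    qed
  qed
  moreover have "L2_norm_sq \<Omega> (\<lambda>x. f x - \<psi> x) \<le> ennreal e"
  proof -
    have "norm (f x - \<psi> x) \<le> e1" for x
      using mollification_error[OF c\<psi> c\<eta> \<eta>(2-4), of x e1] d1(2) r by (simp add: f_def)
    from L2_norm_sq_uniform_le[OF \<Omega>m this] show ?thesis
      using e1e by (meson ennreal_leI order_trans)
  qed
  moreover have "L2_norm_sq \<Omega> (\<lambda>x. grad f x - p x) \<le> ennreal e"
  proof -
    have "norm (grad f x - p x) \<le> e1" for x
      using mollification_error[OF p c\<eta> \<eta>(2-4), of x e1] d2(2) r by (simp add: grad_f)
    from L2_norm_sq_uniform_le[OF \<Omega>m this] show ?thesis
      using e1e by (meson ennreal_leI order_trans)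
  qed
  ultimately show "\<exists>f. test_fun \<Omega> f \<and> L2_norm_sq \<Omega> (\<lambda>x. f x - \<psi> x) \<le> ennreal e \<and>
      L2_norm_sq \<Omega> (\<lambda>x. grad f x - p x) \<le> ennreal e"
    by blast
qed

lemma test_fun_zero: "test_fun \<Omega> (\<lambda>_. 0)"
  by (rule test_funI[of _ "{}"]) (auto intro: Ck_on_const)

section \<open>Division by a regular coefficient\<close>

text \<open>The quotient inherits the compact support of \<phi> but only the regularity of \<sigma>,
  so it is in general no test function and has to be mollified.\<close>

lemma H10_test_fun_divide:
  fixes \<phi> \<sigma> :: "real^2 \<Rightarrow> real"
  assumes \<Omega>: "open \<Omega>" "bounded \<Omega>" and \<phi>: "test_fun \<Omega> \<phi>"
    and \<sigma>: "Ck_on 1 \<Omega> \<sigma>" "\<And>x. x \<in> \<Omega> \<Longrightarrow> \<sigma> x \<noteq> 0"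
  shows "H10 \<Omega> (\<lambda>x. \<phi> x / \<sigma> x) (\<lambda>x. (1 / \<sigma> x) *\<^sub>R grad \<phi> x - (\<phi> x / (\<sigma> x)\<^sup>2) *\<^sub>R grad \<sigma> x)"
proof (cases "\<exists>x0. \<phi> x0 \<noteq> 0")
  case True
  then obtain x0 where x0: "\<phi> x0 \<noteq> 0" by blast
  note \<phi>D = test_fun_1D[OF \<phi>] and \<sigma>D = Ck_on_1D[OF \<sigma>(1) \<Omega>(1)]
  let ?S = "closure {x. \<phi> x \<noteq> 0}"
  have S: "compact ?S" "?S \<subseteq> \<Omega>" using \<phi> by (auto simp: test_fun_def)
  have \<phi>0: "\<phi> x = 0" if "x \<notin> ?S" for x
    using that closure_subset[of "{x. \<phi> x \<noteq> 0}"] by blast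
  have D\<phi>0: "grad \<phi> x = 0" if "x \<notin> ?S" for x
  proof (rule grad_eqI)
    show "(\<phi> has_derivative (\<lambda>h. 0 \<bullet> h)) (at x)"
      using has_derivative_zero_outside[OF closed_closure \<phi>0 that] by simp
  qed
  let ?p = "\<lambda>x. (1 / \<sigma> x) *\<^sub>R grad \<phi> x - (\<phi> x / (\<sigma> x)\<^sup>2) *\<^sub>R grad \<sigma> x"
  show ?thesis
  proof (rule H10_C1_compact_support[OF \<Omega> \<phi> x0 _ _ S])
    show "((\<lambda>x. \<phi> x / \<sigma> x) has_derivative (\<lambda>h. ?p x \<bullet> h)) (at x)" for x
    proof (cases "x \<in> ?S")
      case True
      then have x: "x \<in> \<Omega>" using S by blast
      show ?thesis
        by (rule has_derivative_eq_rhs[OF has_derivative_divide'[OF \<phi>D(1) \<sigma>D(1)[OF x] \<sigma>(2)[OF x]]])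
          (rule ext, use \<sigma>(2)[OF x] in \<open>simp add: inner_diff_left diff_divide_distrib power2_eq_square\<close>)
    next
      case False
      have "((\<lambda>x. \<phi> x / \<sigma> x) has_derivative (\<lambda>h. 0)) (at x)"
        by (rule has_derivative_zero_outside[OF closed_closure _ False], drule \<phi>0) simp
      then show ?thesis using \<phi>0[OF False] D\<phi>0[OF False] by simp
    qed
    have "continuous_on \<Omega> ?p"
    proof -
      have "continuous_on \<Omega> \<sigma>" by (rule continuous_on_if_has_derivative[OF \<sigma>D(1)])
      moreover have "continuous_on \<Omega> \<phi>" "continuous_on \<Omega> (grad \<phi>)"
        using \<phi>D(2,3) continuous_on_subset by blast+
      ultimately show ?thesis using \<sigma>D(2) \<sigma>(2) by (intro continuous_intros) auto
    qed
    moreover have "continuous_on (- ?S) ?p"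
    proof (rule continuous_on_eq[of _ "\<lambda>_. 0"])
      fix x assume "x \<in> - ?S"
      then have "x \<notin> ?S" by blast
      from \<phi>0[OF this] D\<phi>0[OF this] show "0 = ?p x" by simp
    qed (rule continuous_on_const)
    \<comment> \<open>Continuity on the whole plane by gluing two open sets: \<Omega>, where
      \<sigma> is controlled, and the complement of the support, where everything is 0 whatever
      \<sigma> is.\<close>
    ultimately have "continuous_on (\<Omega> \<union> - ?S) ?p"
      using \<Omega>(1) by (intro continuous_on_open_Un) (auto simp: open_Compl)
    moreover have "\<Omega> \<union> - ?S = UNIV" using S by blast
    ultimately show "continuous_on UNIV ?p" by simp
    show "\<phi> x / \<sigma> x = 0" if "x \<notin> ?S" for x
      using \<phi>0[OF that] by simp
  qed
next
  case False
  then have 0: "\<phi> = (\<lambda>_. 0)" by auto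
  have g0: "grad (\<lambda>_. 0) = (\<lambda>_. 0)"
    by (rule ext, rule grad_eqI) simp
  show ?thesis
    unfolding 0 g0
    by (rule H10I) (auto intro!: exI[of _ "\<lambda>_. 0"] simp: test_fun_zero g0 L2_norm_sq_def)
qed

text \<open>Division by \<sigma> is a bounded operation on pairs of function and gradient, so it
  carries approximating test functions to approximations of the quotient, and
  \<open>H10_closed\<close> applies.\<close>

lemma H10_divide:
  fixes \<sigma> w :: "real^2 \<Rightarrow> real"
  assumes \<Omega>: "open \<Omega>" "bounded \<Omega>" and w: "H10 \<Omega> w Dw"
    and \<sigma>: "Ck_on 1 \<Omega> \<sigma>" "\<And>x. x \<in> \<Omega> \<Longrightarrow> s0 \<le> \<sigma> x" "0 < s0" "\<And>x. x \<in> \<Omega> \<Longrightarrow> norm (grad \<sigma> x) \<le> b"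
  shows "H10 \<Omega> (\<lambda>x. w x / \<sigma> x) (\<lambda>x. (1 / \<sigma> x) *\<^sub>R Dw x - (w x / (\<sigma> x)\<^sup>2) *\<^sub>R grad \<sigma> x)"
proof (rule H10_closed)
  note \<sigma>D = Ck_on_1D[OF \<sigma>(1) \<Omega>(1)]
  note mw [measurable] = H10_measurable[OF w]
  have [measurable]: "\<sigma> \<in> borel_measurable (lebesgue_on \<Omega>)" "grad \<sigma> \<in> borel_measurable (lebesgue_on \<Omega>)"
    using \<sigma>D(2) continuous_on_if_has_derivative[OF \<sigma>D(1)] \<Omega>
    by (auto intro!: continuous_imp_measurable_on_sets_lebesgue)
  show "(\<lambda>x. w x / \<sigma> x) \<in> borel_measurable (lebesgue_on \<Omega>)"
    "(\<lambda>x. (1 / \<sigma> x) *\<^sub>R Dw x - (w x / (\<sigma> x)\<^sup>2) *\<^sub>R grad \<sigma> x) \<in> borel_measurable (lebesgue_on \<Omega>)"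
    by measurable
  fix e :: real assume e: "0 < e"
  have \<sigma>0: "\<sigma> x \<noteq> 0" if "x \<in> \<Omega>" for x using \<sigma>(2)[OF that] \<sigma>(3) by simp
  \<comment> \<open>One constant for both multipliers, 1 / \<sigma> and the gradient of 1 /
    \<sigma>; the entry 1 keeps it positive for the division below.\<close>
  define c where "c = max 1 (max (1 / s0) (\<bar>b\<bar> / s0\<^sup>2))"
  have c: "1 \<le> c" "1 / s0 \<le> c" "\<bar>b\<bar> / s0\<^sup>2 \<le> c" by (auto simp: c_def)
  have d: "0 < e / (4 * c\<^sup>2)" using e c(1) by simp
  obtain \<phi> where \<phi>: "test_fun \<Omega> \<phi>" "L2_norm_sq \<Omega> (\<lambda>x. \<phi> x - w x) \<le> ennreal (e / (4 * c\<^sup>2))"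
      "L2_norm_sq \<Omega> (\<lambda>x. grad \<phi> x - Dw x) \<le> ennreal (e / (4 * c\<^sup>2))"
    using H10_approx[OF w d] .
  note m\<phi> [measurable] = test_fun_measurable[OF \<phi>(1)]
  have ce: "ennreal (c\<^sup>2) * A \<le> ennreal (e / 4)" if "A \<le> ennreal (e / (4 * c\<^sup>2))" for A
  proof -
    have "ennreal (c\<^sup>2) * A \<le> ennreal (c\<^sup>2) * ennreal (e / (4 * c\<^sup>2))"
      using that by (rule mult_left_mono) simp
    also have "\<dots> = ennreal (c\<^sup>2 * (e / (4 * c\<^sup>2)))"
      by (intro ennreal_mult[symmetric] less_imp_le[OF d]) simp
    also have "c\<^sup>2 * (e / (4 * c\<^sup>2)) = e / 4" using c(1) by simp
    finally show ?thesis .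
  qed
  have inv: "\<bar>1 / \<sigma> x\<bar> \<le> c" "norm ((1 / (\<sigma> x)\<^sup>2) *\<^sub>R grad \<sigma> x) \<le> c" if x: "x \<in> \<Omega>" for x
  proof -
    have "1 / \<sigma> x \<le> 1 / s0" using \<sigma>(2)[OF x] \<sigma>(3) by (simp add: frac_le)
    then show "\<bar>1 / \<sigma> x\<bar> \<le> c" using c(2) \<sigma>(2)[OF x] \<sigma>(3) by simp
    have "norm (grad \<sigma> x) / (\<sigma> x)\<^sup>2 \<le> \<bar>b\<bar> / s0\<^sup>2"
      using \<sigma>(2)[OF x] \<sigma>(3) \<sigma>(4)[OF x] by (intro frac_le power_mono) auto
    then show "norm ((1 / (\<sigma> x)\<^sup>2) *\<^sub>R grad \<sigma> x) \<le> c" using c(3) by simp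
  qed
  let ?D = "\<lambda>x. (1 / \<sigma> x) *\<^sub>R grad \<phi> x - (\<phi> x / (\<sigma> x)\<^sup>2) *\<^sub>R grad \<sigma> x"
  have "L2_norm_sq \<Omega> (\<lambda>x. \<phi> x / \<sigma> x - w x / \<sigma> x) \<le> ennreal e"
  proof -
    have "L2_norm_sq \<Omega> (\<lambda>x. \<phi> x / \<sigma> x - w x / \<sigma> x) \<le> ennreal (c\<^sup>2) * L2_norm_sq \<Omega> (\<lambda>x. \<phi> x - w x)"
    proof (rule L2_norm_sq_le_cmult)
      fix x assume "x \<in> \<Omega>"
      have "\<phi> x / \<sigma> x - w x / \<sigma> x = (1 / \<sigma> x) * (\<phi> x - w x)" by (simp add: diff_divide_distrib)
      also have "norm \<dots> \<le> c * norm (\<phi> x - w x)"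
        unfolding norm_mult using inv(1)[OF \<open>x \<in> \<Omega>\<close>] by (intro mult_right_mono) auto
      finally show "norm (\<phi> x / \<sigma> x - w x / \<sigma> x) \<le> c * norm (\<phi> x - w x)" .
    qed measurable
    also have "\<dots> \<le> ennreal (e / 4)" by (rule ce[OF \<phi>(2)])
    also have "\<dots> \<le> ennreal e" using e by (intro ennreal_leI) simp
    finally show ?thesis .
  qed
  moreover have "L2_norm_sq \<Omega> (\<lambda>x. ?D x - ((1 / \<sigma> x) *\<^sub>R Dw x - (w x / (\<sigma> x)\<^sup>2) *\<^sub>R grad \<sigma> x)) \<le> ennreal e"
  proof -
    have "L2_norm_sq \<Omega> (\<lambda>x. ?D x - ((1 / \<sigma> x) *\<^sub>R Dw x - (w x / (\<sigma> x)\<^sup>2) *\<^sub>R grad \<sigma> x))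
      = L2_norm_sq \<Omega> (\<lambda>x. (1 / \<sigma> x) *\<^sub>R (grad \<phi> x - Dw x) + (\<phi> x - w x) *\<^sub>R ((- 1 / (\<sigma> x)\<^sup>2) *\<^sub>R grad \<sigma> x))"
      by (simp add: algebra_simps diff_divide_distrib)
    also have "\<dots> \<le> 2 * L2_norm_sq \<Omega> (\<lambda>x. (1 / \<sigma> x) *\<^sub>R (grad \<phi> x - Dw x))
        + 2 * L2_norm_sq \<Omega> (\<lambda>x. (\<phi> x - w x) *\<^sub>R ((- 1 / (\<sigma> x)\<^sup>2) *\<^sub>R grad \<sigma> x))"
      by (intro L2_norm_sq_add_le; measurable)
    also have "\<dots> \<le> ennreal e"
    proof (rule ennreal_twice_quarter[OF _ _ e])
      show "L2_norm_sq \<Omega> (\<lambda>x. (1 / \<sigma> x) *\<^sub>R (grad \<phi> x - Dw x)) \<le> ennreal (e / 4)"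
        using inv(1) by (intro order_trans[OF L2_norm_sq_le_cmult ce[OF \<phi>(3)]])
          (auto intro!: borel_measurable_diff m\<phi> mw mult_right_mono simp del: abs_divide)
      have "norm ((\<phi> x - w x) *\<^sub>R ((- 1 / (\<sigma> x)\<^sup>2) *\<^sub>R grad \<sigma> x)) \<le> c * norm (\<phi> x - w x)" if "x \<in> \<Omega>" for x
        using mult_right_mono[OF inv(2)[OF that], of "norm (\<phi> x - w x)"] by (simp add: ac_simps)
      then show "L2_norm_sq \<Omega> (\<lambda>x. (\<phi> x - w x) *\<^sub>R ((- 1 / (\<sigma> x)\<^sup>2) *\<^sub>R grad \<sigma> x)) \<le> ennreal (e / 4)"
        by (intro order_trans[OF L2_norm_sq_le_cmult ce[OF \<phi>(2)]]) (auto intro!: borel_measurable_diff m\<phi> mw)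
    qed
    finally show ?thesis .
  qed
  ultimately show "\<exists>\<psi> D\<psi>. H10 \<Omega> \<psi> D\<psi> \<and> L2_norm_sq \<Omega> (\<lambda>x. \<psi> x - w x / \<sigma> x) \<le> ennreal e \<and>
      L2_norm_sq \<Omega> (\<lambda>x. D\<psi> x - ((1 / \<sigma> x) *\<^sub>R Dw x - (w x / (\<sigma> x)\<^sup>2) *\<^sub>R grad \<sigma> x)) \<le> ennreal e"
    using H10_test_fun_divide[OF \<Omega> \<phi>(1) \<sigma>(1) \<sigma>0] by blast
qed

section \<open>Variational estimates\<close>

lemma integrable_bounded:
  fixes f :: "real^2 \<Rightarrow> 'b::euclidean_space"
  assumes "\<Omega> \<in> lmeasurable" "f \<in> borel_measurable (lebesgue_on \<Omega>)"
    and "AE x in lebesgue_on \<Omega>. norm (f x) \<le> b"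
  shows "integrable (lebesgue_on \<Omega>) f"
proof -
  interpret finite_measure "lebesgue_on \<Omega>" by (rule finite_measure_lebesgue_on[OF assms(1)])
  show ?thesis using assms by (intro integrable_const_bound[of _ b])
qed

lemma
  fixes f :: "real^2 \<Rightarrow> 'b::euclidean_space"
  assumes \<Omega>: "\<Omega> \<in> lmeasurable" and f: "f \<in> borel_measurable (lebesgue_on \<Omega>)" "L2_norm_sq \<Omega> f < \<infinity>"
  shows integrable_norm_sq: "integrable (lebesgue_on \<Omega>) (\<lambda>x. (norm (f x))\<^sup>2)"
    and integrable_L2: "integrable (lebesgue_on \<Omega>) f"
proof -
  show sq: "integrable (lebesgue_on \<Omega>) (\<lambda>x. (norm (f x))\<^sup>2)"
    using f unfolding L2_norm_sq_def by (intro integrableI_bounded) simp_all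
  have "integrable (lebesgue_on \<Omega>) (\<lambda>x. 1 + (norm (f x))\<^sup>2)"
    using sq integrable_bounded[OF \<Omega>, of "\<lambda>_. 1::real" 1] by simp
  then show "integrable (lebesgue_on \<Omega>) f"
  proof (rule Bochner_Integration.integrable_bound[OF _ f(1)])
    have "norm (f x) \<le> 1 + (norm (f x))\<^sup>2" for x
    proof (cases "norm (f x) \<le> 1")
      case False
      then have "norm (f x) * 1 \<le> norm (f x) * norm (f x)" by (intro mult_left_mono) auto
      then show ?thesis by (simp add: power2_eq_square)
    qed (simp add: add_increasing2)
    then show "AE x in lebesgue_on \<Omega>. norm (f x) \<le> norm (1 + (norm (f x))\<^sup>2)" by simp
  qed
qed

lemma integrable_inner_bounded:
  fixes f g :: "real^2 \<Rightarrow> 'b::euclidean_space"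
  assumes f: "integrable (lebesgue_on \<Omega>) f" and g: "g \<in> borel_measurable (lebesgue_on \<Omega>)"
    "AE x in lebesgue_on \<Omega>. norm (g x) \<le> b"
  shows "integrable (lebesgue_on \<Omega>) (\<lambda>x. f x \<bullet> g x)"
proof (rule Bochner_Integration.integrable_bound)
  show "integrable (lebesgue_on \<Omega>) (\<lambda>x. b * norm (f x))" using f by simp
  show "(\<lambda>x. f x \<bullet> g x) \<in> borel_measurable (lebesgue_on \<Omega>)"
    using f g(1) by (intro borel_measurable_inner) auto
  show "AE x in lebesgue_on \<Omega>. norm (f x \<bullet> g x) \<le> norm (b * norm (f x))"
    using g(2)
  proof eventually_elim
    case (elim x)
    have "norm (f x \<bullet> g x) \<le> norm (f x) * norm (g x)"
      using Cauchy_Schwarz_ineq2[of "f x" "g x"] by simp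
    also have "\<dots> \<le> norm (f x) * b" using elim by (intro mult_left_mono) auto
    also have "\<dots> \<le> norm (b * norm (f x))" by (simp add: mult.commute abs_mult[symmetric])
    finally show ?case .
  qed
qed

lemma L2_norm_sq_finite_bounded:
  assumes "\<Omega> \<in> lmeasurable" "AE x in lebesgue_on \<Omega>. norm (f x) \<le> b"
  shows "L2_norm_sq \<Omega> f < \<infinity>"
proof -
  have "L2_norm_sq \<Omega> f \<le> (\<integral>\<^sup>+x. ennreal (b\<^sup>2) \<partial>lebesgue_on \<Omega>)"
    unfolding L2_norm_sq_def using assms(2)
    by (intro nn_integral_mono_AE) (auto elim!: eventually_mono intro!: ennreal_leI power_mono)
  also have "\<dots> = ennreal (b\<^sup>2) * emeasure lebesgue \<Omega>"
    using assms by (simp add: emeasure_restrict_space fmeasurableD space_restrict_space)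
  also have "\<dots> < \<infinity>"
    using emeasure_eq_measure2[OF assms(1)] by (simp add: ennreal_mult_less_top)
  finally show ?thesis .
qed

lemma test_fun_bounded:
  assumes "test_fun \<Omega> \<phi>"
  obtains b where "\<And>x. \<bar>\<phi> x\<bar> \<le> b" "\<And>x. norm (grad \<phi> x) \<le> b"
proof -
  note D = test_fun_1D[OF assms]
  define S where "S = closure {x. \<phi> x \<noteq> 0}"
  have S: "compact S" using assms by (simp add: test_fun_def S_def)
  have 0: "\<phi> x = 0" if "x \<notin> S" for x
    using that closure_subset[of "{x. \<phi> x \<noteq> 0}"] unfolding S_def by blast
  have D0: "grad \<phi> x = 0" if "x \<notin> S" for x
    by (rule grad_eqI) (use has_derivative_zero_outside[OF compact_imp_closed[OF S] 0 that] in simp)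
  have "bounded (\<phi> ` S)" "bounded (grad \<phi> ` S)"
    using D(2,3) S by (auto intro!: compact_imp_bounded compact_continuous_image intro: continuous_on_subset)
  then obtain b1 b2 where b: "\<And>x. x \<in> S \<Longrightarrow> \<bar>\<phi> x\<bar> \<le> b1" "\<And>x. x \<in> S \<Longrightarrow> norm (grad \<phi> x) \<le> b2"
    unfolding bounded_iff by auto
  have "\<bar>\<phi> x\<bar> \<le> max 0 (max b1 b2)" for x
    using b(1)[of x] 0[of x] by (cases "x \<in> S") auto
  moreover have "norm (grad \<phi> x) \<le> max 0 (max b1 b2)" for x
    using b(2)[of x] D0[of x] by (cases "x \<in> S") auto
  ultimately show ?thesis by (rule that)
qed

text \<open>Square integrability is not written into \<open>H10\<close>; it follows because w and
  its gradient are at finite L2 distance from a bounded test function on a set of finite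
  measure.\<close>

lemma H10_L2_finite:
  assumes \<Omega>: "\<Omega> \<in> lmeasurable" and w: "H10 \<Omega> w Dw"
  shows "L2_norm_sq \<Omega> w < \<infinity>" "L2_norm_sq \<Omega> Dw < \<infinity>"
proof -
  obtain \<phi> where \<phi>: "test_fun \<Omega> \<phi>" "L2_norm_sq \<Omega> (\<lambda>x. \<phi> x - w x) \<le> ennreal 1"
      "L2_norm_sq \<Omega> (\<lambda>x. grad \<phi> x - Dw x) \<le> ennreal 1"
    using H10_approx[OF w zero_less_one] .
  obtain b where b: "\<And>x. \<bar>\<phi> x\<bar> \<le> b" "\<And>x. norm (grad \<phi> x) \<le> b"
    using test_fun_bounded[OF \<phi>(1)] by blast
  note m [measurable] = H10_measurable[OF w] test_fun_measurable[OF \<phi>(1)]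
  have fin: "L2_norm_sq \<Omega> g < \<infinity>"
    if "g \<in> borel_measurable (lebesgue_on \<Omega>)" "f \<in> borel_measurable (lebesgue_on \<Omega>)"
      "L2_norm_sq \<Omega> (\<lambda>x. f x - g x) \<le> ennreal 1" "\<And>x. norm (f x) \<le> b"
    for f g :: "real^2 \<Rightarrow> 'c::euclidean_space"
  proof -
    have "L2_norm_sq \<Omega> g = L2_norm_sq \<Omega> (\<lambda>x. (g x - f x) + f x)" by simp
    also have "\<dots> \<le> 2 * L2_norm_sq \<Omega> (\<lambda>x. g x - f x) + 2 * L2_norm_sq \<Omega> f"
      using that by (intro L2_norm_sq_add_le borel_measurable_diff)
    also have "L2_norm_sq \<Omega> (\<lambda>x. g x - f x) = L2_norm_sq \<Omega> (\<lambda>x. f x - g x)"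
      by (simp add: L2_norm_sq_def norm_minus_commute)
    also have "2 * L2_norm_sq \<Omega> (\<lambda>x. f x - g x) + 2 * L2_norm_sq \<Omega> f < \<infinity>"
      using that(3) L2_norm_sq_finite_bounded[OF \<Omega>, of f b] that(4)
      by (auto simp: ennreal_mult_less_top intro: order_le_less_trans)
    finally show ?thesis .
  qed
  show "L2_norm_sq \<Omega> w < \<infinity>" "L2_norm_sq \<Omega> Dw < \<infinity>"
    by (rule fin[OF m(1) m(3) \<phi>(2)], simp add: b) (rule fin[OF m(2) m(4) \<phi>(3) b(2)])
qed

section \<open>Euler-Lagrange equation and flux identities\<close>

lemma linear_coefficient_zero:
  fixes L Q :: real
  assumes "\<And>t. 0 \<le> t * L + t\<^sup>2 * Q"
  shows "L = 0"
proof (rule ccontr)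
  assume "L \<noteq> 0"
  define q where "q = \<bar>Q\<bar> + 1"
  have q: "0 < q" "Q \<le> q" by (auto simp: q_def)
  \<comment> \<open>The minimiser of t L + q t^2, whose minimum is negative unless L = 0.\<close>
  have "0 \<le> (- L / (2 * q)) * L + (- L / (2 * q))\<^sup>2 * Q" by (rule assms)
  also have "\<dots> \<le> (- L / (2 * q)) * L + (- L / (2 * q))\<^sup>2 * q"
    using q by (intro add_left_mono mult_left_mono) auto
  also have "\<dots> = - (L\<^sup>2 / (4 * q))"
    using q by (simp add: field_simps power2_eq_square)
  also have "\<dots> < 0" using q \<open>L \<noteq> 0\<close> by simp
  finally show False by simp
qed

text \<open>From 2 |p| |p + q| \<le> |p|^2 + |p + q|^2. An explicit quadratic remainder replaces
  differentiation of the norm under the integral sign.\<close>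

lemma norm_add_le_second_order:
  fixes p q :: "'a::real_inner"
  assumes "p \<noteq> 0"
  shows "norm (p + q) \<le> norm p + (p \<bullet> q) / norm p + (norm q)\<^sup>2 / (2 * norm p)"
proof -
  have p: "0 < norm p" using assms by simp
  have "2 * norm p * norm (p + q) \<le> (norm p)\<^sup>2 + (norm (p + q))\<^sup>2"
    by (rule sum_squares_bound)
  also have "(norm (p + q))\<^sup>2 = (norm p)\<^sup>2 + 2 * (p \<bullet> q) + (norm q)\<^sup>2"
    by (simp add: power2_norm_eq_inner algebra_simps inner_commute)
  finally show ?thesis
    using p by (simp add: field_simps power2_eq_square)
qed

text \<open>Perturbing u by t w changes the functional by at most t L + t^2 Q, and minimality makes
  this nonnegative for all t of either sign, so L = 0. The lower bound c on |Du + F| keeps Q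
  finite.\<close>

lemma euler_lagrange:
  assumes \<Omega>: "\<Omega> \<in> lmeasurable" and u: "primal_solution \<Omega> a F H u Du" and w: "H10 \<Omega> w Dw"
    and a: "a \<in> borel_measurable (lebesgue_on \<Omega>)" "AE x in lebesgue_on \<Omega>. 0 \<le> a x \<and> a x \<le> M"
    and F: "F \<in> borel_measurable (lebesgue_on \<Omega>)" "AE x in lebesgue_on \<Omega>. norm (F x) \<le> kF"
    and H: "H \<in> borel_measurable (lebesgue_on \<Omega>)" "AE x in lebesgue_on \<Omega>. norm (H x) \<le> kH"
    and c: "0 < c" "\<And>x. x \<in> \<Omega> \<Longrightarrow> c \<le> norm (Du x + F x)"
  shows "(\<integral>x. Dw x \<bullet> ((a x / norm (Du x + F x)) *\<^sub>R (Du x + F x)) + H x * w x \<partial>lebesgue_on \<Omega>) = 0"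
proof -
  let ?\<mu> = "lebesgue_on \<Omega>"
  have uH: "H10 \<Omega> u Du" using u by (simp add: primal_solution_def)
  define P where "P x = Du x + F x" for x
  note [measurable] = H10_measurable[OF uH] H10_measurable[OF w] a(1) F(1) H(1)
  have [measurable]: "P \<in> borel_measurable ?\<mu>" unfolding P_def by measurable
  have a': "AE x in ?\<mu>. norm (a x) \<le> M" using a(2) by eventually_elim auto
  have int_a: "integrable ?\<mu> (\<lambda>x. a x * norm (f x))"
    if "integrable ?\<mu> f" for f :: "real^2 \<Rightarrow> real^2"
    using integrable_inner_bounded[OF integrable_norm[OF that] a(1) a'] by (simp add: mult.commute)
  have int_H: "integrable ?\<mu> (\<lambda>x. H x * f x)" if "integrable ?\<mu> f" for f :: "real^2 \<Rightarrow> real"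
    using integrable_inner_bounded[OF that H] by (simp add: mult.commute)
  have iF: "integrable ?\<mu> F" using F by (intro integrable_bounded[OF \<Omega>])
  have iu: "integrable ?\<mu> u" and iDu: "integrable ?\<mu> Du" and iw: "integrable ?\<mu> w" and iDw: "integrable ?\<mu> Dw"
    using H10_L2_finite[OF \<Omega> uH] H10_L2_finite[OF \<Omega> w] by (auto intro!: integrable_L2[OF \<Omega>])
  have iP: "integrable ?\<mu> P" unfolding P_def using iDu iF by simp
  have iDw2: "integrable ?\<mu> (\<lambda>x. (norm (Dw x))\<^sup>2)"
    using H10_L2_finite[OF \<Omega> w] by (intro integrable_norm_sq[OF \<Omega>]) auto
  have iJ: "integrable ?\<mu> (\<lambda>x. Dw x \<bullet> ((a x / norm (P x)) *\<^sub>R P x))"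
  proof (rule integrable_inner_bounded[OF iDw])
    show "AE x in ?\<mu>. norm ((a x / norm (P x)) *\<^sub>R P x) \<le> \<bar>M\<bar>"
      using a(2) by eventually_elim auto
  qed measurable
  define L where "L = (\<integral>x. Dw x \<bullet> ((a x / norm (P x)) *\<^sub>R P x) + H x * w x \<partial>?\<mu>)"
  define Q where "Q = (\<integral>x. M / (2 * c) * (norm (Dw x))\<^sup>2 \<partial>?\<mu>)"
  have "0 \<le> t * L + t\<^sup>2 * Q" for t
  proof -
    have "primal_functional \<Omega> a F H u Du \<le> primal_functional \<Omega> a F H (\<lambda>x. u x + t * w x) (\<lambda>x. Du x + t *\<^sub>R Dw x)"
      using u H10_lincomb[OF uH w] unfolding primal_solution_def by blast
    then have "(\<integral>x. a x * norm (P x) + H x * u x \<partial>?\<mu>)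
        \<le> (\<integral>x. a x * norm (P x + t *\<^sub>R Dw x) + H x * (u x + t * w x) \<partial>?\<mu>)"
      by (simp add: primal_functional_def P_def add_ac)
    also have "\<dots> \<le> (\<integral>x. (a x * norm (P x) + H x * u x)
        + (t * (Dw x \<bullet> ((a x / norm (P x)) *\<^sub>R P x) + H x * w x) + t\<^sup>2 * (M / (2 * c) * (norm (Dw x))\<^sup>2)) \<partial>?\<mu>)"
    proof (rule integral_mono_AE)
      show "integrable ?\<mu> (\<lambda>x. a x * norm (P x + t *\<^sub>R Dw x) + H x * (u x + t * w x))"
        using iP iDw iu iw by (intro Bochner_Integration.integrable_add int_a int_H) simp_all
      show "integrable ?\<mu> (\<lambda>x. (a x * norm (P x) + H x * u x)
        + (t * (Dw x \<bullet> ((a x / norm (P x)) *\<^sub>R P x) + H x * w x) + t\<^sup>2 * (M / (2 * c) * (norm (Dw x))\<^sup>2)))"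
        using iP iDw2 iu iw iJ
        by (intro Bochner_Integration.integrable_add integrable_mult_right int_a int_H) simp_all
      have "AE x in ?\<mu>. x \<in> \<Omega>" by (rule AE_I2) (simp add: space_restrict_space)
      with a(2) show "AE x in ?\<mu>. a x * norm (P x + t *\<^sub>R Dw x) + H x * (u x + t * w x)
        \<le> (a x * norm (P x) + H x * u x)
        + (t * (Dw x \<bullet> ((a x / norm (P x)) *\<^sub>R P x) + H x * w x) + t\<^sup>2 * (M / (2 * c) * (norm (Dw x))\<^sup>2))"
      proof eventually_elim
        case (elim x)
        then have P: "c \<le> norm (P x)" using c by (simp add: P_def)
        then have P0: "P x \<noteq> 0" "0 < norm (P x)" using c(1) by auto
        have "a x * norm (P x + t *\<^sub>R Dw x)
            \<le> a x * (norm (P x) + (P x \<bullet> (t *\<^sub>R Dw x)) / norm (P x) + (norm (t *\<^sub>R Dw x))\<^sup>2 / (2 * norm (P x)))"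
          using elim by (intro mult_left_mono norm_add_le_second_order P0) auto
        also have "\<dots> = a x * norm (P x) + t * (Dw x \<bullet> ((a x / norm (P x)) *\<^sub>R P x))
            + t\<^sup>2 * (a x / (2 * norm (P x)) * (norm (Dw x))\<^sup>2)"
          by (simp add: algebra_simps power_mult_distrib inner_commute)
        also have "\<dots> \<le> a x * norm (P x) + t * (Dw x \<bullet> ((a x / norm (P x)) *\<^sub>R P x))
            + t\<^sup>2 * (M / (2 * c) * (norm (Dw x))\<^sup>2)"
          using elim P c(1) by (intro add_left_mono mult_left_mono mult_right_mono frac_le) auto
        finally show ?case by (simp add: algebra_simps)
      qed
    qed
    also have "\<dots> = (\<integral>x. a x * norm (P x) + H x * u x \<partial>?\<mu>) + (t * L + t\<^sup>2 * Q)"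
      unfolding L_def Q_def using iP iDw2 iu iw iJ int_a[OF iP] int_H[OF iu] int_H[OF iw]
      by (subst Bochner_Integration.integral_add; (subst Bochner_Integration.integral_add)?; simp)
    finally show ?thesis by simp
  qed
  then have "L = 0" by (rule linear_coefficient_zero)
  then show ?thesis by (simp add: L_def P_def)
qed

text \<open>The dual problem compares only the integrals of F against the fields. Testing both weak
  equations with u equates the integrals against Du, so the comparison extends to P = Du + F.
  Pointwise, however, the competitor \<open>J0\<close> maximises the product with P among fields of
  norm at most a; equality of the integrals forces equality almost everywhere.\<close>

lemma flux_norm_eq:
  assumes \<Omega>: "\<Omega> \<in> lmeasurable" and u: "primal_solution \<Omega> a F H u Du"
    and J: "dual_solution \<Omega> a F H (\<lambda>x. \<sigma> x *\<^sub>R (Du x + F x))"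
    and a: "a \<in> borel_measurable (lebesgue_on \<Omega>)" "AE x in lebesgue_on \<Omega>. 0 \<le> a x \<and> a x \<le> M"
    and F: "F \<in> borel_measurable (lebesgue_on \<Omega>)" "AE x in lebesgue_on \<Omega>. norm (F x) \<le> kF"
    and H: "H \<in> borel_measurable (lebesgue_on \<Omega>)" "AE x in lebesgue_on \<Omega>. norm (H x) \<le> kH"
    and c: "0 < c" "\<And>x. x \<in> \<Omega> \<Longrightarrow> c \<le> norm (Du x + F x)"
    and \<sigma>: "\<And>x. x \<in> \<Omega> \<Longrightarrow> 0 \<le> \<sigma> x"
  shows "AE x in lebesgue_on \<Omega>. norm (\<sigma> x *\<^sub>R (Du x + F x)) = a x"
proof -
  let ?\<mu> = "lebesgue_on \<Omega>"
  have uH: "H10 \<Omega> u Du" using u by (simp add: primal_solution_def)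
  define P where "P x = Du x + F x" for x
  define J0 where "J0 x = (a x / norm (P x)) *\<^sub>R P x" for x
  define J1 where "J1 x = \<sigma> x *\<^sub>R P x" for x
  note [measurable] = H10_measurable[OF uH] a(1) F(1) H(1)
  have [measurable]: "P \<in> borel_measurable ?\<mu>" unfolding P_def by measurable
  have mJ0 [measurable]: "J0 \<in> borel_measurable ?\<mu>" unfolding J0_def by measurable
  have in\<Omega>: "AE x in ?\<mu>. x \<in> \<Omega>" by (rule AE_I2) (simp add: space_restrict_space)
  have J0a: "AE x in ?\<mu>. norm (J0 x) \<le> a x"
    using a(2) by eventually_elim (auto simp: J0_def)
  have J0M: "AE x in ?\<mu>. norm (J0 x) \<le> M"
    using J0a a(2) by eventually_elim auto
  have "dual_feasible \<Omega> a H J0"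
    unfolding dual_feasible_def
  proof (intro conjI allI impI)
    show "(\<integral>x. Dw x \<bullet> J0 x + H x * w x \<partial>?\<mu>) = 0" if "H10 \<Omega> w Dw" for w Dw
      using euler_lagrange[OF \<Omega> u that a F H c] unfolding J0_def P_def .
  qed (use mJ0 J0a L2_norm_sq_finite_bounded[OF \<Omega> J0M] in auto)
  then have le: "(\<integral>x. F x \<bullet> J0 x \<partial>?\<mu>) \<le> (\<integral>x. F x \<bullet> J1 x \<partial>?\<mu>)"
    and eq0: "(\<integral>x. Du x \<bullet> J0 x + H x * u x \<partial>?\<mu>) = 0"
    using J uH unfolding dual_solution_def dual_feasible_def J1_def P_def by blast+
  have J1: "J1 \<in> borel_measurable ?\<mu>" "AE x in ?\<mu>. norm (J1 x) \<le> a x"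
    and eq1: "(\<integral>x. Du x \<bullet> J1 x + H x * u x \<partial>?\<mu>) = 0"
    using J uH unfolding dual_solution_def dual_feasible_def J1_def P_def by blast+
  have J1M: "AE x in ?\<mu>. norm (J1 x) \<le> M"
    using J1(2) a(2) by eventually_elim auto
  have iF: "integrable ?\<mu> F" using F by (intro integrable_bounded[OF \<Omega>])
  have iu: "integrable ?\<mu> u" and iDu: "integrable ?\<mu> Du"
    using H10_L2_finite[OF \<Omega> uH] H10_measurable[OF uH] by (auto intro!: integrable_L2[OF \<Omega>])
  have iP: "integrable ?\<mu> P" unfolding P_def using iDu iF by simp
  have iHu: "integrable ?\<mu> (\<lambda>x. H x * u x)"
    using integrable_inner_bounded[OF iu H] by (simp add: mult.commute)
  note i0 = integrable_inner_bounded[OF _ mJ0 J0M] and i1 = integrable_inner_bounded[OF _ J1(1) J1M]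
  have "(\<integral>x. P x \<bullet> J0 x \<partial>?\<mu>) \<le> (\<integral>x. P x \<bullet> J1 x \<partial>?\<mu>)"
  proof -
    have "(\<integral>x. P x \<bullet> J0 x \<partial>?\<mu>) = (\<integral>x. Du x \<bullet> J0 x \<partial>?\<mu>) + (\<integral>x. F x \<bullet> J0 x \<partial>?\<mu>)"
      "(\<integral>x. P x \<bullet> J1 x \<partial>?\<mu>) = (\<integral>x. Du x \<bullet> J1 x \<partial>?\<mu>) + (\<integral>x. F x \<bullet> J1 x \<partial>?\<mu>)"
      unfolding P_def inner_add_left
      by (rule Bochner_Integration.integral_add i0 i1 iDu iF)+
    moreover have "(\<integral>x. Du x \<bullet> J0 x \<partial>?\<mu>) + (\<integral>x. H x * u x \<partial>?\<mu>) = 0"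
      "(\<integral>x. Du x \<bullet> J1 x \<partial>?\<mu>) + (\<integral>x. H x * u x \<partial>?\<mu>) = 0"
      using eq0 eq1 Bochner_Integration.integral_add[OF i0[OF iDu] iHu]
        Bochner_Integration.integral_add[OF i1[OF iDu] iHu] by simp_all
    ultimately show ?thesis using le by simp
  qed
  then have int_le: "(\<integral>x. P x \<bullet> J0 x - P x \<bullet> J1 x \<partial>?\<mu>) \<le> 0"
    using i0[OF iP] i1[OF iP] by simp
  have nonneg: "AE x in ?\<mu>. 0 \<le> P x \<bullet> J0 x - P x \<bullet> J1 x"
    using J1(2)
  proof eventually_elim
    case (elim x)
    have "P x \<bullet> J1 x \<le> norm (P x) * norm (J1 x)" by (rule norm_cauchy_schwarz)
    also have "\<dots> \<le> norm (P x) * a x" using elim by (intro mult_left_mono) auto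
    also have "\<dots> = P x \<bullet> J0 x"
      by (simp add: J0_def dot_square_norm power2_eq_square)
    finally show ?case by simp
  qed
  have "(\<integral>x. P x \<bullet> J0 x - P x \<bullet> J1 x \<partial>?\<mu>) = 0"
    using int_le integral_nonneg_AE[OF nonneg] by simp
  then have "AE x in ?\<mu>. P x \<bullet> J0 x - P x \<bullet> J1 x = 0"
    using integral_nonneg_eq_0_iff_AE[OF _ nonneg] i0[OF iP] i1[OF iP] by simp
  with in\<Omega> show ?thesis
  proof eventually_elim
    case (elim x)
    have P: "0 < norm (P x)" using c elim(1) by (force simp: P_def)
    have "\<sigma> x * (norm (P x))\<^sup>2 = a x * norm (P x)"
      using elim(2) P by (simp add: J0_def J1_def dot_square_norm power2_eq_square)
    then have "\<sigma> x * norm (P x) = a x" using P by (simp add: power2_eq_square)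
    then show ?case using \<sigma>[OF elim(1)] by (simp add: P_def)
  qed
qed

text \<open>\<open>J'\<close> is optimal for a' and u for a. The weak equation for
  \<open>J'\<close>, tested with u - u', turns the misalignment into a difference of the
  a'-functional at u and u'; the same difference for a is at most 0, so only the error from
  exchanging a and a' remains.\<close>

lemma flux_alignment:
  assumes \<Omega>: "\<Omega> \<in> lmeasurable"
    and u: "primal_solution \<Omega> a F H u Du" and u': "H10 \<Omega> u' Du'"
    and J': "dual_feasible \<Omega> a' H (\<lambda>x. \<sigma>' x *\<^sub>R (Du' x + F x))"
    and J'a: "AE x in lebesgue_on \<Omega>. norm (\<sigma>' x *\<^sub>R (Du' x + F x)) = a' x"
    and a: "a \<in> borel_measurable (lebesgue_on \<Omega>)" "AE x in lebesgue_on \<Omega>. 0 \<le> a x \<and> a x \<le> M"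
    and a': "a' \<in> borel_measurable (lebesgue_on \<Omega>)" "AE x in lebesgue_on \<Omega>. 0 \<le> a' x \<and> a' x \<le> M"
    and \<delta>: "AE x in lebesgue_on \<Omega>. \<bar>a x - a' x\<bar> \<le> \<delta>"
    and F: "F \<in> borel_measurable (lebesgue_on \<Omega>)" "AE x in lebesgue_on \<Omega>. norm (F x) \<le> kF"
    and H: "H \<in> borel_measurable (lebesgue_on \<Omega>)" "AE x in lebesgue_on \<Omega>. norm (H x) \<le> kH"
    and V: "\<And>x. x \<in> \<Omega> \<Longrightarrow> norm (Du x + F x) \<le> V" "\<And>x. x \<in> \<Omega> \<Longrightarrow> norm (Du' x + F x) \<le> V" "0 \<le> V"
    and \<sigma>': "0 < \<sigma>0" "\<And>x. x \<in> \<Omega> \<Longrightarrow> \<sigma>0 \<le> \<sigma>' x"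
  shows "\<sigma>0 * (\<integral>x. norm (Du x + F x) * norm (Du' x + F x) - (Du x + F x) \<bullet> (Du' x + F x) \<partial>lebesgue_on \<Omega>)
    \<le> \<delta> * V * measure lebesgue \<Omega>"
proof -
  let ?\<mu> = "lebesgue_on \<Omega>"
  have uH: "H10 \<Omega> u Du" using u by (simp add: primal_solution_def)
  define P P' J where "P x = Du x + F x" and "P' x = Du' x + F x" and "J x = \<sigma>' x *\<^sub>R P' x" for x
  note [measurable] = H10_measurable[OF uH] H10_measurable[OF u'] a(1) a'(1) F(1) H(1)
  have mP [measurable]: "P \<in> borel_measurable ?\<mu>" "P' \<in> borel_measurable ?\<mu>"
    unfolding P_def P'_def by measurable
  have J: "J \<in> borel_measurable ?\<mu>" "AE x in ?\<mu>. norm (J x) \<le> a' x"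
    and weak: "\<And>w Dw. H10 \<Omega> w Dw \<Longrightarrow> (\<integral>x. Dw x \<bullet> J x + H x * w x \<partial>?\<mu>) = 0"
    using J' unfolding dual_feasible_def J_def P'_def by blast+
  note [measurable] = J(1)
  have in\<Omega>: "AE x in ?\<mu>. x \<in> \<Omega>" by (rule AE_I2) (simp add: space_restrict_space)
  have PV: "AE x in ?\<mu>. norm (P x) \<le> V" "AE x in ?\<mu>. norm (P' x) \<le> V"
    using in\<Omega> by (auto simp: P_def P'_def V elim: eventually_mono)
  have JM: "AE x in ?\<mu>. norm (J x) \<le> M" using J(2) a'(2) by eventually_elim auto
  have aM: "AE x in ?\<mu>. norm (a x) \<le> M" using a(2) by eventually_elim auto
  have a'M: "AE x in ?\<mu>. norm (a' x) \<le> M" using a'(2) by eventually_elim auto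
  have iP: "integrable ?\<mu> P" "integrable ?\<mu> P'"
    using PV mP by (auto intro: integrable_bounded[OF \<Omega>])
  have iu: "integrable ?\<mu> u" "integrable ?\<mu> u'"
    using H10_L2_finite[OF \<Omega> uH] H10_L2_finite[OF \<Omega> u'] H10_measurable[OF uH] H10_measurable[OF u']
    by (auto intro!: integrable_L2[OF \<Omega>])
  have iH: "integrable ?\<mu> (\<lambda>x. H x * u x)" "integrable ?\<mu> (\<lambda>x. H x * u' x)"
    using integrable_inner_bounded[OF iu(1) H] integrable_inner_bounded[OF iu(2) H] by (simp_all add: mult.commute)
  have iJ: "integrable ?\<mu> (\<lambda>x. P x \<bullet> J x)" "integrable ?\<mu> (\<lambda>x. P' x \<bullet> J x)"
    using iP J JM by (auto intro: integrable_inner_bounded)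
  have ia: "integrable ?\<mu> (\<lambda>x. a x * norm (P x))" "integrable ?\<mu> (\<lambda>x. a x * norm (P' x))"
    "integrable ?\<mu> (\<lambda>x. a' x * norm (P x))" "integrable ?\<mu> (\<lambda>x. a' x * norm (P' x))"
    using integrable_inner_bounded[OF integrable_norm[OF iP(1)] a(1) aM]
      integrable_inner_bounded[OF integrable_norm[OF iP(2)] a(1) aM]
      integrable_inner_bounded[OF integrable_norm[OF iP(1)] a'(1) a'M]
      integrable_inner_bounded[OF integrable_norm[OF iP(2)] a'(1) a'M]
    by (simp_all add: mult.commute)
  have opt: "(\<integral>x. a x * norm (P x) + H x * u x \<partial>?\<mu>) \<le> (\<integral>x. a x * norm (P' x) + H x * u' x \<partial>?\<mu>)"
    using u u' unfolding primal_solution_def primal_functional_def P_def P'_def by blast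
  have weak0: "(\<integral>x. P x \<bullet> J x - P' x \<bullet> J x + (H x * u x - H x * u' x) \<partial>?\<mu>) = 0"
    using weak[OF H10_lincomb[OF uH u', of "-1"]]
    by (simp add: P_def P'_def inner_diff_left inner_add_left right_diff_distrib)
  have J'P: "AE x in ?\<mu>. P' x \<bullet> J x = a' x * norm (P' x)"
    using J'a in\<Omega>
  proof eventually_elim
    case (elim x)
    have "P' x \<bullet> J x = norm (\<sigma>' x *\<^sub>R P' x) * norm (P' x)"
      using \<sigma>'(1) \<sigma>'(2)[OF elim(2)] by (simp add: J_def dot_square_norm power2_eq_square)
    with elim(1) show ?case by (simp add: P'_def)
  qed
  have fin: "measure ?\<mu> \<Omega> = measure lebesgue \<Omega>"
    using \<Omega> by (simp add: measure_restrict_space fmeasurableD)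
  interpret finite_measure ?\<mu> by (rule finite_measure_lebesgue_on[OF \<Omega>])
  have "\<sigma>0 * (\<integral>x. norm (P x) * norm (P' x) - P x \<bullet> P' x \<partial>?\<mu>)
      = (\<integral>x. \<sigma>0 * (norm (P x) * norm (P' x) - P x \<bullet> P' x) \<partial>?\<mu>)"
    by simp
  also have "\<dots> \<le> (\<integral>x. a' x * norm (P x) - P x \<bullet> J x \<partial>?\<mu>)"
  proof (rule integral_mono_AE)
    show "integrable ?\<mu> (\<lambda>x. \<sigma>0 * (norm (P x) * norm (P' x) - P x \<bullet> P' x))"
      using integrable_inner_bounded[OF integrable_norm[OF iP(1)], of "\<lambda>x. norm (P' x)" V] PV(2) mP
        integrable_inner_bounded[OF iP(1) mP(2) PV(2)] by simp
    show "integrable ?\<mu> (\<lambda>x. a' x * norm (P x) - P x \<bullet> J x)" using ia iJ by simp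
    show "AE x in ?\<mu>. \<sigma>0 * (norm (P x) * norm (P' x) - P x \<bullet> P' x) \<le> a' x * norm (P x) - P x \<bullet> J x"
      using J'a in\<Omega>
    proof eventually_elim
      case (elim x)
      have s: "\<sigma>0 \<le> \<sigma>' x" by (rule \<sigma>'(2)[OF elim(2)])
      have "\<sigma>0 * (norm (P x) * norm (P' x) - P x \<bullet> P' x) \<le> \<sigma>' x * (norm (P x) * norm (P' x) - P x \<bullet> P' x)"
        using s norm_cauchy_schwarz[of "P x" "P' x"] by (intro mult_right_mono) auto
      also have "\<dots> = norm (\<sigma>' x *\<^sub>R P' x) * norm (P x) - P x \<bullet> J x"
        using s \<sigma>'(1) by (simp add: J_def algebra_simps)
      also have "norm (\<sigma>' x *\<^sub>R P' x) = a' x" using elim(1) by (simp add: P'_def)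
      finally show ?case .
    qed
  qed
  \<comment> \<open>The added summand integrates to 0 by \<open>weak0\<close>; it trades
    \<open>P x \<bullet> J x\<close> for \<open>P' x \<bullet> J x\<close>, which equals
    \<open>a' x * norm (P' x)\<close>.\<close>
  also have "\<dots> = (\<integral>x. a' x * norm (P x) - P x \<bullet> J x
      + (P x \<bullet> J x - P' x \<bullet> J x + (H x * u x - H x * u' x)) \<partial>?\<mu>)"
    using ia iJ iH weak0 by (subst Bochner_Integration.integral_add) auto
  also have "\<dots> = (\<integral>x. a' x * norm (P x) - a' x * norm (P' x) + (H x * u x - H x * u' x) \<partial>?\<mu>)"
    using J'P by (intro integral_cong_AE) (auto elim: eventually_mono)
  \<comment> \<open>Splits off the a-functional at u minus that at u', which \<open>opt\<close>
    discards; the rest is (a' - a) times |P| - |P'|.\<close>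
  also have "\<dots> = (\<integral>x. ((a x * norm (P x) + H x * u x) - (a x * norm (P' x) + H x * u' x))
      + (a' x * norm (P x) - a' x * norm (P' x) - (a x * norm (P x) - a x * norm (P' x))) \<partial>?\<mu>)"
    by (intro Bochner_Integration.integral_cong) (auto simp: algebra_simps)
  also have "\<dots> = ((\<integral>x. a x * norm (P x) + H x * u x \<partial>?\<mu>) - (\<integral>x. a x * norm (P' x) + H x * u' x \<partial>?\<mu>))
      + (\<integral>x. a' x * norm (P x) - a' x * norm (P' x) - (a x * norm (P x) - a x * norm (P' x)) \<partial>?\<mu>)"
    using ia iH by (subst Bochner_Integration.integral_add; (subst Bochner_Integration.integral_diff)?; simp)
  also have "\<dots> \<le> (\<integral>x. a' x * norm (P x) - a' x * norm (P' x) - (a x * norm (P x) - a x * norm (P' x)) \<partial>?\<mu>)"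
    using opt by simp
  also have "\<dots> \<le> (\<integral>x. \<delta> * V \<partial>?\<mu>)"
  proof (rule integral_mono_AE)
    show "AE x in ?\<mu>. a' x * norm (P x) - a' x * norm (P' x) - (a x * norm (P x) - a x * norm (P' x)) \<le> \<delta> * V"
      using \<delta> PV
    proof eventually_elim
      case (elim x)
      have "a' x * norm (P x) - a' x * norm (P' x) - (a x * norm (P x) - a x * norm (P' x))
          = (a' x - a x) * (norm (P x) - norm (P' x))" by (simp add: algebra_simps)
      also have "\<dots> \<le> \<bar>a x - a' x\<bar> * \<bar>norm (P x) - norm (P' x)\<bar>"
        by (metis abs_ge_self abs_minus_commute abs_mult)
      also have "\<dots> \<le> \<delta> * V"
      proof (rule mult_mono)
        \<comment> \<open>Both norms lie between 0 and V, so V suffices instead of 2 V.\<close>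
        show "\<bar>norm (P x) - norm (P' x)\<bar> \<le> V"
          using elim norm_ge_zero[of "P x"] norm_ge_zero[of "P' x"] by linarith
      qed (use elim in auto)
      finally show ?case .
    qed
  qed (use ia in auto)
  also have "\<dots> = \<delta> * V * measure lebesgue \<Omega>" by (simp add: fin)
  finally show ?thesis unfolding P_def P'_def .
qed

text \<open>With test function w / \<sigma> the coefficient cancels against the flux in the leading
  term. The remainder \<open>w x * q x\<close> contains derivatives of \<sigma> but none of w, which
  is why the mean of |w| bounds it.\<close>

lemma flux_weak_divided:
  fixes \<sigma> w :: "real^2 \<Rightarrow> real"
  assumes \<Omega>: "open \<Omega>" "bounded \<Omega>" and w: "H10 \<Omega> w Dw"
    and J: "dual_feasible \<Omega> a H (\<lambda>x. \<sigma> x *\<^sub>R P x)"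
    and \<sigma>: "Ck_on 1 \<Omega> \<sigma>" "\<And>x. x \<in> \<Omega> \<Longrightarrow> s0 \<le> \<sigma> x" "0 < s0" "\<And>x. x \<in> \<Omega> \<Longrightarrow> norm (grad \<sigma> x) \<le> b"
    and P: "P \<in> borel_measurable (lebesgue_on \<Omega>)" "\<And>x. x \<in> \<Omega> \<Longrightarrow> norm (P x) \<le> V"
    and H: "H \<in> borel_measurable (lebesgue_on \<Omega>)" "\<And>x. x \<in> \<Omega> \<Longrightarrow> \<bar>H x\<bar> \<le> kH"
    and nn: "0 \<le> V" "0 \<le> b" "0 \<le> kH"
  shows "\<bar>\<integral>x. Dw x \<bullet> P x \<partial>lebesgue_on \<Omega>\<bar> \<le> (b * V + kH) / s0 * (\<integral>x. \<bar>w x\<bar> \<partial>lebesgue_on \<Omega>)"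
proof -
  let ?\<mu> = "lebesgue_on \<Omega>"
  have \<Omega>m: "\<Omega> \<in> lmeasurable" using \<Omega> by (simp add: lmeasurable_open)
  note \<sigma>D = Ck_on_1D[OF \<sigma>(1) \<Omega>(1)]
  note [measurable] = H10_measurable[OF w] P(1) H(1)
  have [measurable]: "\<sigma> \<in> borel_measurable ?\<mu>" "grad \<sigma> \<in> borel_measurable ?\<mu>"
    using \<sigma>D(2) continuous_on_if_has_derivative[OF \<sigma>D(1)] \<Omega>
    by (auto intro!: continuous_imp_measurable_on_sets_lebesgue)
  have in\<Omega>: "x \<in> \<Omega>" if "x \<in> space ?\<mu>" for x using that by (simp add: space_restrict_space)
  have iw: "integrable ?\<mu> w" and iDw: "integrable ?\<mu> Dw"
    using H10_L2_finite[OF \<Omega>m w] by (auto intro!: integrable_L2[OF \<Omega>m])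
  define q where "q x = (H x - grad \<sigma> x \<bullet> P x) / \<sigma> x" for x
  have [measurable]: "q \<in> borel_measurable ?\<mu>" unfolding q_def by measurable
  have qb: "\<bar>q x\<bar> \<le> (b * V + kH) / s0" if x: "x \<in> \<Omega>" for x
  proof -
    have "\<bar>grad \<sigma> x \<bullet> P x\<bar> \<le> norm (grad \<sigma> x) * norm (P x)" by (rule Cauchy_Schwarz_ineq2)
    also have "\<dots> \<le> b * V" using \<sigma>(4)[OF x] P(2)[OF x] nn by (intro mult_mono) auto
    finally have "\<bar>H x - grad \<sigma> x \<bullet> P x\<bar> \<le> b * V + kH" using H(2)[OF x] by linarith
    moreover have "\<bar>q x\<bar> = \<bar>H x - grad \<sigma> x \<bullet> P x\<bar> / \<sigma> x"
      using \<sigma>(2)[OF x] \<sigma>(3) by (simp add: q_def)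
    ultimately show ?thesis
      using \<sigma>(2)[OF x] \<sigma>(3) nn by (auto intro!: frac_le)
  qed
  have iq: "integrable ?\<mu> (\<lambda>x. w x * q x)"
  proof -
    have "AE x in ?\<mu>. norm (q x) \<le> (b * V + kH) / s0" by (rule AE_I2) (simp add: qb in\<Omega>)
    from integrable_inner_bounded[OF iw _ this] show ?thesis by simp
  qed
  have iDwP: "integrable ?\<mu> (\<lambda>x. Dw x \<bullet> P x)"
    using P in\<Omega> by (intro integrable_inner_bounded[OF iDw, of _ V]) (auto intro: AE_I2)
  have weak: "\<And>w Dw. H10 \<Omega> w Dw \<Longrightarrow> (\<integral>x. Dw x \<bullet> (\<sigma> x *\<^sub>R P x) + H x * w x \<partial>?\<mu>) = 0"
    using J unfolding dual_feasible_def by blast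
  have "0 = (\<integral>x. ((1 / \<sigma> x) *\<^sub>R Dw x - (w x / (\<sigma> x)\<^sup>2) *\<^sub>R grad \<sigma> x) \<bullet> (\<sigma> x *\<^sub>R P x) + H x * (w x / \<sigma> x) \<partial>?\<mu>)"
    by (rule weak[OF H10_divide[OF \<Omega> w \<sigma>], symmetric])
  also have "\<dots> = (\<integral>x. Dw x \<bullet> P x + w x * q x \<partial>?\<mu>)"
  proof (rule Bochner_Integration.integral_cong[OF refl])
    fix x assume "x \<in> space ?\<mu>"
    then have s: "\<sigma> x \<noteq> 0" using \<sigma>(2)[OF in\<Omega>] \<sigma>(3) by force
    show "((1 / \<sigma> x) *\<^sub>R Dw x - (w x / (\<sigma> x)\<^sup>2) *\<^sub>R grad \<sigma> x) \<bullet> (\<sigma> x *\<^sub>R P x) + H x * (w x / \<sigma> x)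
        = Dw x \<bullet> P x + w x * q x"
      using s by (simp add: q_def inner_diff_left power2_eq_square field_simps)
  qed
  also have "\<dots> = (\<integral>x. Dw x \<bullet> P x \<partial>?\<mu>) + (\<integral>x. w x * q x \<partial>?\<mu>)"
    by (rule Bochner_Integration.integral_add[OF iDwP iq])
  finally have "\<bar>\<integral>x. Dw x \<bullet> P x \<partial>?\<mu>\<bar> = \<bar>\<integral>x. w x * q x \<partial>?\<mu>\<bar>" by simp
  also have "\<dots> \<le> (\<integral>x. \<bar>w x * q x\<bar> \<partial>?\<mu>)" by (rule integral_abs_bound)
  also have "\<dots> \<le> (\<integral>x. (b * V + kH) / s0 * \<bar>w x\<bar> \<partial>?\<mu>)"
  proof (rule integral_mono)
    fix x assume "x \<in> space ?\<mu>"
    then show "\<bar>w x * q x\<bar> \<le> (b * V + kH) / s0 * \<bar>w x\<bar>"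
      using mult_right_mono[OF qb[OF in\<Omega>], of x "\<bar>w x\<bar>"] by (simp add: abs_mult mult.commute)
  qed (use iq iw in auto)
  finally show ?thesis by simp
qed

section \<open>Cauchy-Schwarz and Lagrange's identity\<close>

lemma integral_le_sqrt:
  fixes f :: "real^2 \<Rightarrow> real"
  assumes \<Omega>: "\<Omega> \<in> lmeasurable" and f: "f \<in> borel_measurable (lebesgue_on \<Omega>)"
    and f2: "integrable (lebesgue_on \<Omega>) (\<lambda>x. (f x)\<^sup>2)"
  shows "(\<integral>x. \<bar>f x\<bar> \<partial>lebesgue_on \<Omega>) \<le> sqrt (measure lebesgue \<Omega> * (\<integral>x. (f x)\<^sup>2 \<partial>lebesgue_on \<Omega>))"
proof -
  let ?\<mu> = "lebesgue_on \<Omega>"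
  have fin: "emeasure ?\<mu> (space ?\<mu>) = ennreal (measure lebesgue \<Omega>)"
    using \<Omega> emeasure_eq_measure2[OF \<Omega>] by (simp add: emeasure_restrict_space fmeasurableD space_restrict_space)
  have L2: "L2_norm_sq \<Omega> f = ennreal (\<integral>x. (f x)\<^sup>2 \<partial>?\<mu>)"
    unfolding L2_norm_sq_def using f2 by (subst nn_integral_eq_integral[symmetric]) auto
  have i: "integrable ?\<mu> f"
    using f L2 by (intro integrable_L2[OF \<Omega>]) auto
  have "ennreal ((\<integral>x. \<bar>f x\<bar> \<partial>?\<mu>)\<^sup>2) = (\<integral>\<^sup>+x. 1 * ennreal \<bar>f x\<bar> \<partial>?\<mu>)\<^sup>2"
    using i by (simp add: nn_integral_eq_integral ennreal_power)
  also have "\<dots> \<le> (\<integral>\<^sup>+x. 1\<^sup>2 \<partial>?\<mu>) * (\<integral>\<^sup>+x. (ennreal \<bar>f x\<bar>)\<^sup>2 \<partial>?\<mu>)"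
    using f by (intro Cauchy_Schwarz_nn_integral) auto
  also have "\<dots> = ennreal (measure lebesgue \<Omega> * (\<integral>x. (f x)\<^sup>2 \<partial>?\<mu>))"
    using L2 fin by (simp add: ennreal_mult ennreal_power L2_norm_sq_def)
  finally have "(\<integral>x. \<bar>f x\<bar> \<partial>?\<mu>)\<^sup>2 \<le> measure lebesgue \<Omega> * (\<integral>x. (f x)\<^sup>2 \<partial>?\<mu>)"
    by (subst (asm) ennreal_le_iff) auto
  then show ?thesis by (rule real_le_rsqrt)
qed

text \<open>Lagrange's identity. Its right-hand side factors as a difference of squares, one factor
  being the misalignment |p| |q| - p \<bullet> q; this is where the first square root of \<delta>
  arises.\<close>

lemma plane_det_sq:
  "(plane_det p q)\<^sup>2 = (norm p)\<^sup>2 * (norm q)\<^sup>2 - (p \<bullet> q)\<^sup>2"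
proof -
  have "(norm r)\<^sup>2 = r $ 1 * r $ 1 + r $ 2 * r $ 2" for r :: "real^2"
    by (simp add: power2_norm_eq_inner inner_vec_def UNIV_2)
  then show ?thesis
    by (simp add: plane_det_def inner_vec_def UNIV_2 power2_eq_square algebra_simps)
qed

section \<open>The stability estimate\<close>

lemma Ck_norm_bound:
  assumes "Ck_norm k \<Omega> f \<le> ennreal B" "0 \<le> B" "i + j \<le> k" "x \<in> \<Omega>"
  shows "norm (multi_deriv i j f x) \<le> B"
proof -
  let ?s = "\<lambda>i j. SUP x\<in>\<Omega>. ennreal (norm (multi_deriv i j f x))"
  have "ennreal (norm (multi_deriv i j f x)) \<le> ?s i j"
    using assms(4) by (rule SUP_upper)
  also have "\<dots> \<le> (\<Sum>j\<le>k - i. ?s i j)"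
    using assms(3) by (intro member_le_sum) auto
  also have "\<dots> \<le> (\<Sum>i\<le>k. \<Sum>j\<le>k - i. ?s i j)"
    using assms(3) by (intro member_le_sum[of i "{..k}" "\<lambda>i. \<Sum>j\<le>k - i. ?s i j"]) auto
  also have "\<dots> \<le> ennreal B" using assms(1) by (simp add: Ck_norm_def)
  finally show ?thesis using assms(2) by (simp add: ennreal_le_iff)
qed

text \<open>The Euclidean norm is at most the sum of two partial derivatives, each bounded by B; the
  final constant therefore contains \<open>2 * \<sigma>2\<close>.\<close>

lemma Ck_norm_bound_grad:
  assumes "Ck_norm k \<Omega> f \<le> ennreal B" "0 \<le> B" "1 \<le> k" "x \<in> \<Omega>"
  shows "norm (grad f x) \<le> 2 * B"
proof -
  have "norm (grad f x) \<le> \<bar>grad f x $ 1\<bar> + \<bar>grad f x $ 2\<bar>"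
    using norm_le_l1_cart[of "grad f x"] by (simp add: UNIV_2)
  also have "\<dots> \<le> B + B"
    using Ck_norm_bound[OF assms(1,2) _ assms(4), of 1 0] Ck_norm_bound[OF assms(1,2) _ assms(4), of 0 1] assms(3)
    by (intro add_mono) (simp_all add: multi_deriv_def grad_def)
  finally show ?thesis by simp
qed

lemma admissible_field_bounds:
  assumes "admissible \<Omega> \<sigma>0 \<sigma>1 m M a F H u \<sigma>" "0 < m" "0 < \<sigma>0" "0 < \<sigma>1" "x \<in> \<Omega>"
  shows "m / \<sigma>1 \<le> norm (grad u x + F x)" "norm (grad u x + F x) \<le> M / \<sigma>0"
proof -
  have s: "\<sigma>0 \<le> \<sigma> x" "\<sigma> x \<le> \<sigma>1" and J: "m \<le> norm (\<sigma> x *\<^sub>R (grad u x + F x))" "norm (\<sigma> x *\<^sub>R (grad u x + F x)) \<le> M"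
    using assms(1,5) unfolding admissible_def Let_def by blast+
  have J': "m \<le> \<sigma> x * norm (grad u x + F x)" "\<sigma> x * norm (grad u x + F x) \<le> M"
    using J s assms(3) by simp_all
  have "\<sigma> x * norm (grad u x + F x) \<le> \<sigma>1 * norm (grad u x + F x)"
    "\<sigma>0 * norm (grad u x + F x) \<le> \<sigma> x * norm (grad u x + F x)"
    using s by (intro mult_right_mono; simp)+
  with J' assms(3,4) show "m / \<sigma>1 \<le> norm (grad u x + F x)" "norm (grad u x + F x) \<le> M / \<sigma>0"
    by (simp_all add: field_simps)
qed

text \<open>Extracts the curves that \<open>level_set_transport\<close> consumes. The curve lies in
  \<Omega> except at its start on the boundary, so continuity of w up to the closure is what carries
  its boundary value 0 along the curve.\<close>

lemma well_structured_path:
  assumes ws: "well_structured \<Omega> Kt v" and w: "continuous_on (closure \<Omega>) w" "\<And>x. x \<in> frontier \<Omega> \<Longrightarrow> w x = 0"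
  shows "AE x in lebesgue_on \<Omega>. \<exists>(s0::real) \<gamma>. 0 < s0 \<and> continuous_on {0..s0} (\<lambda>s. w (\<gamma> s)) \<and>
    w (\<gamma> 0) = 0 \<and> \<gamma> s0 = x \<and> (\<forall>s\<in>{0<..s0}. \<gamma> s \<in> \<Omega> \<and> v (\<gamma> s) = v x)"
proof -
  obtain R where "AE x in lebesgue_on \<Omega>. \<exists>s0 \<gamma>. 0 < s0 \<and> level_curve_param \<Omega> v x s0 \<gamma> \<and>
        (\<forall>s\<in>{0..s0}. norm (vector_derivative \<gamma> (at s)) = 1) \<and>
        (\<forall>h. norm h = 1 \<longrightarrow>
          (\<exists>\<Gamma> B.
             (\<forall>\<^sub>F t in at 0. level_curve_param \<Omega> v (x + t *\<^sub>R h) s0 (\<Gamma> t) \<and>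
                (\<forall>s\<in>{0..s0}. norm (vector_derivative (\<Gamma> t) (at s) - vector_derivative \<gamma> (at s))
                   \<le> Kt * \<bar>t\<bar>)) \<and>
             (\<forall>s\<in>{0..s0}. ((\<lambda>t. (\<Gamma> t s - \<gamma> s) /\<^sub>R t) \<longlongrightarrow> B s) (at 0) \<and> norm (B s) \<le> R)))"
    using ws unfolding well_structured_def by (rule exE)
  then show ?thesis
  proof eventually_elim
    case (elim x)
    then have "\<exists>s0 \<gamma>. 0 < s0 \<and> level_curve_param \<Omega> v x s0 \<gamma>" by blast
    then obtain s0 \<gamma> where s0: "0 < s0" and \<gamma>: "\<gamma> C1_differentiable_on {0..s0}" "\<gamma> 0 \<in> frontier \<Omega>" "\<gamma> s0 = x"
       "\<gamma> ` {0<..s0} \<subseteq> level_curve \<Omega> v x"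
      unfolding level_curve_param_def by blast
    have on: "\<gamma> s \<in> \<Omega> \<and> v (\<gamma> s) = v x" if "s \<in> {0<..s0}" for s
      using \<gamma>(4) that connected_component_subset[of "{y \<in> \<Omega>. v y = v x}" x]
      unfolding level_curve_def by blast
    have "\<gamma> s \<in> closure \<Omega>" if "s \<in> {0..s0}" for s
    proof (cases "s = 0")
      case True
      then show ?thesis using \<gamma>(2) by (simp add: frontier_def)
    next
      case False
      then show ?thesis using on[of s] that closure_subset by auto
    qed
    then have "continuous_on {0..s0} (\<lambda>s. w (\<gamma> s))"
      by (intro continuous_on_compose2[OF w(1) C1_differentiable_imp_continuous_on[OF \<gamma>(1)]]) auto
    with s0 \<gamma> on w(2) show ?case by blast
  qed
qed

text \<open>The nested constant, read from inside: the inner square root bounds the mean of the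
  Jacobian; \<open>8 * K / c\<close> turns it into the mean of |w|; twice (\<open>\<sigma>2\<close>
  V + k2) / \<open>\<sigma>0\<close> gives the energy of \<nabla>w; the outer square root its mean;
  the factors A / c and |M| / c^2 come from the quotient \<sigma> = a / |\<nabla>v|.\<close>

lemma stability_estimate:
  fixes \<Omega> :: "(real^2) set"
  assumes \<Omega>: "open \<Omega>" "bounded \<Omega>"
    and pos: "0 < m" "0 < \<sigma>0" "0 < \<sigma>1" "0 < k2" "0 < \<sigma>2" "0 \<le> K"
    and a: "a \<in> borel_measurable (lebesgue_on \<Omega>)" "AE x in lebesgue_on \<Omega>. m \<le> a x \<and> a x \<le> M"
    and a': "a' \<in> borel_measurable (lebesgue_on \<Omega>)" "AE x in lebesgue_on \<Omega>. m \<le> a' x \<and> a' x \<le> M"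
    and f: "Ck_on 1 \<Omega> f" "\<And>x. x \<in> \<Omega> \<Longrightarrow> F x = grad f x"
    and u: "admissible \<Omega> \<sigma>0 \<sigma>1 m M a F H u \<sigma>" and u': "admissible \<Omega> \<sigma>0 \<sigma>1 m M a' F H u' \<sigma>'"
    and bd: "\<And>x. x \<in> frontier \<Omega> \<Longrightarrow> u x = u' x"
    and reg: "continuous_on \<Omega> F" "continuous_on \<Omega> H" "Ck_on 1 \<Omega> \<sigma>" "Ck_on 1 \<Omega> \<sigma>'"
    and bounds: "\<And>x. x \<in> \<Omega> \<Longrightarrow> norm (F x) \<le> k2" "\<And>x. x \<in> \<Omega> \<Longrightarrow> \<bar>H x\<bar> \<le> k2"
      "\<And>x. x \<in> \<Omega> \<Longrightarrow> norm (grad \<sigma> x) \<le> \<sigma>2" "\<And>x. x \<in> \<Omega> \<Longrightarrow> norm (grad \<sigma>' x) \<le> \<sigma>2"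
    and K: "\<And>t. hausdorff1 {x\<in>\<Omega>. u x + f x = t} \<le> ennreal K"
    and ws: "well_structured \<Omega> Kt (\<lambda>x. u x + f x)"
    and \<delta>: "AE x in lebesgue_on \<Omega>. \<bar>a x - a' x\<bar> \<le> \<delta>" "0 \<le> \<delta>"
    and A: "A = measure lebesgue \<Omega>" and c: "c = m / \<sigma>1" and V: "V = \<bar>M\<bar> / \<sigma>0"
  shows "L1_norm \<Omega> (\<lambda>x. \<sigma> x - \<sigma>' x) \<le> ennreal (A / c * \<delta> + \<bar>M\<bar> / c\<^sup>2 *
    sqrt (A * (2 * ((\<sigma>2 * V + k2) / \<sigma>0) * (8 * K / c * sqrt (2 * V ^ 3 * A\<^sup>2 / \<sigma>0 * \<delta>)))))"
proof -
  let ?\<mu> = "lebesgue_on \<Omega>"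
  have \<Omega>m: "\<Omega> \<in> lmeasurable" using \<Omega> by (simp add: lmeasurable_open)
  have in\<Omega>: "x \<in> \<Omega>" if "x \<in> space ?\<mu>" for x using that by (simp add: space_restrict_space)
  have AE\<Omega>: "AE x in ?\<mu>. x \<in> \<Omega>" by (rule AE_I2) (rule in\<Omega>)
  have A0: "0 \<le> A" by (simp add: A)
  have c0: "0 < c" and V0: "0 \<le> V" using pos by (auto simp: c V)
  have ab: "AE x in ?\<mu>. 0 \<le> a x \<and> a x \<le> M" "AE x in ?\<mu>. 0 \<le> a' x \<and> a' x \<le> M"
    subgoal using a(2) by eventually_elim (use pos(1) in auto)
    subgoal using a'(2) by eventually_elim (use pos(1) in auto)
    done
  define P P' w where "P x = grad u x + F x" and "P' x = grad u' x + F x" and "w x = u x - u' x" for x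
  have cP: "c \<le> norm (P x)" "c \<le> norm (P' x)" and VP: "norm (P x) \<le> V" "norm (P' x) \<le> V" if x: "x \<in> \<Omega>" for x
  proof -
    \<comment> \<open>The absolute value in V keeps it nonnegative even for empty \<Omega>, where
      nothing forces M to be positive.\<close>
    have "M / \<sigma>0 \<le> V" using pos by (simp add: V divide_right_mono)
    then show "c \<le> norm (P x)" "c \<le> norm (P' x)" "norm (P x) \<le> V" "norm (P' x) \<le> V"
      using admissible_field_bounds[OF u pos(1-3) x] admissible_field_bounds[OF u' pos(1-3) x]
      by (auto simp: c P_def P'_def)
  qed
  have adm: "Ck_on 1 \<Omega> u" "continuous_on (closure \<Omega>) u" "primal_solution \<Omega> a F H u (grad u)"
      "dual_solution \<Omega> a F H (\<lambda>x. \<sigma> x *\<^sub>R (grad u x + F x))" "\<And>x. x \<in> \<Omega> \<Longrightarrow> \<sigma>0 \<le> \<sigma> x"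
    using u unfolding admissible_def Ck_closure_def Let_def by blast+
  have adm': "Ck_on 1 \<Omega> u'" "continuous_on (closure \<Omega>) u'" "primal_solution \<Omega> a' F H u' (grad u')"
      "dual_solution \<Omega> a' F H (\<lambda>x. \<sigma>' x *\<^sub>R (grad u' x + F x))" "\<And>x. x \<in> \<Omega> \<Longrightarrow> \<sigma>0 \<le> \<sigma>' x"
    using u' unfolding admissible_def Ck_closure_def Let_def by blast+
  have \<sigma>pos: "0 \<le> \<sigma> x" "0 \<le> \<sigma>' x" if "x \<in> \<Omega>" for x
    using adm(5)[OF that] adm'(5)[OF that] pos(2) by simp_all
  note uD = Ck_on_1D[OF adm(1) \<Omega>(1)] and u'D = Ck_on_1D[OF adm'(1) \<Omega>(1)] and fD = Ck_on_1D[OF f(1) \<Omega>(1)]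
  have contP: "continuous_on \<Omega> P" "continuous_on \<Omega> P'"
    unfolding P_def P'_def using uD(2) u'D(2) reg(1) by (auto intro: continuous_on_add)
  have cont_meas: "g \<in> borel_measurable ?\<mu>" if "continuous_on \<Omega> g" for g :: "real^2 \<Rightarrow> 'z::euclidean_space"
    using that \<Omega> by (intro continuous_imp_measurable_on_sets_lebesgue) auto
  have cont\<sigma>: "continuous_on \<Omega> \<sigma>" "continuous_on \<Omega> \<sigma>'"
    using Ck_on_Suc_imp[of 0 \<Omega> \<sigma>] Ck_on_Suc_imp[of 0 \<Omega> \<sigma>'] reg(3,4) by (simp_all del: Ck_on.simps(2) add: One_nat_def)
  have mF: "F \<in> borel_measurable ?\<mu>" "AE x in ?\<mu>. norm (F x) \<le> k2"
    and mH: "H \<in> borel_measurable ?\<mu>" "AE x in ?\<mu>. norm (H x) \<le> k2"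
    using reg(1,2) AE\<Omega> bounds(1,2) by (auto intro: cont_meas elim!: eventually_mono)
  note [measurable] = cont_meas[OF contP(1)] cont_meas[OF contP(2)] a(1) a'(1) mF(1) mH(1)
    cont_meas[OF cont\<sigma>(1)] cont_meas[OF cont\<sigma>(2)]

  have Ja: "AE x in ?\<mu>. norm (\<sigma> x *\<^sub>R (grad u x + F x)) = a x"
    by (rule flux_norm_eq[OF \<Omega>m adm(3,4) a(1) ab(1) mF mH c0 cP(1)[unfolded P_def] \<sigma>pos(1)])
  have J'a: "AE x in ?\<mu>. norm (\<sigma>' x *\<^sub>R (grad u' x + F x)) = a' x"
    by (rule flux_norm_eq[OF \<Omega>m adm'(3,4) a'(1) ab(2) mF mH c0 cP(2)[unfolded P'_def] \<sigma>pos(2)])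
  have H10u: "H10 \<Omega> u (grad u)" "H10 \<Omega> u' (grad u')"
    using adm(3) adm'(3) by (simp_all add: primal_solution_def)
  have Jf: "dual_feasible \<Omega> a H (\<lambda>x. \<sigma> x *\<^sub>R P x)" "dual_feasible \<Omega> a' H (\<lambda>x. \<sigma>' x *\<^sub>R P' x)"
    using adm(4) adm'(4) by (simp_all add: dual_solution_def P_def P'_def)

  \<comment> \<open>|P| |P'| times 1 minus the cosine of the angle between them: the misalignment of
    the gradients.\<close>
  define D where "D x = norm (P x) * norm (P' x) - P x \<bullet> P' x" for x
  have "\<sigma>0 * (\<integral>x. D x \<partial>?\<mu>) \<le> \<delta> * V * A"
    using flux_alignment[OF \<Omega>m adm(3) H10u(2) Jf(2)[unfolded P'_def] J'a a(1) ab(1) a'(1) ab(2) \<delta>(1) mF mH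
        VP(1)[unfolded P_def] VP(2)[unfolded P'_def] V0 pos(2) adm'(5)]
    by (simp add: D_def P_def P'_def A)
  then have D_int: "(\<integral>x. D x \<partial>?\<mu>) \<le> \<delta> * V * A / \<sigma>0"
    using pos(2) by (simp add: field_simps)
  have D_le: "0 \<le> D x" "D x \<le> 2 * V\<^sup>2" if x: "x \<in> \<Omega>" for x
  proof -
    show "0 \<le> D x" using norm_cauchy_schwarz[of "P x" "P' x"] by (simp add: D_def)
    have "norm (P x) * norm (P' x) \<le> V * V" using VP[OF x] V0 by (intro mult_mono) auto
    moreover have "\<bar>P x \<bullet> P' x\<bar> \<le> norm (P x) * norm (P' x)" by (rule Cauchy_Schwarz_ineq2)
    ultimately show "D x \<le> 2 * V\<^sup>2" by (simp add: D_def power2_eq_square)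
  qed
  have contD: "continuous_on \<Omega> D" unfolding D_def by (intro continuous_intros contP)
  have iD: "integrable ?\<mu> D"
    by (rule integrable_continuous_bounded[OF \<Omega> contD, of "2 * V\<^sup>2"]) (simp add: D_le)

  \<comment> \<open>The Jacobian of (v, w). Subtracting P' from P changes the determinant with P
    only in sign, so the misalignment D controls it.\<close>
  define X where "X x = plane_det (P x) (P x - P' x)" for x
  have X_alt: "X x = - plane_det (P x) (P' x)" for x
    by (simp add: X_def plane_det_def algebra_simps)
  have contX: "continuous_on \<Omega> X"
    unfolding X_def plane_det_def by (intro continuous_intros contP)
  have X2: "(X x)\<^sup>2 \<le> 2 * V\<^sup>2 * D x" if x: "x \<in> \<Omega>" for x
  proof -
    have "(X x)\<^sup>2 = (norm (P x) * norm (P' x) + P x \<bullet> P' x) * D x"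
      unfolding X_alt power2_minus plane_det_sq D_def by (simp add: power2_eq_square algebra_simps)
    also have "\<dots> \<le> (2 * V\<^sup>2) * D x"
    proof (rule mult_right_mono[OF _ D_le(1)[OF x]])
      have "norm (P x) * norm (P' x) \<le> V * V" using VP[OF x] V0 by (intro mult_mono) auto
      moreover have "P x \<bullet> P' x \<le> norm (P x) * norm (P' x)" by (rule norm_cauchy_schwarz)
      ultimately show "norm (P x) * norm (P' x) + P x \<bullet> P' x \<le> 2 * V\<^sup>2" by (simp add: power2_eq_square)
    qed
    finally show ?thesis .
  qed
  have X2b: "(X x)\<^sup>2 \<le> 2 * V\<^sup>2 * (2 * V\<^sup>2)" if x: "x \<in> \<Omega>" for x
    by (rule order_trans[OF X2[OF x] mult_left_mono[OF D_le(2)[OF x]]]) simp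
  have Xb: "\<bar>X x\<bar> \<le> 2 * V\<^sup>2" if x: "x \<in> \<Omega>" for x
  proof (rule power2_le_imp_le)
    show "\<bar>X x\<bar>\<^sup>2 \<le> (2 * V\<^sup>2)\<^sup>2"
      using X2b[OF x] unfolding power2_abs power2_eq_square[of "2 * V\<^sup>2"] .
  qed simp
  have iX2: "integrable ?\<mu> (\<lambda>x. (X x)\<^sup>2)"
    by (rule integrable_continuous_bounded[OF \<Omega> _, of _ "2 * V\<^sup>2 * (2 * V\<^sup>2)"])
      (use X2b contX in \<open>auto intro!: continuous_intros\<close>)
  have iX: "integrable ?\<mu> (\<lambda>x. \<bar>X x\<bar>)"
    by (rule integrable_continuous_bounded[OF \<Omega> _, of _ "2 * V\<^sup>2"])
      (use Xb contX in \<open>auto intro!: continuous_intros\<close>)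
  define Xi where "Xi = (\<integral>x. \<bar>X x\<bar> \<partial>?\<mu>)"
  have "(\<integral>x. (X x)\<^sup>2 \<partial>?\<mu>) \<le> (\<integral>x. 2 * V\<^sup>2 * D x \<partial>?\<mu>)"
    using iX2 iD X2 in\<Omega> by (intro integral_mono) auto
  also have "\<dots> \<le> 2 * V\<^sup>2 * (\<delta> * V * A / \<sigma>0)"
    unfolding integral_mult_right_zero by (rule mult_left_mono[OF D_int]) simp
  finally have "A * (\<integral>x. (X x)\<^sup>2 \<partial>?\<mu>) \<le> A * (2 * V\<^sup>2 * (\<delta> * V * A / \<sigma>0))"
    using A0 by (rule mult_left_mono)
  also have "\<dots> = 2 * V ^ 3 * A\<^sup>2 / \<sigma>0 * \<delta>"
    by (simp add: power2_eq_square power3_eq_cube)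
  finally have Xi: "Xi \<le> sqrt (2 * V ^ 3 * A\<^sup>2 / \<sigma>0 * \<delta>)"
    using integral_le_sqrt[OF \<Omega>m cont_meas[OF contX] iX2] unfolding Xi_def A
    by (meson order_trans real_sqrt_le_mono)

  have wD: "(w has_derivative (\<lambda>h. (P x - P' x) \<bullet> h)) (at x)" if "x \<in> \<Omega>" for x
    using has_derivative_diff[OF uD(1)[OF that] u'D(1)[OF that]]
    by (simp add: w_def[abs_def] P_def P'_def inner_diff_left)
  have vD: "((\<lambda>x. u x + f x) has_derivative (\<lambda>h. P x \<bullet> h)) (at x)" if "x \<in> \<Omega>" for x
    using has_derivative_add[OF uD(1)[OF that] fD(1)[OF that]]
    by (simp add: P_def f(2)[OF that] inner_add_left)
  have contw: "continuous_on (closure \<Omega>) w"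
    unfolding w_def by (intro continuous_on_diff adm(2) adm'(2))
  have w0: "w x = 0" if "x \<in> frontier \<Omega>" for x using bd[OF that] by (simp add: w_def)
  have H10w: "H10 \<Omega> w (\<lambda>x. P x - P' x)"
    using H10_lincomb[OF H10u, of "-1"] by (simp add: w_def[abs_def] P_def P'_def)
  have iw: "integrable ?\<mu> w"
    using H10_L2_finite[OF \<Omega>m H10w] H10_measurable[OF H10w] by (auto intro!: integrable_L2[OF \<Omega>m])
  define W where "W = (\<integral>x. \<bar>w x\<bar> \<partial>?\<mu>)"
  have "ennreal (c / 4) * (\<integral>\<^sup>+x. ennreal \<bar>w x\<bar> \<partial>?\<mu>)
      \<le> 2 * ennreal K * (\<integral>\<^sup>+x. ennreal \<bar>X x\<bar> \<partial>?\<mu>)"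
    unfolding X_def
    by (rule level_set_transport[OF \<Omega> vD wD contP(1) _ Xb[unfolded X_def] cP(1) c0 K
          well_structured_path[OF ws contw w0]])
      (auto intro!: continuous_intros contP)
  also have "(\<integral>\<^sup>+x. ennreal \<bar>w x\<bar> \<partial>?\<mu>) = ennreal W"
    unfolding W_def using iw by (intro nn_integral_eq_integral) auto
  also have "(\<integral>\<^sup>+x. ennreal \<bar>X x\<bar> \<partial>?\<mu>) = ennreal Xi"
    unfolding Xi_def using iX by (intro nn_integral_eq_integral) auto
  finally have le: "ennreal (c / 4) * ennreal W \<le> 2 * ennreal K * ennreal Xi" .
  have "ennreal (c / 4 * W) = ennreal (c / 4) * ennreal W"
    using c0 by (intro ennreal_mult) (auto simp: W_def)
  also note le
  also have "2 * ennreal K * ennreal Xi = ennreal (2 * K * Xi)"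
    using pos(6) by (simp add: ennreal_mult Xi_def)
  finally have "c / 4 * W \<le> 2 * K * Xi"
    using pos(6) by (subst (asm) ennreal_le_iff) (auto simp: Xi_def)
  \<comment> \<open>2 K from the coarea inequality divided by its c / 4.\<close>
  then have W: "W \<le> 8 * K / c * Xi" using c0 by (simp add: field_simps)

  define b where "b = (\<sigma>2 * V + k2) / \<sigma>0"
  have b0: "0 \<le> b" using pos V0 by (simp add: b_def)
  have E1: "\<bar>\<integral>x. (P x - P' x) \<bullet> P x \<partial>?\<mu>\<bar> \<le> b * W"
    unfolding b_def W_def
    by (rule flux_weak_divided[OF \<Omega> H10w Jf(1) reg(3) adm(5) pos(2) bounds(3) cont_meas[OF contP(1)] VP(1) mH(1) bounds(2)])
      (use V0 pos in auto)
  have E2: "\<bar>\<integral>x. (P x - P' x) \<bullet> P' x \<partial>?\<mu>\<bar> \<le> b * W"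
    unfolding b_def W_def
    by (rule flux_weak_divided[OF \<Omega> H10w Jf(2) reg(4) adm'(5) pos(2) bounds(4) cont_meas[OF contP(2)] VP(2) mH(1) bounds(2)])
      (use V0 pos in auto)
  define d where "d x = norm (P x - P' x)" for x
  have contd: "continuous_on \<Omega> d" unfolding d_def by (intro continuous_intros contP)
  have db: "d x \<le> 2 * V" if "x \<in> \<Omega>" for x
    using norm_triangle_ineq4[of "P x" "P' x"] VP[OF that] by (simp add: d_def)
  have id: "integrable ?\<mu> d"
    by (rule integrable_continuous_bounded[OF \<Omega> contd, of "2 * V"]) (use db in \<open>auto simp: d_def\<close>)
  have id2: "integrable ?\<mu> (\<lambda>x. (d x)\<^sup>2)"
  proof (rule integrable_continuous_bounded[OF \<Omega>])
    show "norm ((d x)\<^sup>2) \<le> (2 * V)\<^sup>2" if "x \<in> \<Omega>" for x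
      using power_mono[OF db[OF that], of 2] by (simp add: d_def)
  qed (intro continuous_intros contd)
  have iPP: "integrable ?\<mu> (\<lambda>x. (P x - P' x) \<bullet> Q x)"
    if "Q \<in> borel_measurable ?\<mu>" "\<And>x. x \<in> \<Omega> \<Longrightarrow> norm (Q x) \<le> V" for Q
  proof -
    have "integrable ?\<mu> (\<lambda>x. P x - P' x)"
      by (rule integrable_continuous_bounded[OF \<Omega>, of _ "2 * V"])
        (use db in \<open>auto simp: d_def intro!: continuous_intros contP\<close>)
    moreover have "AE x in ?\<mu>. norm (Q x) \<le> V"
      using AE\<Omega> by eventually_elim (rule that(2))
    ultimately show ?thesis by (rule integrable_inner_bounded[OF _ that(1)])
  qed
  \<comment> \<open>Each of the two terms is a divided weak equation tested with the same w, so both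
    are bounded by b W.\<close>
  have "(\<integral>x. (d x)\<^sup>2 \<partial>?\<mu>) = (\<integral>x. (P x - P' x) \<bullet> P x - (P x - P' x) \<bullet> P' x \<partial>?\<mu>)"
    by (simp add: d_def power2_norm_eq_inner inner_diff_right)
  also have "\<dots> = (\<integral>x. (P x - P' x) \<bullet> P x \<partial>?\<mu>) - (\<integral>x. (P x - P' x) \<bullet> P' x \<partial>?\<mu>)"
    by (intro Bochner_Integration.integral_diff iPP cont_meas contP VP)
  also have "\<dots> \<le> 2 * b * W" using E1 E2 by linarith
  finally have E: "A * (\<integral>x. (d x)\<^sup>2 \<partial>?\<mu>) \<le> A * (2 * b * W)"
    using A0 by (rule mult_left_mono)
  also have "\<dots> \<le> A * (2 * b * (8 * K / c * sqrt (2 * V ^ 3 * A\<^sup>2 / \<sigma>0 * \<delta>)))"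
  proof (intro mult_left_mono A0)
    have "W \<le> 8 * K / c * sqrt (2 * V ^ 3 * A\<^sup>2 / \<sigma>0 * \<delta>)"
      using W mult_left_mono[OF Xi, of "8 * K / c"] pos(6) c0 by simp
    then show "W \<le> 8 * K / c * sqrt (2 * V ^ 3 * A\<^sup>2 / \<sigma>0 * \<delta>)" .
  qed (use b0 in simp)
  finally have "(\<integral>x. \<bar>d x\<bar> \<partial>?\<mu>) \<le> sqrt (A * (2 * b * (8 * K / c * sqrt (2 * V ^ 3 * A\<^sup>2 / \<sigma>0 * \<delta>))))"
    using integral_le_sqrt[OF \<Omega>m cont_meas[OF contd] id2] unfolding A
    by (meson order_trans real_sqrt_le_mono)
  then have Y: "(\<integral>x. d x \<partial>?\<mu>) \<le> sqrt (A * (2 * b * (8 * K / c * sqrt (2 * V ^ 3 * A\<^sup>2 / \<sigma>0 * \<delta>))))"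
    by (simp add: d_def)

  have ptw: "AE x in ?\<mu>. \<bar>\<sigma> x - \<sigma>' x\<bar> \<le> \<delta> / c + \<bar>M\<bar> / c\<^sup>2 * d x"
    using Ja J'a \<delta>(1) ab(2) AE\<Omega>
  proof eventually_elim
    case (elim x)
    define p p' where "p = norm (P x)" and "p' = norm (P' x)"
    have p: "c \<le> p" "c \<le> p'" "0 < p" "0 < p'"
      using cP[OF elim(5)] c0 by (auto simp: p_def p'_def)
    have s: "\<sigma> x = a x / p" "\<sigma>' x = a' x / p'"
    proof -
      have "a x = \<sigma> x * p" "a' x = \<sigma>' x * p'"
        using elim(1,2) \<sigma>pos[OF elim(5)] by (simp_all add: P_def P'_def p_def p'_def)
      then show "\<sigma> x = a x / p" "\<sigma>' x = a' x / p'" using p by simp_all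
    qed
    \<comment> \<open>Separates the change of a, at most \<delta>, from the change of the gradient
      length, at most \<open>d x\<close>.\<close>
    have eq: "\<sigma> x - \<sigma>' x = (a x - a' x) / p + a' x * (p' - p) / (p * p')"
      unfolding s using p by (simp add: field_simps)
    have "\<bar>(a x - a' x) / p\<bar> = \<bar>a x - a' x\<bar> / p" using p by simp
    also have "\<dots> \<le> \<delta> / c" using elim(3) p c0 \<delta>(2) by (intro frac_le) auto
    finally have 1: "\<bar>(a x - a' x) / p\<bar> \<le> \<delta> / c" .
    have "\<bar>p' - p\<bar> \<le> d x"
      using norm_triangle_ineq3[of "P' x" "P x"] by (simp add: p_def p'_def d_def norm_minus_commute)
    then have "\<bar>a' x * (p' - p)\<bar> \<le> \<bar>M\<bar> * d x"
      unfolding abs_mult using elim(4) by (intro mult_mono) auto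
    moreover have "c\<^sup>2 \<le> p * p'"
      unfolding power2_eq_square using p c0 by (intro mult_mono) auto
    ultimately have "\<bar>a' x * (p' - p)\<bar> / (p * p') \<le> \<bar>M\<bar> * d x / c\<^sup>2"
      using c0 by (intro frac_le) (auto simp: d_def)
    then have "\<bar>a' x * (p' - p) / (p * p')\<bar> \<le> \<bar>M\<bar> / c\<^sup>2 * d x"
      using p by (simp add: abs_mult)
    with 1 show ?case unfolding eq by linarith
  qed
  have ic: "integrable ?\<mu> (\<lambda>x. \<delta> / c)"
    by (rule integrable_bounded[OF \<Omega>m, of _ "\<bar>\<delta> / c\<bar>"]) auto
  have icd: "integrable ?\<mu> (\<lambda>x. \<delta> / c + \<bar>M\<bar> / c\<^sup>2 * d x)"
    by (intro Bochner_Integration.integrable_add integrable_mult_right ic id)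
  have "L1_norm \<Omega> (\<lambda>x. \<sigma> x - \<sigma>' x) \<le> (\<integral>\<^sup>+x. ennreal (\<delta> / c + \<bar>M\<bar> / c\<^sup>2 * d x) \<partial>?\<mu>)"
    unfolding L1_norm_def using ptw by (intro nn_integral_mono_AE) (auto elim!: eventually_mono intro!: ennreal_leI)
  also have "\<dots> = ennreal (\<integral>x. \<delta> / c + \<bar>M\<bar> / c\<^sup>2 * d x \<partial>?\<mu>)"
    by (rule nn_integral_eq_integral[OF icd]) (use \<delta>(2) c0 in \<open>simp add: d_def\<close>)
  also have "(\<integral>x. \<delta> / c + \<bar>M\<bar> / c\<^sup>2 * d x \<partial>?\<mu>) = A / c * \<delta> + \<bar>M\<bar> / c\<^sup>2 * (\<integral>x. d x \<partial>?\<mu>)"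
  proof -
    have "measure ?\<mu> \<Omega> = A"
      using \<Omega>m by (simp add: A measure_restrict_space fmeasurableD)
    then show ?thesis
      using id ic by (subst Bochner_Integration.integral_add) auto
  qed
  also have "\<dots> \<le> A / c * \<delta> + \<bar>M\<bar> / c\<^sup>2 *
      sqrt (A * (2 * b * (8 * K / c * sqrt (2 * V ^ 3 * A\<^sup>2 / \<sigma>0 * \<delta>))))"
    using Y by (intro add_left_mono mult_left_mono) auto
  finally show ?thesis unfolding b_def by (simp add: ennreal_leI)
qed

theorem theorem2p12:
  fixes \<Omega> :: "(real^2) set" and m M k1 k2 K Kt \<sigma>0 \<sigma>1 \<sigma>2 :: real
  assumes "open \<Omega>" "connected \<Omega>" "bounded \<Omega>" "lipschitz_boundary \<Omega>"
    and "0 < m" "0 < \<sigma>0" "0 < \<sigma>1" "0 < k2" "0 < \<sigma>2" "0 \<le> K"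
  shows "\<exists>C::real. \<forall>a a' f F H u u' \<sigma> \<sigma>'.
    a \<in> borel_measurable (lebesgue_on \<Omega>) \<and> (AE x in lebesgue_on \<Omega>. m \<le> a x \<and> a x \<le> M) \<and>
    a' \<in> borel_measurable (lebesgue_on \<Omega>) \<and> (AE x in lebesgue_on \<Omega>. m \<le> a' x \<and> a' x \<le> M) \<and>
    Ck_on 1 \<Omega> f \<and> continuous_on (closure \<Omega>) f \<and> (\<forall>x\<in>\<Omega>. F x = grad f x) \<and>
    L1_norm \<Omega> F \<le> ennreal k1 \<and>
    admissible \<Omega> \<sigma>0 \<sigma>1 m M a F H u \<sigma> \<and> admissible \<Omega> \<sigma>0 \<sigma>1 m M a' F H u' \<sigma>' \<and>
    (\<forall>x\<in>frontier \<Omega>. u x = 0 \<and> u' x = 0) \<and>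
    Ck_closure 2 \<Omega> F \<and> Ck_closure 1 \<Omega> H \<and> Ck_closure 2 \<Omega> \<sigma> \<and> Ck_closure 2 \<Omega> \<sigma>' \<and>
    Ck_norm 2 \<Omega> F \<le> ennreal k2 \<and> Ck_norm 1 \<Omega> H \<le> ennreal k2 \<and>
    Ck_norm 2 \<Omega> \<sigma> \<le> ennreal \<sigma>2 \<and> Ck_norm 2 \<Omega> \<sigma>' \<le> ennreal \<sigma>2 \<and>
    (SUP t. hausdorff1 {x\<in>\<Omega>. u x + f x = t}) = ennreal K \<and>
    well_structured \<Omega> Kt (\<lambda>x. u x + f x)
    \<longrightarrow> L1_norm \<Omega> (\<lambda>x. \<sigma> x - \<sigma>' x)
          \<le> ennreal (C * enn2real (Linf_norm \<Omega> (\<lambda>x. a x - a' x)) powr (1/4))"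
proof -
  define A c V where "A = measure lebesgue \<Omega>" and "c = m / \<sigma>1" and "V = \<bar>M\<bar> / \<sigma>0"
  define B where "B = A * (2 * ((2 * \<sigma>2 * V + k2) / \<sigma>0) * (8 * K / c * sqrt (2 * V ^ 3 * A\<^sup>2 / \<sigma>0)))"
  \<comment> \<open>The term linear in \<delta> is absorbed into the power 1/4 by \<delta> \<le>
    |M|, which leaves |M| to the power 3/4.\<close>
  define C where "C = A / c * \<bar>M\<bar> powr (3/4) + \<bar>M\<bar> / c\<^sup>2 * sqrt B"
  have A0: "0 \<le> A" and c0: "0 < c" and V0: "0 \<le> V" using assms by (auto simp: A_def c_def V_def)
  show ?thesis
  proof (intro exI[of _ C] allI impI, elim conjE)
    fix a a' f F H u u' \<sigma> \<sigma>'
    assume a: "a \<in> borel_measurable (lebesgue_on \<Omega>)" "AE x in lebesgue_on \<Omega>. m \<le> a x \<and> a x \<le> M"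
      and a': "a' \<in> borel_measurable (lebesgue_on \<Omega>)" "AE x in lebesgue_on \<Omega>. m \<le> a' x \<and> a' x \<le> M"
      and f: "Ck_on 1 \<Omega> f" "\<forall>x\<in>\<Omega>. F x = grad f x"
      and u: "admissible \<Omega> \<sigma>0 \<sigma>1 m M a F H u \<sigma>" and u': "admissible \<Omega> \<sigma>0 \<sigma>1 m M a' F H u' \<sigma>'"
      and bd: "\<forall>x\<in>frontier \<Omega>. u x = 0 \<and> u' x = 0"
      and reg: "Ck_closure 2 \<Omega> F" "Ck_closure 1 \<Omega> H" "Ck_closure 2 \<Omega> \<sigma>" "Ck_closure 2 \<Omega> \<sigma>'"
      and norms: "Ck_norm 2 \<Omega> F \<le> ennreal k2" "Ck_norm 1 \<Omega> H \<le> ennreal k2"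
        "Ck_norm 2 \<Omega> \<sigma> \<le> ennreal \<sigma>2" "Ck_norm 2 \<Omega> \<sigma>' \<le> ennreal \<sigma>2"
      and K: "(SUP t. hausdorff1 {x\<in>\<Omega>. u x + f x = t}) = ennreal K"
      and ws: "well_structured \<Omega> Kt (\<lambda>x. u x + f x)"
    define L where "L = Linf_norm \<Omega> (\<lambda>x. a x - a' x)"
    define \<delta> where "\<delta> = enn2real L"
    \<comment> \<open>Both coefficients lie between m > 0 and M. The essential supremum is therefore
      finite, so \<open>enn2real\<close> preserves it.\<close>
    have diff: "AE x in lebesgue_on \<Omega>. \<bar>a x - a' x\<bar> \<le> \<bar>M\<bar>"
      using a(2) a'(2) by eventually_elim (use assms(5) in auto)
    have L: "L \<le> ennreal \<bar>M\<bar>"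
      unfolding L_def Linf_norm_def using diff a(1) a'(1)
      by (intro esssup_I) (auto elim!: eventually_mono intro!: ennreal_leI)
    then have \<delta>M: "0 \<le> \<delta>" "\<delta> \<le> \<bar>M\<bar>" by (auto simp: \<delta>_def enn2real_leI)
    have "AE x in lebesgue_on \<Omega>. ennreal (norm (a x - a' x)) \<le> L"
      unfolding L_def Linf_norm_def by (rule esssup_AE)
    then have \<delta>: "AE x in lebesgue_on \<Omega>. \<bar>a x - a' x\<bar> \<le> \<delta>"
    proof eventually_elim
      case (elim x)
      have "L < top" using L by (simp add: order_le_less_trans)
      then have "enn2real (ennreal (norm (a x - a' x))) \<le> enn2real L"
        using elim by (intro enn2real_mono)
      then show ?case by (simp add: \<delta>_def)
    qed
    have cont: "continuous_on \<Omega> F" "continuous_on \<Omega> H"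
      using reg(1,2) by (auto simp: Ck_closure_def intro: continuous_on_subset[OF _ closure_subset])
    have C1: "Ck_on 1 \<Omega> \<sigma>" "Ck_on 1 \<Omega> \<sigma>'"
      by (rule Ck_on_antimono[of 2]; use reg(3,4) in \<open>simp add: Ck_closure_def\<close>)+
    have bounds: "norm (F x) \<le> k2" "\<bar>H x\<bar> \<le> k2" "norm (grad \<sigma> x) \<le> 2 * \<sigma>2" "norm (grad \<sigma>' x) \<le> 2 * \<sigma>2"
      if x: "x \<in> \<Omega>" for x
      using Ck_norm_bound[OF norms(1) _ _ x, of 0 0] Ck_norm_bound[OF norms(2) _ _ x, of 0 0]
        Ck_norm_bound_grad[OF norms(3) _ _ x] Ck_norm_bound_grad[OF norms(4) _ _ x] assms(8,9)
      by (simp_all add: multi_deriv_def)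
    have Kt: "hausdorff1 {x\<in>\<Omega>. u x + f x = t} \<le> ennreal K" for t
      unfolding K[symmetric] by (rule SUP_upper) simp
    have "L1_norm \<Omega> (\<lambda>x. \<sigma> x - \<sigma>' x) \<le> ennreal (A / c * \<delta> + \<bar>M\<bar> / c\<^sup>2 *
        sqrt (A * (2 * ((2 * \<sigma>2 * V + k2) / \<sigma>0) * (8 * K / c * sqrt (2 * V ^ 3 * A\<^sup>2 / \<sigma>0 * \<delta>)))))"
      using bd f(2) assms
      by (intro stability_estimate[OF _ _ _ _ _ _ _ _ a a' f(1) _ u u' _ cont C1 bounds Kt ws \<delta> \<delta>M(1) A_def c_def V_def]) auto
    also have "A * (2 * ((2 * \<sigma>2 * V + k2) / \<sigma>0) * (8 * K / c * sqrt (2 * V ^ 3 * A\<^sup>2 / \<sigma>0 * \<delta>))) = B * sqrt \<delta>"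
      unfolding B_def by (simp only: real_sqrt_mult mult_ac)
    \<comment> \<open>The two nested square roots, with \<delta> pulled out of each.\<close>
    also have "sqrt (B * sqrt \<delta>) = sqrt B * \<delta> powr (1/4)"
      using \<delta>M(1) by (simp add: real_sqrt_mult powr_half_sqrt[symmetric] powr_powr)
    also have "A / c * \<delta> + \<bar>M\<bar> / c\<^sup>2 * (sqrt B * \<delta> powr (1/4)) \<le> C * \<delta> powr (1/4)"
    proof -
      have "\<delta> = \<delta> powr (3/4) * \<delta> powr (1/4)"
        using \<delta>M(1) by (simp add: powr_add[symmetric])
      also have "\<dots> \<le> \<bar>M\<bar> powr (3/4) * \<delta> powr (1/4)"
        using \<delta>M by (intro mult_right_mono powr_mono2) auto
      finally have "A / c * \<delta> \<le> A / c * (\<bar>M\<bar> powr (3/4) * \<delta> powr (1/4))"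
        using A0 c0 by (intro mult_left_mono) auto
      then show ?thesis by (simp add: C_def algebra_simps)
    qed
    finally show "L1_norm \<Omega> (\<lambda>x. \<sigma> x - \<sigma>' x)
        \<le> ennreal (C * enn2real (Linf_norm \<Omega> (\<lambda>x. a x - a' x)) powr (1/4))"
      by (simp add: ennreal_leI \<delta>_def L_def)
  qed
qed

end
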